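(* Let $L\ge 0$ and $T>0$ be given. Let $\Phi$ be an admissible DGF, let $\tilde{\boldsymbol k}=(\tilde k_1,\tilde k_2,\tilde k_3)\in\mathbb{R}_{>0}^3$ be a normalized parameter triple with respect to $\Phi$, and suppose that $\hat{\mathbb T}(\Phi,\tilde{\boldsymbol k},0)\le \tilde T$ for some $\tilde T>0$. For some $\gamma>L$ define $\boldsymbol k=(k_1,k_2,k_3)$ by $$k_1=\tilde k_1\sqrt{\gamma},\qquad k_2=\tilde k_2\,\gamma,\qquad k_3=\frac{\tilde k_3\sqrt{\gamma}}{\gamma-L}\cdot\frac{\tilde T}{T}.$$ Then the global convergence time of the differentiator satisfies $\hat{\mathbb T}(\Phi,\boldsymbol k,L)\le T$.
   Context: A locally absolutely continuous function $\Phi:\mathbb{R}\to\mathbb{R}$ is a Differentiator Generating Function (DGF) if: (i) $\Phi$ is odd; (ii) $\Phi$ and $\Phi'$ are continuously differentiable on $\mathbb{R}\setminus\{0\}$; (iii) $\Phi'(x)>0$ for all $x\ne0$; (iv) $\lim_{x\to0}|\Phi'(x)|=\infty$; (v) $\lim_{x\to0}\left|\frac{2\Phi'(x)^3}{\Phi''(x)}\right|=1$. A DGF $\Phi$ is admissible if there exist constants $B>0$, $C>0$, $D\ge1$ such that (a) $\int_0^\infty\frac{1}{B\Phi(x)}\,dx\le1$; (b) $C\Phi'(x)\ge1$ for all $x\ne0$; (c) $2D|\Phi'(x)|^3\ge|\Phi''(x)|$ for all $x\ne0$. A triple $\boldsymbol k=(k_1,k_2,k_3)\in\mathbb{R}_{>0}^3$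 is normalized with respect to an admissible DGF $\Phi$ if there exists $D\ge 1$ satisfying (c), i.e. $D\ge\sup_{x\neq 0}\frac{|\Phi''(x)|}{2|\Phi'(x)|^3}$, such that $\overline L\ge1$, where $$\overline L=\begin{cases}\frac{k_2}{D}&\text{if }k_1^2\ge8k_2,\\[2pt] \frac{k_2}{D}\tanh\frac{\pi k_1}{2\sqrt{8k_2-k_1^2}}&\text{if }k_1^2<8k_2.\end{cases}$$ For $\epsilon>0$ put $\Phi_\epsilon(x)=\epsilon^{-1}\Phi(\epsilon^2x)$. Let $f:\mathbb{R}_{\ge0}\to\mathbb{R}$ be continuously differentiable with Lipschitz continuous $\dot f$ and $|\ddot f(t)|\le L$ for almost all $t$. The differentiator with input $f$ is $\dot y_1=k_1\Phi_{k_3}(f-y_1)+y_2$, $\dot y_2=2k_2\Phi_{k_3}(f-y_1)\Phi_{k_3}'(f-y_1)$, with output $y=y_2$. With errors $x_1=f-y_1$, $x_2=\dot f-y_2$, its error system is $$\dot x_1=-k_1\Phi_{k_3}(x_1)+x_2,\qquad \dot x_2=-2k_2\Phi_{k_3}(x_1)\Phi_{k_3}'(x_1)+\ddot f,$$ with solutions understood in the sense of Filippov (for $x_1=0$ the second equation reads $\dot x_2\in[-k_2,k_2]+\ddot f$). For a solution $\boldsymbol x(\cdot,\boldsymbol x_0,f)$ with $\boldsymbol x(0)=\boldsymbol x_0\in\mathbb{R}^2$, its convergence time is $\tau(\boldsymbol x_0,f)=\inf\{t\ge0:\boldsymbol x(\sigma,\boldsymbol x_0,f)=0\ \forall\sigma\ge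 t\}$ ($\inf\emptyset=\infty$). The convergence time function is $T_L^{\Phi,\boldsymbol k}(\boldsymbol x_0)=\sup_{|\ddot f|\le L}\tau(\boldsymbol x_0,f)$ (the supremum is over all such $f$ and, if solutions are not unique, also over all solutions), and the global convergence time is $\hat{\mathbb T}(\Phi,\boldsymbol k,L)=\sup_{\boldsymbol x_0\in\mathbb{R}^2}T_L^{\Phi,\boldsymbol k}(\boldsymbol x_0)\in[0,\infty]$. *)

theory Defs
  imports "HOL-Analysis.Analysis"
begin

section \<open>Local absolute continuity\<close>

(* The epsilon-delta definition; \<D> ranges over the finite families of nonoverlapping
   compact subintervals K = {Inf K..Sup K} of {a..b}. *)
definition absolutely_cont_on_interval ::
    "(real \<Rightarrow> 'a::real_normed_vector) \<Rightarrow> real \<Rightarrow> real \<Rightarrow> bool" where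
  "absolutely_cont_on_interval f a b \<longleftrightarrow>
     (\<forall>\<epsilon>>0. \<exists>\<delta>>0. \<forall>\<D>. \<D> division_of \<Union>\<D> \<and> \<Union>\<D> \<subseteq> {a..b} \<and> (\<Sum>K\<in>\<D>. Sup K - Inf K) < \<delta>
        \<longrightarrow> (\<Sum>K\<in>\<D>. norm (f (Sup K) - f (Inf K))) < \<epsilon>)"

definition locally_absolutely_cont_on ::
    "(real \<Rightarrow> 'a::real_normed_vector) \<Rightarrow> real set \<Rightarrow> bool" where
  "locally_absolutely_cont_on f S \<longleftrightarrow>
     (\<forall>a b. a \<le> b \<and> {a..b} \<subseteq> S \<longrightarrow> absolutely_cont_on_interval f a b)"

section \<open>Differentiator generating functions\<close>

definition DGF :: "(real \<Rightarrow> real) \<Rightarrow> bool" where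
  "DGF \<Phi> \<longleftrightarrow>
     locally_absolutely_cont_on \<Phi> UNIV \<and>
     (\<forall>x. \<Phi> (- x) = - \<Phi> x) \<and>
     \<Phi> C1_differentiable_on (- {0}) \<and>
     deriv \<Phi> C1_differentiable_on (- {0}) \<and>
     (\<forall>x. x \<noteq> 0 \<longrightarrow> deriv \<Phi> x > 0) \<and>
     filterlim (\<lambda>x. \<bar>deriv \<Phi> x\<bar>) at_top (at 0) \<and>
     ((\<lambda>x. \<bar>2 * deriv \<Phi> x ^ 3 / deriv (deriv \<Phi>) x\<bar>) \<longlongrightarrow> 1) (at 0)"

definition curvature_bound :: "(real \<Rightarrow> real) \<Rightarrow> real \<Rightarrow> bool" where
  "curvature_bound \<Phi> D \<longleftrightarrow>
     D \<ge> 1 \<and> (\<forall>x. x \<noteq> 0 \<longrightarrow> 2 * D * \<bar>deriv \<Phi> x\<bar> ^ 3 \<ge> \<bar>deriv (deriv \<Phi>) x\<bar>)"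

definition admissible_DGF :: "(real \<Rightarrow> real) \<Rightarrow> bool" where
  "admissible_DGF \<Phi> \<longleftrightarrow>
     DGF \<Phi> \<and>
     (\<exists>B C D. B > 0 \<and> C > 0 \<and>
        (\<integral>\<^sup>+ x\<in>{0<..}. ennreal (1 / (B * \<Phi> x)) \<partial>lborel) \<le> 1 \<and>
        (\<forall>x. x \<noteq> 0 \<longrightarrow> C * deriv \<Phi> x \<ge> 1) \<and>
        curvature_bound \<Phi> D)"

definition L_bar :: "real \<Rightarrow> real \<Rightarrow> real \<Rightarrow> real" where
  "L_bar D k1 k2 =
     (if k1\<^sup>2 \<ge> 8 * k2 then k2 / D
      else k2 / D * tanh (pi * k1 / (2 * sqrt (8 * k2 - k1\<^sup>2))))"

definition normalized :: "(real \<Rightarrow> real) \<Rightarrow> real \<Rightarrow> real \<Rightarrow> real \<Rightarrow> bool" where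
  "normalized \<Phi> k1 k2 k3 \<longleftrightarrow>
     k1 > 0 \<and> k2 > 0 \<and> k3 > 0 \<and> (\<exists>D. curvature_bound \<Phi> D \<and> L_bar D k1 k2 \<ge> 1)"

definition scaled :: "(real \<Rightarrow> real) \<Rightarrow> real \<Rightarrow> real \<Rightarrow> real" where
  "scaled \<Phi> \<epsilon> x = \<Phi> (\<epsilon>\<^sup>2 * x) / \<epsilon>"

section \<open>Filippov solutions\<close>

definition filippov_set :: "('a::euclidean_space \<Rightarrow> 'a) \<Rightarrow> 'a \<Rightarrow> 'a set" where
  "filippov_set g x =
     (\<Inter>\<delta>\<in>{0<..}. \<Inter>N\<in>{N. negligible N}. closure (convex hull (g ` (ball x \<delta> - N))))"

definition filippov_solution ::
    "(real \<Rightarrow> 'a::euclidean_space \<Rightarrow> 'a) \<Rightarrow> (real \<Rightarrow> 'a) \<Rightarrow> bool" where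
  "filippov_solution g x \<longleftrightarrow>
     locally_absolutely_cont_on x {0..} \<and>
     (AE t in lebesgue. t \<ge> 0 \<longrightarrow>
        (\<exists>v \<in> filippov_set (g t) (x t). (x has_vector_derivative v) (at t within {0..})))"

section \<open>The differentiator and its convergence time\<close>

text \<open>Functions of time live on \<^term>\<open>{0::real..}\<close>; their values at negative times are irrelevant.\<close>

definition time_deriv :: "(real \<Rightarrow> real) \<Rightarrow> real \<Rightarrow> real" where
  "time_deriv f t = vector_derivative f (at t within {0..})"

definition input_signal :: "real \<Rightarrow> (real \<Rightarrow> real) \<Rightarrow> bool" where
  "input_signal L f \<longleftrightarrow>
     f differentiable_on {0..} \<and>
     continuous_on {0..} (time_deriv f) \<and>
     (\<exists>M. M-lipschitz_on {0..} (time_deriv f)) \<and>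
     (AE t in lebesgue. t \<ge> 0 \<longrightarrow>
        time_deriv f differentiable (at t within {0..}) \<and>
        \<bar>time_deriv (time_deriv f) t\<bar> \<le> L)"

(* Right-hand side of the differential equation for the errors x1 = f - y1, x2 = f' - y2 of the
   differentiator y1' = k1 \<Phi>_k3(f - y1) + y2, y2' = 2 k2 \<Phi>_k3(f - y1) \<Phi>_k3'(f - y1).
   On the null set x1 = 0, where \<Phi>_k3' need not exist, the value is immaterial: it does not
   affect the Filippov set, whose second component there is the interval [-k2, k2] + f''(t). *)
definition error_field ::
    "(real \<Rightarrow> real) \<Rightarrow> real \<Rightarrow> real \<Rightarrow> real \<Rightarrow> (real \<Rightarrow> real) \<Rightarrow> real \<Rightarrow> real \<times> real \<Rightarrow> real \<times> real"
  where
  "error_field \<Phi> k1 k2 k3 f t = (\<lambda>(x1, x2).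
     (- k1 * scaled \<Phi> k3 x1 + x2,
      - 2 * k2 * scaled \<Phi> k3 x1 * deriv (scaled \<Phi> k3) x1 + time_deriv (time_deriv f) t))"

definition error_solution ::
    "(real \<Rightarrow> real) \<Rightarrow> real \<Rightarrow> real \<Rightarrow> real \<Rightarrow> (real \<Rightarrow> real) \<Rightarrow> real \<times> real \<Rightarrow> (real \<Rightarrow> real \<times> real) \<Rightarrow> bool"
  where
  "error_solution \<Phi> k1 k2 k3 f x0 x \<longleftrightarrow>
     filippov_solution (error_field \<Phi> k1 k2 k3 f) x \<and> x 0 = x0"

definition convergence_time :: "(real \<Rightarrow> real \<times> real) \<Rightarrow> ennreal" where
  "convergence_time x = (INF t\<in>{t. t \<ge> 0 \<and> (\<forall>\<sigma>\<ge>t. x \<sigma> = 0)}. ennreal t)"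

definition convergence_time_function ::
    "(real \<Rightarrow> real) \<Rightarrow> real \<Rightarrow> real \<Rightarrow> real \<Rightarrow> real \<Rightarrow> real \<times> real \<Rightarrow> ennreal" where
  "convergence_time_function \<Phi> k1 k2 k3 L x0 =
     (SUP f\<in>{f. input_signal L f}. SUP x\<in>{x. error_solution \<Phi> k1 k2 k3 f x0 x}.
        convergence_time x)"

definition global_convergence_time ::
    "(real \<Rightarrow> real) \<Rightarrow> real \<Rightarrow> real \<Rightarrow> real \<Rightarrow> real \<Rightarrow> ennreal" where
  "global_convergence_time \<Phi> k1 k2 k3 L = (SUP x0. convergence_time_function \<Phi> k1 k2 k3 L x0)"

end

theory Submission
  imports Defs
begin

text \<open>
  Let \<open>a\<close>, \<open>b = 2 k\<^sub>2'\<close> be the normalized parameters. In the coordinates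
  \<open>(\<Phi>(k\<^sub>3\<^sup>2 x\<^sub>1), k\<^sub>3 x\<^sub>2 / sqrt \<gamma>)\<close> the unperturbed error system is, up to a change of time
  \<open>dt = G(z\<^sub>1) d\<tau>\<close> with \<open>G = (\<Phi>\<^sup>-\<^sup>1)'\<close>, the linear system \<open>z\<^sub>1' = - a z\<^sub>1 + z\<^sub>2\<close>, \<open>z\<^sub>2' = - b z\<^sub>1\<close>.
  Its settling time \<open>V(z) = \<integral> G(z\<^sub>1(\<tau>)) d\<tau>\<close> serves as a Lyapunov function. By hypothesis
  it is bounded by \<open>k\<^sub>3' T'\<close>. Condition (c) says that \<open>G\<close> is \<open>2D\<close>-Lipschitz, so in the direction
  of \<open>z\<^sub>2\<close> the Lipschitz constant of \<open>V\<close> is at most \<open>2D \<integral> \<bar>h\<bar>\<close>, \<open>h\<close> being the impulse response of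
  the linear system, and this number is \<open>1 / L_bar \<le> 1\<close>. Hence a perturbation bounded by \<open>L\<close> slows
  the decrease of \<open>V\<close> down by at most the factor \<open>(\<gamma> - L) / \<gamma>\<close>, which the choice of \<open>k\<^sub>3\<close> compensates.
\<close>

section \<open>Absolutely continuous functions\<close>

text \<open>The delicate place is the line x1 = 0, near which \<Phi>' is unbounded and across which
  the error field jumps. The coordinate z1 is not a Lipschitz function of x1 there, so V along a
  solution is not known to be absolutely continuous across this line. Crossings away from the origin
  are isolated, however, since x1' = x2 is nonzero there; as V is continuous, the decrease proved
  between crossings extends over them. To first order a solution leaves the flow in the direction of
  z2 alone. Hence the Lipschitz constant in that direction must be sharp, while any finite constant
  will do for z1. The hypothesis speaks of Filippov solutions, so it bounds V only once the
  time-changed linear trajectory is known to be one. In real time the second state moves at a speed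
  proportional to |z1| / G(z1), and condition (v) keeps this bounded near crossings. Absolute
  continuity is turned into increment bounds directly, by divisions fine with respect to a
  gauge.\<close>

lemma AC_intervalD:
  assumes "absolutely_cont_on_interval f a b" "0 < e"
  obtains d where "d > 0"
    "\<And>\<D>. \<lbrakk>\<D> division_of \<Union>\<D>; \<Union>\<D> \<subseteq> {a..b}; (\<Sum>K\<in>\<D>. Sup K - Inf K) < d\<rbrakk>
       \<Longrightarrow> (\<Sum>K\<in>\<D>. norm (f (Sup K) - f (Inf K))) < e"
  using assms unfolding absolutely_cont_on_interval_def by meson

lemma division_real_memberE:
  assumes "\<D> division_of S" "K \<in> \<D>"
  obtains u v :: real where "K = {u..v}" "u \<le> v" "Inf K = u" "Sup K = v" "u \<in> S" "v \<in> S"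
proof -
  obtain u v where K: "K = {u..v}" "K \<noteq> {}" "K \<subseteq> S"
    using assms by (metis division_ofD(2,3,4) box_real(2))
  then show ?thesis by (intro that[of u v]) auto
qed

lemma AC_interval_continuous:
  assumes "absolutely_cont_on_interval f a b"
  shows "continuous_on {a..b} f"
  unfolding continuous_on_iff
proof (intro ballI allI impI)
  fix t e :: real assume t: "t \<in> {a..b}" and e: "0 < e"
  obtain d where d: "d > 0"
    "\<And>\<D>. \<lbrakk>\<D> division_of \<Union>\<D>; \<Union>\<D> \<subseteq> {a..b}; (\<Sum>K\<in>\<D>. Sup K - Inf K) < d\<rbrakk>
       \<Longrightarrow> (\<Sum>K\<in>\<D>. norm (f (Sup K) - f (Inf K))) < e"
    using AC_intervalD[OF assms e] by blast
  have "dist (f s) (f t) < e" if s: "s \<in> {a..b}" "dist s t < d" for s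
  proof -
    let ?D = "{{min s t..max s t}}"
    have 1: "?D division_of \<Union>?D"
      using division_of_self[of "min s t" "max s t"] by (simp add: box_real)
    have "(\<Sum>K\<in>?D. norm (f (Sup K) - f (Inf K))) < e"
      by (rule d(2)[OF 1]) (use s t in \<open>auto simp: dist_real_def max_def min_def\<close>)
    then show ?thesis
      by (auto simp: dist_norm max_def min_def norm_minus_commute split: if_splits)
  qed
  then show "\<exists>d>0. \<forall>x'\<in>{a..b}. dist x' t < d \<longrightarrow> dist (f x') (f t) < e"
    using d(1) by blast
qed

lemma AC_interval_dominated:
  assumes x: "absolutely_cont_on_interval x a b" and C: "C \<ge> 0"
    and F: "\<And>u v. \<lbrakk>a \<le> u; u \<le> v; v \<le> b\<rbrakk> \<Longrightarrow> norm (F v - F u) \<le> C * norm (x v - x u)"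
  shows "absolutely_cont_on_interval F a b"
  unfolding absolutely_cont_on_interval_def
proof (intro allI impI)
  fix e :: real assume "e > 0"
  \<comment> \<open>Dividing by \<open>C + 1\<close> covers \<open>C = 0\<close> as well and leaves
    room for the strict inequality.\<close>
  then have e: "e / (C + 1) > 0" using C by simp
  obtain d where d: "d > 0"
    "\<And>\<D>. \<lbrakk>\<D> division_of \<Union>\<D>; \<Union>\<D> \<subseteq> {a..b}; (\<Sum>K\<in>\<D>. Sup K - Inf K) < d\<rbrakk>
       \<Longrightarrow> (\<Sum>K\<in>\<D>. norm (x (Sup K) - x (Inf K))) < e / (C + 1)"
    using AC_intervalD[OF x e] by blast
  have "(\<Sum>K\<in>\<D>. norm (F (Sup K) - F (Inf K))) < e"
    if D: "\<D> division_of \<Union>\<D>" "\<Union>\<D> \<subseteq> {a..b}" "(\<Sum>K\<in>\<D>. Sup K - Inf K) < d" for \<D>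
  proof -
    have "(\<Sum>K\<in>\<D>. norm (F (Sup K) - F (Inf K))) \<le> (\<Sum>K\<in>\<D>. (C + 1) * norm (x (Sup K) - x (Inf K)))"
    proof (rule sum_mono)
      fix K assume "K \<in> \<D>"
      then obtain u v where K: "u \<le> v" "Inf K = u" "Sup K = v" "u \<in> \<Union>\<D>" "v \<in> \<Union>\<D>"
        using division_real_memberE[OF D(1)] by metis
      have "norm (F v - F u) \<le> C * norm (x v - x u)"
        using K D(2) by (intro F) auto
      then show "norm (F (Sup K) - F (Inf K)) \<le> (C + 1) * norm (x (Sup K) - x (Inf K))"
        using K by (simp add: distrib_right add_increasing2)
    qed
    also have "\<dots> = (C + 1) * (\<Sum>K\<in>\<D>. norm (x (Sup K) - x (Inf K)))"
      by (simp add: sum_distrib_left)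
    also have "\<dots> < (C + 1) * (e / (C + 1))"
      using d(2)[OF D] C by (intro mult_strict_left_mono) auto
    finally show ?thesis using C by simp
  qed
  then show "\<exists>d>0. \<forall>\<D>. \<D> division_of \<Union>\<D> \<and> \<Union>\<D> \<subseteq> {a..b} \<and> (\<Sum>K\<in>\<D>. Sup K - Inf K) < d
     \<longrightarrow> (\<Sum>K\<in>\<D>. norm (F (Sup K) - F (Inf K))) < e"
    using d(1) by blast
qed

text \<open>Through \<open>AC_interval_dominated\<close> this makes every Lipschitz function of time
  absolutely continuous.\<close>

lemma AC_interval_id: "absolutely_cont_on_interval (\<lambda>t. t) a b"
  unfolding absolutely_cont_on_interval_def
proof (intro allI impI)
  fix e :: real assume "e > 0"
  have "(\<Sum>K\<in>\<D>. norm (Sup K - Inf K)) = (\<Sum>K\<in>\<D>. Sup K - Inf K)"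
    if D: "\<D> division_of \<Union>\<D>" for \<D> :: "real set set"
  proof (rule sum.cong)
    fix K assume "K \<in> \<D>"
    then obtain u v where "u \<le> v" "Inf K = u" "Sup K = v"
      using division_real_memberE[OF D] by metis
    then show "norm (Sup K - Inf K) = Sup K - Inf K" by simp
  qed simp
  then show "\<exists>d>0. \<forall>\<D>. \<D> division_of \<Union>\<D> \<and> \<Union>\<D> \<subseteq> {a..b} \<and> (\<Sum>K\<in>\<D>. Sup K - Inf K) < d
     \<longrightarrow> (\<Sum>K\<in>\<D>. norm (Sup K - Inf K)) < e"
    using \<open>e > 0\<close> by (intro exI[of _ e]) auto
qed

lemma locally_AC_continuous:
  assumes f: "locally_absolutely_cont_on f {0..}"
  shows "continuous_on {0..} f"
  unfolding continuous_on_eq_continuous_within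
proof
  fix t :: real assume t: "t \<in> {0..}"
  have "continuous_on {0..t+1} f"
    using f t by (intro AC_interval_continuous) (auto simp: locally_absolutely_cont_on_def)
  then have "continuous (at t within {0..t+1}) f"
    using t by (simp add: continuous_on_eq_continuous_within)
  moreover have "at t within {0..t+1} = at t within {0..}"
    by (rule at_within_nhd[of _ "{..<t+1}"]) auto
  ultimately show "continuous (at t within {0..}) f"
    by (simp add: continuous_within)
qed

text \<open>Compactness in gauge form: on a division fine with respect to the local radii every
  piece satisfies the bound, and the increments telescope. Halving the radii makes a piece inside
  the ball shorter than \<open>d t\<close>.\<close>

lemma increment_le_of_local:
  fixes F :: "real \<Rightarrow> real"
  assumes ab: "a \<le> b"
    and loc: "\<And>t. t \<in> {a..b} \<Longrightarrow> \<exists>d>0. \<forall>u v. a \<le> u \<and> u \<le> t \<and> t \<le> v \<and> v \<le> b \<and> v - u < d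
       \<longrightarrow> F v - F u \<le> c * (v - u)"
  shows "F b - F a \<le> c * (b - a)"
proof -
  have "\<forall>t. \<exists>d>0. t \<in> {a..b} \<longrightarrow> (\<forall>u v. a \<le> u \<and> u \<le> t \<and> t \<le> v \<and> v \<le> b \<and> v - u < d
       \<longrightarrow> F v - F u \<le> c * (v - u))"
    using loc zero_less_one by metis
  then obtain d where d: "\<And>t. d t > 0"
      "\<And>t u v. \<lbrakk>t \<in> {a..b}; a \<le> u; u \<le> t; t \<le> v; v \<le> b; v - u < d t\<rbrakk>
         \<Longrightarrow> F v - F u \<le> c * (v - u)"
    by metis
  have "gauge (\<lambda>t. ball t (d t / 2))" using d(1) by (auto simp: gauge_def)
  then obtain p where p: "p tagged_division_of {a..b}" "(\<lambda>t. ball t (d t / 2)) fine p"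
    using fine_division_exists_real by blast
  have "F b - F a = (\<Sum>(t, K)\<in>p. F (Sup K) - F (Inf K))"
    by (simp add: additive_tagged_division_1[OF ab p(1)])
  also have "\<dots> \<le> (\<Sum>(t, K)\<in>p. c * (Sup K - Inf K))"
  proof (rule sum_mono, clarify)
    fix t K assume tK: "(t, K) \<in> p"
    then obtain u v where K: "K = {u..v}" using p(1) by (metis tagged_division_ofD(4) box_real(2))
    have sub: "t \<in> K" "K \<subseteq> {a..b}" using tagged_division_ofD(2,3)[OF p(1) tK] by auto
    have K': "u \<le> t" "t \<le> v" "a \<le> u" "v \<le> b" "Inf K = u" "Sup K = v"
      using sub K by auto
    have "K \<subseteq> ball t (d t / 2)" using p(2) tK by (auto simp: fine_def)
    moreover have "u \<in> K" "v \<in> K" using K K' by auto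
    ultimately have "u \<in> ball t (d t / 2)" "v \<in> ball t (d t / 2)" by blast+
    then have "v - u < d t" using K' by (auto simp: dist_real_def)
    then show "F (Sup K) - F (Inf K) \<le> c * (Sup K - Inf K)"
      using d(2)[of t u v] K' by simp
  qed
  also have "\<dots> = c * (b - a)"
    using additive_tagged_division_1[OF ab p(1), of "\<lambda>t. c * t"] by (simp add: right_diff_distrib)
  finally show ?thesis .
qed

text \<open>Links the tagged divisions produced by gauges with the untagged ones in the definition
  of absolute continuity. Different tags can share an interval only if it is a single point, and
  there \<open>d\<close> vanishes.\<close>

lemma sum_tagged_division_real:
  fixes d :: "real set \<Rightarrow> 'a::comm_monoid_add"
  assumes q: "q tagged_division_of S" and d: "\<And>u. d {u} = 0"
  shows "(\<Sum>(t, K)\<in>q. d K) = (\<Sum>K\<in>snd ` q. d K)"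
proof -
  let ?d = "\<lambda>K. if K = {} then 0 else d K"
  have ne: "K \<noteq> {}" if "(t, K) \<in> q" for t K
    using tagged_division_ofD(2)[OF q that] by auto
  have "(\<Sum>(t, K)\<in>q. d K) = (\<Sum>(t, K)\<in>q. ?d K)"
    by (rule sum.cong) (use ne in auto)
  also have "\<dots> = (\<Sum>K\<in>snd ` q. ?d K)"
  proof (rule sum.over_tagged_division_lemma[OF q])
    fix u v :: real assume "box u v = {}"
    then have "cbox u v = {} \<or> cbox u v = {u}" by (auto simp: box_real)
    then show "?d (cbox u v) = 0" using d by auto
  qed
  also have "\<dots> = (\<Sum>K\<in>snd ` q. d K)"
    by (rule sum.cong) (use ne in auto)
  finally show ?thesis .
qed

text \<open>Choose a tagged division fine with respect to a gauge that confines the intervals tagged in \<open>N\<close>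
  to an open set of small measure: absolute continuity controls their contribution.\<close>

lemma AC_increment_le:
  fixes F :: "real \<Rightarrow> real"
  assumes ab: "a \<le> b" and AC: "absolutely_cont_on_interval F a b" and N: "negligible N"
    and good: "\<And>t \<eta>. \<lbrakk>t \<in> {a..b} - N; \<eta> > 0\<rbrakk> \<Longrightarrow>
       \<exists>d>0. \<forall>u v. a \<le> u \<and> u \<le> t \<and> t \<le> v \<and> v \<le> b \<and> v - u < d
         \<longrightarrow> F v - F u \<le> (c + \<eta>) * (v - u)"
  shows "F b - F a \<le> c * (b - a)"
proof -
  have main: "F b - F a \<le> c * (b - a) + e * (b - a + 2)" if e: "0 < e" "e \<le> 1" for e
  proof -
    obtain \<delta> where \<delta>: "\<delta> > 0"
      "\<And>\<D>. \<lbrakk>\<D> division_of \<Union>\<D>; \<Union>\<D> \<subseteq> {a..b}; (\<Sum>K\<in>\<D>. Sup K - Inf K) < \<delta>\<rbrakk>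
         \<Longrightarrow> (\<Sum>K\<in>\<D>. norm (F (Sup K) - F (Inf K))) < e"
      using AC_intervalD[OF AC e(1)] by blast
    \<comment> \<open>The second bound keeps the correction
      \<open>(\<bar>c\<bar> - c) * (Sup K - Inf K)\<close>, summed over the intervals tagged in
      \<open>N\<close>, below \<open>e\<close>.\<close>
    define \<delta>' where "\<delta>' = min \<delta> (e / (2 * (\<bar>c\<bar> + 1)))"
    have \<delta>': "\<delta>' > 0" "\<delta>' \<le> \<delta>" "(2 * (\<bar>c\<bar> + 1)) * \<delta>' \<le> e"
      proof -
      have "0 < e / (2 * (\<bar>c\<bar> + 1))" using e by simp
      then show "\<delta>' > 0" "\<delta>' \<le> \<delta>" using \<delta>(1) by (auto simp: \<delta>'_def)
      have "(2 * (\<bar>c\<bar> + 1)) * \<delta>' \<le> (2 * (\<bar>c\<bar> + 1)) * (e / (2 * (\<bar>c\<bar> + 1)))"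
        by (intro mult_left_mono) (auto simp: \<delta>'_def)
      also have "\<dots> = e" by simp
      finally show "(2 * (\<bar>c\<bar> + 1)) * \<delta>' \<le> e" .
    qed
    obtain U where U: "open U" "N \<subseteq> U" "U - N \<in> lmeasurable" "emeasure lebesgue (U - N) < ennreal \<delta>'"
      using sets_lebesgue_outer_open[of N \<delta>'] N \<delta>'(1) by (metis negligible_imp_sets)
    have Nn: "N \<in> null_sets lebesgue" using N negligible_iff_null_sets by blast
    have "emeasure lebesgue U = emeasure lebesgue (U - N)"
      using emeasure_Diff_null_set[OF Nn, of U] U(1) by (simp add: borel_open)
    with U have Um: "emeasure lebesgue U < ennreal \<delta>'" by simp
    have Ul: "U \<in> lmeasurable"
      using U(1) Um by (intro fmeasurableI) (auto simp: borel_open less_top intro: order.strict_trans)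
    have Umu: "measure lebesgue U < \<delta>'"
      using Um Ul \<delta>'(1) by (metis emeasure_eq_measure2 ennreal_less_iff measure_nonneg)
    have "\<exists>d>0. t \<in> {a..b} - N \<longrightarrow> (\<forall>u v. a \<le> u \<and> u \<le> t \<and> t \<le> v \<and> v \<le> b \<and> v - u < d
         \<longrightarrow> F v - F u \<le> (c + e) * (v - u))" for t
      using good[of t e] e(1) zero_less_one by metis
    then obtain d where d: "\<And>t. d t > 0"
        "\<And>t u v. \<lbrakk>t \<in> {a..b} - N; a \<le> u; u \<le> t; t \<le> v; v \<le> b; v - u < d t\<rbrakk>
           \<Longrightarrow> F v - F u \<le> (c + e) * (v - u)"
      by metis
    define g where "g t = (if t \<in> N then U else ball t (d t / 2))" for t
    have "gauge g" using d(1) U by (auto simp: gauge_def g_def)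
    then obtain p where p: "p tagged_division_of {a..b}" "g fine p"
      using fine_division_exists_real by blast
    define q where "q = {(t, K) \<in> p. t \<in> N}"
    have fin: "finite p" using p(1) by blast
    have mem: "\<exists>u v. K = {u..v} \<and> u \<le> t \<and> t \<le> v \<and> a \<le> u \<and> v \<le> b \<and> Inf K = u \<and> Sup K = v"
      if tK: "(t, K) \<in> p" for t K
    proof -
      obtain u v where K: "K = {u..v}" using p(1) tK by (metis tagged_division_ofD(4) box_real(2))
      have "t \<in> K" "K \<subseteq> {a..b}" using tagged_division_ofD(2,3)[OF p(1) tK] by auto
      then show ?thesis using K by (intro exI[of _ u] exI[of _ v]) auto
    qed
    have qp: "q tagged_partial_division_of {a..b}"
      using p(1) by (auto simp: q_def tagged_division_of_def intro: tagged_partial_division_subset)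
    have qt: "q tagged_division_of \<Union>(snd ` q)" by (rule tagged_partial_division_of_Union_self[OF qp])
    have qd: "snd ` q division_of \<Union>(snd ` q)" by (rule division_of_tagged_division[OF qt])
    have subab: "\<Union>(snd ` q) \<subseteq> {a..b}"
      using tagged_partial_division_ofD(3)[OF qp] by fastforce
    have subU: "\<Union>(snd ` q) \<subseteq> U"
      using p(2) by (fastforce simp: q_def g_def fine_def)
    have "(\<Sum>K\<in>snd ` q. Sup K - Inf K) = (\<Sum>K\<in>snd ` q. measure lebesgue K)"
    proof (rule sum.cong)
      fix K assume "K \<in> snd ` q"
      then obtain t where "(t, K) \<in> p" by (auto simp: q_def)
      then obtain u v where "K = {u..v}" "u \<le> t" "t \<le> v" "Inf K = u" "Sup K = v"
        using mem by blast
      then show "Sup K - Inf K = measure lebesgue K" by simp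
    qed simp
    also have "\<dots> = measure lebesgue (\<Union>(snd ` q))"
      by (rule content_division[OF qd])
    also have "\<dots> \<le> measure lebesgue U"
      using subU Ul qd by (intro measure_mono_fmeasurable) (auto dest: lmeasurable_division)
    finally have len: "(\<Sum>K\<in>snd ` q. Sup K - Inf K) < \<delta>'" using Umu by simp
    have bad: "(\<Sum>K\<in>snd ` q. norm (F (Sup K) - F (Inf K))) < e"
      using \<delta>(2)[OF qd subab] len \<delta>'(2) by simp
    have len': "(\<Sum>(t, K)\<in>q. Sup K - Inf K) < \<delta>'"
      using len by (subst sum_tagged_division_real[OF qt]) auto
    have bad': "(\<Sum>(t, K)\<in>q. norm (F (Sup K) - F (Inf K))) < e"
      using bad by (subst sum_tagged_division_real[OF qt]) auto
    have "F b - F a = (\<Sum>(t, K)\<in>p. F (Sup K) - F (Inf K))"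
      by (simp add: additive_tagged_division_1[OF ab p(1)])
    \<comment> \<open>For tags in \<open>N\<close> only the norm of the increment is under control.
      As \<open>c + e\<close> may be negative, the extra length term is added there so that both
      length terms together are nonnegative.\<close>
    also have "\<dots> \<le> (\<Sum>(t, K)\<in>p. (c + e) * (Sup K - Inf K)
        + (if t \<in> N then norm (F (Sup K) - F (Inf K)) + (\<bar>c\<bar> - c) * (Sup K - Inf K) else 0))"
    proof (rule sum_mono, clarify)
      fix t K assume tK: "(t, K) \<in> p"
      obtain u v where K: "K = {u..v}" "u \<le> t" "t \<le> v" "a \<le> u" "v \<le> b" "Inf K = u" "Sup K = v"
        using mem[OF tK] by blast
      show "F (Sup K) - F (Inf K) \<le> (c + e) * (Sup K - Inf K)
        + (if t \<in> N then norm (F (Sup K) - F (Inf K)) + (\<bar>c\<bar> - c) * (Sup K - Inf K) else 0)"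
      proof (cases "t \<in> N")
        case True
        have "0 \<le> (\<bar>c\<bar> + e) * (v - u)" using K e by (intro mult_nonneg_nonneg) auto
        then have "0 \<le> (c + e) * (v - u) + (\<bar>c\<bar> - c) * (v - u)" by (simp add: algebra_simps)
        then show ?thesis using True K by simp
      next
        case False
        have "K \<subseteq> g t" using p(2) tK by (auto simp: fine_def)
        then have "K \<subseteq> ball t (d t / 2)" using False by (simp add: g_def)
        moreover have "u \<in> K" "v \<in> K" using K by auto
        ultimately have "u \<in> ball t (d t / 2)" "v \<in> ball t (d t / 2)" by blast+
        then have "v - u < d t" using K by (auto simp: dist_real_def)
        then show ?thesis using d(2)[of t u v] K False by simp
      qed
    qed
    also have "\<dots> = (c + e) * (b - a)
        + (\<Sum>(t, K)\<in>q. norm (F (Sup K) - F (Inf K)) + (\<bar>c\<bar> - c) * (Sup K - Inf K))"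
    proof -
      have "(\<Sum>(t, K)\<in>p. (c + e) * (Sup K - Inf K)) = (c + e) * (b - a)"
        using additive_tagged_division_1[OF ab p(1), of "\<lambda>t. (c + e) * t"]
        by (simp add: right_diff_distrib)
      moreover have "(\<Sum>(t, K)\<in>p. if t \<in> N
            then norm (F (Sup K) - F (Inf K)) + (\<bar>c\<bar> - c) * (Sup K - Inf K) else 0)
         = (\<Sum>(t, K)\<in>q. norm (F (Sup K) - F (Inf K)) + (\<bar>c\<bar> - c) * (Sup K - Inf K))"
        using fin by (intro sum.mono_neutral_cong_right) (auto simp: q_def split: if_splits)
      ultimately show ?thesis by (simp add: case_prod_unfold sum.distrib)
    qed
    also have "\<dots> = (c + e) * (b - a) + (\<Sum>(t, K)\<in>q. norm (F (Sup K) - F (Inf K)))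
        + (\<bar>c\<bar> - c) * (\<Sum>(t, K)\<in>q. Sup K - Inf K)"
      by (simp add: case_prod_unfold sum.distrib sum_distrib_left)
    also have "\<dots> \<le> (c + e) * (b - a) + e + e"
    proof -
      have cc: "\<bar>c\<bar> - c \<le> 2 * (\<bar>c\<bar> + 1)" using abs_ge_minus_self[of c] abs_ge_zero[of c] by argo
      have l0: "0 \<le> (\<Sum>(t, K)\<in>q. Sup K - Inf K)"
        using mem by (intro sum_nonneg) (fastforce simp: q_def)
      have "(\<bar>c\<bar> - c) * (\<Sum>(t, K)\<in>q. Sup K - Inf K) \<le> (2 * (\<bar>c\<bar> + 1)) * \<delta>'"
        using l0 len' cc by (intro mult_mono) auto
      then show ?thesis using bad' \<delta>'(3) by linarith
    qed
    finally show ?thesis by (simp add: algebra_simps)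
  qed
  have "((\<lambda>e. c * (b - a) + e * (b - a + 2)) \<longlongrightarrow> c * (b - a) + 0 * (b - a + 2)) (at_right 0)"
    by (intro tendsto_intros)
  then have "F b - F a \<le> c * (b - a) + 0 * (b - a + 2)"
  proof (rule tendsto_lowerbound)
    show "\<forall>\<^sub>F e in at_right 0. F b - F a \<le> c * (b - a) + e * (b - a + 2)"
      using main by (auto simp: eventually_at_right_field intro: exI[of _ 1])
  qed simp
  then show ?thesis by simp
qed

section \<open>Filippov sets\<close>

text \<open>The preimage under \<open>P\<close> of a closed ball around \<open>P (g x)\<close> is
  closed and convex, so it contains the closed convex hull once it contains the values of
  \<open>g\<close> on a small ball. \<open>P\<close> picks out what is continuous in a field with
  jumps: \<open>fst\<close> on the line x1 = 0, the identity off it.\<close>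

lemma filippov_set_continuous_component:
  fixes P :: "'a::euclidean_space \<Rightarrow> 'b::real_normed_vector"
  assumes v: "v \<in> filippov_set g x" and P: "bounded_linear P"
    and cont: "isCont (\<lambda>y. P (g y)) x"
  shows "P v = P (g x)"
proof -
  have "dist (P (g x)) (P v) \<le> e" if e: "e > 0" for e
  proof -
    obtain d where d: "d > 0" "\<And>y. dist y x < d \<Longrightarrow> dist (P (g y)) (P (g x)) < e"
      using cont e unfolding continuous_at_eps_delta by blast
    let ?C = "P -` cball (P (g x)) e"
    have "closed ?C"
      by (rule closed_vimage[OF closed_cball linear_continuous_on[OF P]])
    moreover have "convex ?C"
      by (rule convex_linear_vimage[OF bounded_linear.linear[OF P] convex_cball])
    moreover have "g ` ball x d \<subseteq> ?C"
      using d(2) by (force simp: dist_commute less_imp_le)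
    ultimately have "closure (convex hull (g ` ball x d)) \<subseteq> ?C"
      by (intro closure_minimal hull_minimal)
    moreover have "v \<in> closure (convex hull (g ` (ball x d - {})))"
      using v d(1) unfolding filippov_set_def by blast
    ultimately show ?thesis by auto
  qed
  then have "dist (P (g x)) (P v) \<le> 0" using field_le_epsilon[of "dist (P (g x)) (P v)" 0] by simp
  then show ?thesis by simp
qed

lemma exists_ball_avoiding_negligible:
  fixes x :: "'a::euclidean_space"
  assumes "negligible N" "0 < d"
  obtains y where "y \<in> ball x d" "y \<notin> N"
proof -
  have "\<not> negligible (ball x d)"
    using assms(2) by (intro open_not_negligible) auto
  then have "\<not> ball x d \<subseteq> N" using negligible_subset[OF assms(1)] by blast
  then show ?thesis using that by blast
qed

lemma filippov_set_isCont:
  assumes "isCont g x"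
  shows "g x \<in> filippov_set g x"
  unfolding filippov_set_def
proof (intro INT_I, clarsimp)
  fix d :: real and N :: "'a set" assume d: "0 < d" and N: "negligible N"
  have "g x \<in> closure (g ` (ball x d - N))"
    unfolding closure_approachable
  proof (intro allI impI)
    fix e :: real assume "0 < e"
    then obtain d' where d': "d' > 0" "\<And>y. dist y x < d' \<Longrightarrow> dist (g y) (g x) < e"
      using assms unfolding continuous_at_eps_delta by blast
    obtain y where "y \<in> ball x (min d d')" "y \<notin> N"
      using exists_ball_avoiding_negligible[OF N, of "min d d'"] d d' by auto
    then show "\<exists>y\<in>g ` (ball x d - N). dist y (g x) < e"
      using d'(2)[of y] by (auto simp: dist_commute)
  qed
  then show "g x \<in> closure (convex hull (g ` (ball x d - N)))"
    using closure_mono[OF hull_subset] by blast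
qed

text \<open>Resting at the origin is thereby a Filippov solution of the unperturbed system.
  Enlarging the null set by its reflection leaves a pair y, -y outside it, and the midpoint of their
  values is 0.\<close>

lemma zero_in_filippov_set_odd:
  assumes M: "negligible M" and odd: "\<And>x. x \<notin> M \<Longrightarrow> g (- x) = - g x"
  shows "0 \<in> filippov_set g 0"
  unfolding filippov_set_def
proof (intro INT_I, clarsimp)
  fix d :: real and N :: "'a set" assume d: "0 < d" and N: "negligible N"
  have "negligible (uminus ` N)"
    using N by (intro negligible_differentiable_image_negligible) (auto intro!: derivative_intros simp: differentiable_on_def)
  then have "negligible (N \<union> uminus ` N \<union> M)" using N M by simp
  then obtain y where y: "y \<in> ball 0 d" "y \<notin> N \<union> uminus ` N \<union> M"
    using exists_ball_avoiding_negligible d by blast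
  then have "- y \<notin> N" by (metis UnI1 UnI2 image_eqI minus_minus)
  with y have "g y \<in> g ` (ball 0 d - N)" "g (- y) \<in> g ` (ball 0 d - N)"
    by auto
  then have "g y \<in> convex hull (g ` (ball 0 d - N))" "g (- y) \<in> convex hull (g ` (ball 0 d - N))"
    by (auto intro: hull_inc)
  then have "(1/2) *\<^sub>R g y + (1/2) *\<^sub>R g (- y) \<in> convex hull (g ` (ball 0 d - N))"
    by (intro convexD[OF convex_convex_hull]) auto
  then have "0 \<in> convex hull (g ` (ball 0 d - N))"
    using odd[of y] y by simp
  then show "0 \<in> closure (convex hull (g ` (ball 0 d - N)))"
    using closure_subset by blast
qed

section \<open>The linear oscillator\<close>

text \<open>\<open>h\<close> is the impulse response of h'' + a h' + b h = 0. Stating only initial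
  values, the equation and a common exponential decay lets the three damping regimes share
  everything beyond their explicit formulas.\<close>

locale damped_oscillator =
  fixes a b :: real and h h' :: "real \<Rightarrow> real" and K \<mu> :: real
  assumes a_pos: "a > 0" and b_pos: "b > 0" and \<mu>_pos: "\<mu> > 0"
    and h_0: "h 0 = 0" and h'_0: "h' 0 = 1"
    and h_deriv: "\<And>\<tau>. (h has_real_derivative h' \<tau>) (at \<tau>)"
    and h'_deriv: "\<And>\<tau>. (h' has_real_derivative (- a * h' \<tau> - b * h \<tau>)) (at \<tau>)"
    and h_decay: "\<And>\<tau>. \<tau> \<ge> 0 \<Longrightarrow> \<bar>h \<tau>\<bar> \<le> K * exp (- \<mu> * \<tau>)"
    and h'_decay: "\<And>\<tau>. \<tau> \<ge> 0 \<Longrightarrow> \<bar>h' \<tau>\<bar> \<le> K * exp (- \<mu> * \<tau>)"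
begin

lemma h_deriv' [derivative_intros]:
  "(g has_real_derivative g') (at x within S) \<Longrightarrow>
   ((\<lambda>x. h (g x)) has_real_derivative h' (g x) * g') (at x within S)"
  using DERIV_chain2[OF h_deriv] .

lemma h'_deriv' [derivative_intros]:
  "(g has_real_derivative g') (at x within S) \<Longrightarrow>
   ((\<lambda>x. h' (g x)) has_real_derivative (- a * h' (g x) - b * h (g x)) * g') (at x within S)"
  using DERIV_chain2[OF h'_deriv] .

lemma h_continuous: "continuous_on S h"
  using h_deriv by (meson DERIV_isCont continuous_at_imp_continuous_on)

lemma h'_continuous: "continuous_on S h'"
  using h'_deriv by (meson DERIV_isCont continuous_at_imp_continuous_on)

text \<open>For fixed \<open>s + r\<close>, the right-hand side is a function of \<open>s\<close> with derivative zero.\<close>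

lemma h_add: "h (s + r) = h' s * h r + h s * (h' r + a * h r)"
proof -
  define c where "c x = h' x * h (s + r - x) + h x * (h' (s + r - x) + a * h (s + r - x))" for x
  have "(c has_real_derivative 0) (at x)" for x
    unfolding c_def by (rule derivative_eq_intros refl | simp add: algebra_simps)+
  then have "c s = c 0" using DERIV_isconst_all by blast
  then show ?thesis by (simp add: c_def h_0 h'_0)
qed

text \<open>Both sides are derivatives in \<open>r\<close> of \<open>h (s + r)\<close>, the right
  one computed from the addition formula.\<close>

lemma h'_add: "h' (s + r) = h' s * h' r - b * h s * h r"
proof -
  have "((\<lambda>r. h (s + r)) has_real_derivative h' (s + r)) (at r)"
    by (rule derivative_eq_intros refl | simp)+
  moreover have "((\<lambda>r. h (s + r)) has_real_derivative h' s * h' r - b * h s * h r) (at r)"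
    unfolding h_add by (rule derivative_eq_intros refl | simp add: algebra_simps)+
  ultimately show ?thesis by (rule DERIV_unique)
qed

text \<open>The flow of \<open>z\<^sub>1' = - a z\<^sub>1 + z\<^sub>2\<close>, \<open>z\<^sub>2' = - b z\<^sub>1\<close>.\<close>

definition flow :: "real \<Rightarrow> real \<times> real \<Rightarrow> real \<times> real" where
  "flow \<tau> z = (h' \<tau> * fst z + h \<tau> * snd z, - b * h \<tau> * fst z + (h' \<tau> + a * h \<tau>) * snd z)"

lemma flow_0 [simp]: "flow 0 z = z"
  by (simp add: flow_def h_0 h'_0)

lemma flow_flow: "flow s (flow r z) = flow (s + r) z"
  by (simp add: flow_def h_add h'_add algebra_simps)

lemma flow_zero [simp]: "flow \<tau> 0 = 0"
  by (simp add: flow_def zero_prod_def)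

lemma flow_eq_0_iff: "flow \<tau> z = 0 \<longleftrightarrow> z = 0"
  using flow_flow[of "- \<tau>" \<tau> z] by (metis flow_zero flow_0 add.left_inverse)

lemma fst_flow_deriv:
  "((\<lambda>\<tau>. fst (flow \<tau> z)) has_real_derivative - a * fst (flow \<tau> z) + snd (flow \<tau> z)) (at \<tau>)"
  unfolding flow_def fst_conv snd_conv
  by (rule derivative_eq_intros refl | simp add: algebra_simps)+

lemma snd_flow_deriv:
  "((\<lambda>\<tau>. snd (flow \<tau> z)) has_real_derivative - b * fst (flow \<tau> z)) (at \<tau>)"
  unfolding flow_def fst_conv snd_conv
  by (rule derivative_eq_intros refl | simp add: algebra_simps)+

lemma fst_flow_continuous: "continuous_on S (\<lambda>\<tau>. fst (flow \<tau> z))"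
  using fst_flow_deriv by (meson DERIV_isCont continuous_at_imp_continuous_on)

lemma K_nonneg: "K \<ge> 0"
  using h'_decay[of 0] by (simp add: h'_0)

lemma tendsto_decay:
  assumes "\<And>\<tau>. \<tau> \<ge> 0 \<Longrightarrow> \<bar>f \<tau>\<bar> \<le> C * exp (- \<mu> * \<tau>)"
  shows "(f \<longlongrightarrow> 0) at_top"
proof (rule Lim_null_comparison)
  show "\<forall>\<^sub>F \<tau> in at_top. norm (f \<tau>) \<le> C * exp (- \<mu> * \<tau>)"
    using assms by (auto simp: eventually_at_top_linorder intro!: exI[of _ 0])
  have "filterlim (\<lambda>\<tau>. - \<mu> * \<tau>) at_bot at_top"
    using \<mu>_pos by (intro filterlim_tendsto_neg_mult_at_bot[OF tendsto_const _ filterlim_ident]) auto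
  then have "((\<lambda>\<tau>. exp (- \<mu> * \<tau>)) \<longlongrightarrow> 0) at_top"
    by (rule filterlim_compose[OF exp_at_bot])
  then show "((\<lambda>\<tau>. C * exp (- \<mu> * \<tau>)) \<longlongrightarrow> 0) at_top"
    by (rule tendsto_mult_right_zero)
qed

lemma h_tendsto: "(h \<longlongrightarrow> 0) at_top"
  and h'_tendsto: "(h' \<longlongrightarrow> 0) at_top"
  using tendsto_decay[OF h_decay] tendsto_decay[OF h'_decay] by blast+

lemma flow_tendsto:
  "((\<lambda>\<tau>. fst (flow \<tau> z)) \<longlongrightarrow> 0) at_top" "((\<lambda>\<tau>. snd (flow \<tau> z)) \<longlongrightarrow> 0) at_top"
  unfolding flow_def fst_conv snd_conv
  by (rule tendsto_eq_intros h_tendsto h'_tendsto refl | simp)+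

lemma flow_bound:
  assumes "\<tau> \<ge> 0"
  shows "\<bar>fst (flow \<tau> z)\<bar> \<le> (1 + a + b) * K * (\<bar>fst z\<bar> + \<bar>snd z\<bar>)"
    and "\<bar>snd (flow \<tau> z)\<bar> \<le> (1 + a + b) * K * (\<bar>fst z\<bar> + \<bar>snd z\<bar>)"
proof -
  have "K * exp (- \<mu> * \<tau>) \<le> K * 1"
    using assms \<mu>_pos K_nonneg by (intro mult_left_mono) auto
  then have hK: "\<bar>h \<tau>\<bar> \<le> K" "\<bar>h' \<tau>\<bar> \<le> K"
    using h_decay[OF assms] h'_decay[OF assms] by auto
  have aux: "\<bar>p * fst z + q * snd z\<bar> \<le> (1 + a + b) * K * (\<bar>fst z\<bar> + \<bar>snd z\<bar>)"
    if "\<bar>p\<bar> \<le> (1 + a + b) * K" "\<bar>q\<bar> \<le> (1 + a + b) * K" for p q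
  proof -
    have "\<bar>p * fst z + q * snd z\<bar> \<le> \<bar>p\<bar> * \<bar>fst z\<bar> + \<bar>q\<bar> * \<bar>snd z\<bar>"
      by (metis abs_mult abs_triangle_ineq)
    also have "\<dots> \<le> (1 + a + b) * K * \<bar>fst z\<bar> + (1 + a + b) * K * \<bar>snd z\<bar>"
      using that by (intro add_mono mult_right_mono) auto
    finally show ?thesis by (simp add: algebra_simps)
  qed
  have aK: "0 \<le> a * K" "0 \<le> b * K" using a_pos b_pos K_nonneg by auto
  have "a * \<bar>h \<tau>\<bar> \<le> a * K" "b * \<bar>h \<tau>\<bar> \<le> b * K"
    using hK a_pos b_pos by auto
  moreover have "\<bar>h' \<tau> + a * h \<tau>\<bar> \<le> \<bar>h' \<tau>\<bar> + a * \<bar>h \<tau>\<bar>"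
    using abs_triangle_ineq[of "h' \<tau>" "a * h \<tau>"] a_pos by (simp add: abs_mult)
  moreover have "\<bar>- b * h \<tau>\<bar> = b * \<bar>h \<tau>\<bar>" using b_pos by (simp add: abs_mult)
  ultimately have "\<bar>- b * h \<tau>\<bar> \<le> (1 + a + b) * K" "\<bar>h' \<tau> + a * h \<tau>\<bar> \<le> (1 + a + b) * K"
      "\<bar>h \<tau>\<bar> \<le> (1 + a + b) * K" "\<bar>h' \<tau>\<bar> \<le> (1 + a + b) * K"
    using aK hK K_nonneg unfolding distrib_right mult_1 by linarith+
  then show "\<bar>fst (flow \<tau> z)\<bar> \<le> (1 + a + b) * K * (\<bar>fst z\<bar> + \<bar>snd z\<bar>)"
    and "\<bar>snd (flow \<tau> z)\<bar> \<le> (1 + a + b) * K * (\<bar>fst z\<bar> + \<bar>snd z\<bar>)"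
    unfolding flow_def fst_conv snd_conv by (blast intro: aux)+
qed

text \<open>Any finite bound would serve: it only enters the Lipschitz constant of the settling time
  in the first coordinate, on which the perturbation does not act.\<close>

lemma integral_abs_h'_le:
  assumes "R \<ge> 0"
  shows "integral {0..R} (\<lambda>\<tau>. \<bar>h' \<tau>\<bar>) \<le> K / \<mu>"
proof -
  have "((\<lambda>\<tau>. K * exp (- \<mu> * \<tau>)) has_integral
      (- K / \<mu> * exp (- \<mu> * R)) - (- K / \<mu> * exp (- \<mu> * 0))) {0..R}"
    using \<mu>_pos
    by (intro fundamental_theorem_of_calculus assms)
      (auto intro!: derivative_eq_intros simp flip: has_real_derivative_iff_has_vector_derivative)
  then have *: "((\<lambda>\<tau>. K * exp (- \<mu> * \<tau>)) has_integral (K / \<mu> - K / \<mu> * exp (- \<mu> * R))) {0..R}"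
    by simp
  have "integral {0..R} (\<lambda>\<tau>. \<bar>h' \<tau>\<bar>) \<le> K / \<mu> - K / \<mu> * exp (- \<mu> * R)"
    using h'_decay
    by (intro has_integral_le[OF integrable_integral *] integrable_continuous_real
        continuous_intros h'_continuous) auto
  also have "\<dots> \<le> K / \<mu>" using \<mu>_pos K_nonneg by simp
  finally show ?thesis .
qed

text \<open>By the differential equation \<open>- (h' + a * h) / b\<close> is an antiderivative of
  \<open>h\<close>.\<close>

lemma integral_h:
  assumes "R \<ge> 0"
  shows "(h has_integral (1 - h' R - a * h R) / b) {0..R}"
proof -
  have "(h has_integral (- (h' R + a * h R) / b) - (- (h' 0 + a * h 0) / b)) {0..R}"
    using b_pos
    by (intro fundamental_theorem_of_calculus assms)
      (auto intro!: derivative_eq_intros simp: divide_simps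
        simp flip: has_real_derivative_iff_has_vector_derivative)
  moreover have "(- (h' R + a * h R) / b) - (- (h' 0 + a * h 0) / b) = (1 - h' R - a * h R) / b"
    by (simp add: h_0 h'_0 diff_divide_distrib add_divide_distrib)
  ultimately show ?thesis by simp
qed

lemma integral_abs_h_le_nonneg:
  assumes nonneg: "\<And>\<tau>. \<tau> \<ge> 0 \<Longrightarrow> h \<tau> \<ge> 0" and R: "R \<ge> 0"
  shows "integral {0..R} (\<lambda>\<tau>. \<bar>h \<tau>\<bar>) \<le> 1 / b"
proof -
  have eq: "integral {0..r} (\<lambda>\<tau>. \<bar>h \<tau>\<bar>) = (1 - h' r - a * h r) / b" if "r \<ge> 0" for r
  proof -
    have "integral {0..r} (\<lambda>\<tau>. \<bar>h \<tau>\<bar>) = integral {0..r} h"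
      using nonneg by (intro integral_cong) auto
    then show ?thesis using integral_h[OF that] by (simp add: integral_unique)
  qed
  have lim: "((\<lambda>r. (1 - h' r - a * h r) / b) \<longlongrightarrow> (1 - 0 - a * 0) / b) at_top"
    by (intro tendsto_intros h_tendsto h'_tendsto) (use b_pos in auto)
  have "integral {0..R} (\<lambda>\<tau>. \<bar>h \<tau>\<bar>) \<le> (1 - 0 - a * 0) / b"
  proof (rule tendsto_lowerbound[OF lim])
    have "integral {0..R} (\<lambda>\<tau>. \<bar>h \<tau>\<bar>) \<le> integral {0..r} (\<lambda>\<tau>. \<bar>h \<tau>\<bar>)" if "R \<le> r" for r
      using that
      by (intro integral_subset_le integrable_continuous_real continuous_intros h_continuous) auto
    then show "\<forall>\<^sub>F r in at_top. integral {0..R} (\<lambda>\<tau>. \<bar>h \<tau>\<bar>) \<le> (1 - h' r - a * h r) / b"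
      using eq R by (auto simp: eventually_at_top_linorder intro!: exI[of _ R])
  qed simp
  then show ?thesis by simp
qed

text \<open>The integrals over successive half periods form a geometric progression with ratio \<open>q\<close>.\<close>

lemma integral_abs_h_le_periodic:
  assumes P: "P > 0" and q: "q < 1"
    and nonneg: "\<And>\<tau>. \<lbrakk>0 \<le> \<tau>; \<tau> \<le> P\<rbrakk> \<Longrightarrow> h \<tau> \<ge> 0"
    and periodic: "\<And>\<tau>. \<bar>h (\<tau> + P)\<bar> = q * \<bar>h \<tau>\<bar>"
    and hP: "h P = 0" "h' P = - q" and R: "R \<ge> 0"
  shows "integral {0..R} (\<lambda>\<tau>. \<bar>h \<tau>\<bar>) \<le> (1 + q) / ((1 - q) * b)"
proof -
  let ?I = "\<lambda>u v. integral {u..v} (\<lambda>\<tau>. \<bar>h \<tau>\<bar>)"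
  have int: "(\<lambda>\<tau>. \<bar>h \<tau>\<bar>) integrable_on {u..v}" for u v
    by (intro integrable_continuous_real continuous_intros h_continuous)
  have J: "?I 0 P = (1 + q) / b"
  proof -
    have "?I 0 P = integral {0..P} h"
      using nonneg by (intro integral_cong) auto
    then show ?thesis using integral_h[of P] P hP by (simp add: integral_unique)
  qed
  \<comment> \<open>Lengthening the interval by a half period bounds the integral by
    \<open>?I 0 P\<close> plus \<open>q\<close> times itself, which replaces the summation of the
    series.\<close>
  have "?I 0 R \<le> ?I 0 (P + R)"
    using P by (intro integral_subset_le int) auto
  also have "\<dots> = ?I 0 P + ?I P (P + R)"
    using P R by (intro Henstock_Kurzweil_Integration.integral_combine[symmetric] int) auto
  also have "?I P (P + R) = integral {0..R} ((\<lambda>\<tau>. \<bar>h \<tau>\<bar>) \<circ> (+) P)"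
    by (simp add: integral_shift_Icc_real add.commute)
  also have "\<dots> = q * ?I 0 R"
    using periodic by (simp add: o_def add.commute)
  finally have "(1 - q) * ?I 0 R \<le> (1 + q) / b" using J by (simp add: algebra_simps)
  then have "?I 0 R \<le> (1 + q) / b / (1 - q)"
    using q by (subst pos_le_divide_eq) (auto simp: mult.commute)
  then show ?thesis by (simp add: mult.commute)
qed

end

text \<open>The integral of \<open>\<bar>h\<bar>\<close> over \<open>{0..}\<close> for the impulse response \<open>h\<close> of \<open>h'' + a h' + b h = 0\<close>.\<close>

definition oscillator_mass :: "real \<Rightarrow> real \<Rightarrow> real" where
  "oscillator_mass a b =
     (if a\<^sup>2 \<ge> 4 * b then 1 / b else 1 / (b * tanh (pi * a / (2 * sqrt (4 * b - a\<^sup>2)))))"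

section \<open>The three damping regimes\<close>

lemma overdamped_oscillator:
  assumes a: "a > 0" and b: "b > 0" and ab: "a\<^sup>2 > 4 * b"
  shows "\<exists>h h' K \<mu>. damped_oscillator a b h h' K \<mu> \<and>
    (\<forall>R\<ge>0. integral {0..R} (\<lambda>\<tau>. \<bar>h \<tau>\<bar>) \<le> 1 / b)"
proof -
  define r where "r = sqrt (a\<^sup>2 - 4 * b)"
  have r: "r > 0" "r * r = a * a - 4 * b" using ab by (auto simp: r_def power2_eq_square)
  have "r\<^sup>2 < a\<^sup>2" using r b by (simp add: power2_eq_square)
  then have ra: "r < a" using a by (rule power2_less_imp_less[OF _ less_imp_le])
  \<comment> \<open>The roots of s^2 + a s + b; the one closer to zero, \<open>p\<close>, dictates
    the decay.\<close>
  define p q where "p = (r - a) / 2" and "q = (- r - a) / 2"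
  have pq: "p < 0" "q < p" "p - q = r" "p + q = - a" "p * q = b"
    using r ra a by (auto simp: p_def q_def field_simps)
  define h where "h \<tau> = (exp (p * \<tau>) - exp (q * \<tau>)) / r" for \<tau>
  define h' where "h' \<tau> = (p * exp (p * \<tau>) - q * exp (q * \<tau>)) / r" for \<tau>
  define K where "K = (2 + \<bar>p\<bar> + \<bar>q\<bar>) / r"
  have le: "exp (q * \<tau>) \<le> exp (p * \<tau>)" if "\<tau> \<ge> 0" for \<tau>
    using pq that by (simp add: mult_right_mono)
  interpret damped_oscillator a b h h' K "- p"
  proof
    show "(h has_real_derivative h' \<tau>) (at \<tau>)" for \<tau>
      unfolding h_def h'_def using r by (auto intro!: derivative_eq_intros simp: field_simps)
    have "b = - p * p - a * p" "b = - q * q - a * q"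
      using pq by (auto simp: algebra_simps) (algebra+)
    then have e: "p * p = - a * p - b" "q * q = - a * q - b" by auto
    have "(h' has_real_derivative (p * p * exp (p * \<tau>) - q * q * exp (q * \<tau>)) / r) (at \<tau>)" for \<tau>
      unfolding h_def h'_def using r by (auto intro!: derivative_eq_intros simp: field_simps)
    moreover have "p * p * x - q * q * y = - a * (p * x - q * y) - b * (x - y)" for x y
      unfolding e by (simp add: algebra_simps)
    ultimately show "(h' has_real_derivative - a * h' \<tau> - b * h \<tau>) (at \<tau>)" for \<tau>
      by (simp add: h_def h'_def diff_divide_distrib right_diff_distrib)
    show "\<bar>h \<tau>\<bar> \<le> K * exp (- (- p) * \<tau>)" if "\<tau> \<ge> 0" for \<tau>
    proof -
      have "\<bar>exp (p * \<tau>) - exp (q * \<tau>)\<bar> \<le> 1 * exp (p * \<tau>)"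
        using le[OF that] by simp
      also have "\<dots> \<le> (2 + \<bar>p\<bar> + \<bar>q\<bar>) * exp (p * \<tau>)" by (intro mult_right_mono) auto
      finally show ?thesis using r by (simp add: h_def K_def divide_right_mono)
    qed
    show "\<bar>h' \<tau>\<bar> \<le> K * exp (- (- p) * \<tau>)" if "\<tau> \<ge> 0" for \<tau>
    proof -
      have "\<bar>p * exp (p * \<tau>) - q * exp (q * \<tau>)\<bar> \<le> \<bar>p\<bar> * exp (p * \<tau>) + \<bar>q\<bar> * exp (q * \<tau>)"
        by (metis abs_mult abs_exp_cancel abs_triangle_ineq4)
      also have "\<dots> \<le> \<bar>p\<bar> * exp (p * \<tau>) + \<bar>q\<bar> * exp (p * \<tau>)"
        using le[OF that] by (intro add_left_mono mult_left_mono) auto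
      also have "\<dots> \<le> (2 + \<bar>p\<bar> + \<bar>q\<bar>) * exp (p * \<tau>)" by (simp add: distrib_right)
      finally show ?thesis using r by (simp add: h'_def K_def divide_right_mono)
    qed
    show "h 0 = 0" "h' 0 = 1" using r pq by (auto simp: h_def h'_def)
  qed (use a b pq in auto)
  have "\<forall>R\<ge>0. integral {0..R} (\<lambda>\<tau>. \<bar>h \<tau>\<bar>) \<le> 1 / b"
    using le r by (intro allI impI integral_abs_h_le_nonneg) (auto simp: h_def)
  then show ?thesis using damped_oscillator_axioms by blast
qed

lemma critically_damped_oscillator:
  assumes a: "a > 0" and b: "b > 0" and ab: "a\<^sup>2 = 4 * b"
  shows "\<exists>h h' K \<mu>. damped_oscillator a b h h' K \<mu> \<and>
    (\<forall>R\<ge>0. integral {0..R} (\<lambda>\<tau>. \<bar>h \<tau>\<bar>) \<le> 1 / b)"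
proof -
  define p where "p = a / 2"
  have p: "p > 0" "a = 2 * p" "b = p * p" using a ab by (auto simp: p_def power2_eq_square)
  define h where "h \<tau> = \<tau> * exp (- p * \<tau>)" for \<tau>
  define h' where "h' \<tau> = (1 - p * \<tau>) * exp (- p * \<tau>)" for \<tau>
  define K where "K = 3 + 2 / p"
  \<comment> \<open>The double root leaves a factor \<tau>. Half of the exponential rate is spent on
    absorbing it, by x \<le> exp x, so the decay rate becomes \<open>p / 2\<close>.\<close>
  have te: "p * \<tau> / 2 * exp (- p * \<tau>) \<le> exp (- (p / 2) * \<tau>)" if "\<tau> \<ge> 0" for \<tau>
  proof -
    have "p * \<tau> / 2 \<le> exp (p * \<tau> / 2)"
      using exp_ge_add_one_self[of "p * \<tau> / 2"] by linarith
    then have "p * \<tau> / 2 * exp (- p * \<tau>) \<le> exp (p * \<tau> / 2) * exp (- p * \<tau>)"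
      by (rule mult_right_mono) simp
    also have "\<dots> = exp (- (p / 2) * \<tau>)" by (simp flip: exp_add)
    finally show ?thesis .
  qed
  interpret damped_oscillator a b h h' K "p / 2"
  proof
    show "(h has_real_derivative h' \<tau>) (at \<tau>)" for \<tau>
      unfolding h_def h'_def by (auto intro!: derivative_eq_intros simp: field_simps)
    show "(h' has_real_derivative - a * h' \<tau> - b * h \<tau>) (at \<tau>)" for \<tau>
      unfolding h_def h'_def p by (auto intro!: derivative_eq_intros simp: algebra_simps)
    show "\<bar>h \<tau>\<bar> \<le> K * exp (- (p / 2) * \<tau>)" if "\<tau> \<ge> 0" for \<tau>
    proof -
      have "\<bar>h \<tau>\<bar> = 2 / p * (p * \<tau> / 2 * exp (- p * \<tau>))"
        using that p(1) by (simp add: h_def)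
      also have "\<dots> \<le> 2 / p * exp (- (p / 2) * \<tau>)"
        using te[OF that] p(1) by (intro mult_left_mono) auto
      also have "\<dots> \<le> K * exp (- (p / 2) * \<tau>)"
        by (intro mult_right_mono) (auto simp: K_def)
      finally show ?thesis .
    qed
    show "\<bar>h' \<tau>\<bar> \<le> K * exp (- (p / 2) * \<tau>)" if "\<tau> \<ge> 0" for \<tau>
    proof -
      have "\<bar>1 - p * \<tau>\<bar> \<le> 1 + p * \<tau>" using that p(1) by (simp add: abs_le_iff)
      then have "\<bar>h' \<tau>\<bar> \<le> (1 + p * \<tau>) * exp (- p * \<tau>)"
        by (simp add: h'_def abs_mult mult_right_mono)
      also have "\<dots> = exp (- p * \<tau>) + 2 * (p * \<tau> / 2 * exp (- p * \<tau>))"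
        by (simp add: algebra_simps)
      also have "\<dots> \<le> exp (- (p / 2) * \<tau>) + 2 * exp (- (p / 2) * \<tau>)"
        using te[OF that] p(1) that by (intro add_mono mult_left_mono) auto
      also have "\<dots> = 3 * exp (- (p / 2) * \<tau>)" by simp
      also have "\<dots> \<le> K * exp (- (p / 2) * \<tau>)"
        using p(1) by (intro mult_right_mono) (auto simp: K_def)
      finally show ?thesis .
    qed
  qed (use a b p(1) in \<open>auto simp: h_def h'_def\<close>)
  have "\<forall>R\<ge>0. integral {0..R} (\<lambda>\<tau>. \<bar>h \<tau>\<bar>) \<le> 1 / b"
    by (intro allI impI integral_abs_h_le_nonneg) (auto simp: h_def)
  then show ?thesis using damped_oscillator_axioms by blast
qed

lemma underdamped_oscillator:
  assumes a: "a > 0" and b: "b > 0" and ab: "a\<^sup>2 < 4 * b"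
  shows "\<exists>h h' K \<mu>. damped_oscillator a b h h' K \<mu> \<and>
    (\<forall>R\<ge>0. integral {0..R} (\<lambda>\<tau>. \<bar>h \<tau>\<bar>) \<le> 1 / (b * tanh (pi * a / (2 * sqrt (4 * b - a\<^sup>2)))))"
proof -
  define p \<omega> where "p = a / 2" and "\<omega> = sqrt (4 * b - a\<^sup>2) / 2"
  have w: "\<omega> > 0" "p > 0" "a = 2 * p" "b = \<omega> * \<omega> + p * p"
    using ab a by (auto simp: \<omega>_def p_def power2_eq_square field_simps)
  define h where "h \<tau> = exp (- p * \<tau>) * sin (\<omega> * \<tau>) / \<omega>" for \<tau>
  define h' where "h' \<tau> = exp (- p * \<tau>) * (cos (\<omega> * \<tau>) - p * sin (\<omega> * \<tau>) / \<omega>)" for \<tau>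
  define K where "K = 1 + (1 + p) / \<omega>"
  interpret damped_oscillator a b h h' K p
  proof
    show "(h has_real_derivative h' \<tau>) (at \<tau>)" for \<tau>
      unfolding h_def h'_def using w(1) by (auto intro!: derivative_eq_intros simp: field_simps)
    show "(h' has_real_derivative - a * h' \<tau> - b * h \<tau>) (at \<tau>)" for \<tau>
      unfolding h_def h'_def w(3,4) using w(1)
      by (auto intro!: derivative_eq_intros simp: field_simps)
    have s: "\<bar>sin (\<omega> * \<tau>) / \<omega>\<bar> \<le> 1 / \<omega>" for \<tau>
      using w(1) by (simp add: divide_right_mono)
    show "\<bar>h \<tau>\<bar> \<le> K * exp (- p * \<tau>)" for \<tau>
    proof -
      have "\<bar>h \<tau>\<bar> = \<bar>sin (\<omega> * \<tau>) / \<omega>\<bar> * exp (- p * \<tau>)" by (simp add: h_def abs_mult)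
      also have "\<dots> \<le> K * exp (- p * \<tau>)"
        using s[of \<tau>] w by (intro mult_right_mono) (auto simp: K_def add_divide_distrib intro: order_trans add_increasing2)
      finally show ?thesis .
    qed
    show "\<bar>h' \<tau>\<bar> \<le> K * exp (- p * \<tau>)" for \<tau>
    proof -
      have "\<bar>h' \<tau>\<bar> = \<bar>cos (\<omega> * \<tau>) - p * (sin (\<omega> * \<tau>) / \<omega>)\<bar> * exp (- p * \<tau>)"
        by (simp add: h'_def abs_mult)
      also have "\<dots> \<le> (1 + p * (1 / \<omega>)) * exp (- p * \<tau>)"
      proof (rule mult_right_mono)
        have "\<bar>cos (\<omega> * \<tau>) - p * (sin (\<omega> * \<tau>) / \<omega>)\<bar> \<le> \<bar>cos (\<omega> * \<tau>)\<bar> + p * \<bar>sin (\<omega> * \<tau>) / \<omega>\<bar>"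
          using abs_triangle_ineq4[of "cos (\<omega> * \<tau>)" "p * (sin (\<omega> * \<tau>) / \<omega>)"] w(2)
          by (simp add: abs_mult)
        also have "\<dots> \<le> 1 + p * (1 / \<omega>)"
          using s[of \<tau>] w by (intro add_mono mult_left_mono) auto
        finally show "\<bar>cos (\<omega> * \<tau>) - p * (sin (\<omega> * \<tau>) / \<omega>)\<bar> \<le> 1 + p * (1 / \<omega>)" .
      qed simp
      also have "\<dots> \<le> K * exp (- p * \<tau>)"
        using w by (intro mult_right_mono) (auto simp: K_def add_divide_distrib)
      finally show ?thesis .
    qed
  qed (use a b w(2) in \<open>auto simp: h_def h'_def\<close>)
  \<comment> \<open>Half a period of the sine and the damping over it: h (\<tau> + P) = - q h
    \<tau>.\<close>
  define P q where "P = pi / \<omega>" and "q = exp (- p * P)"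
  have wP: "\<omega> * P = pi" using w(1) by (simp add: P_def)
  have P: "P > 0" using w(1) by (simp add: P_def)
  have q: "0 < q" "q < 1" using P w by (auto simp: q_def)
  have "integral {0..R} (\<lambda>\<tau>. \<bar>h \<tau>\<bar>) \<le> (1 + q) / ((1 - q) * b)" if "R \<ge> 0" for R
  proof (rule integral_abs_h_le_periodic[OF P q(2) _ _ _ _ that])
    show "h \<tau> \<ge> 0" if "0 \<le> \<tau>" "\<tau> \<le> P" for \<tau>
    proof -
      have "\<omega> * \<tau> \<le> \<omega> * P" using that w(1) by (intro mult_left_mono) auto
      then have "sin (\<omega> * \<tau>) \<ge> 0" using that w(1) wP by (intro sin_ge_zero) auto
      then show ?thesis using w(1) by (simp add: h_def)
    qed
    show "\<bar>h (\<tau> + P)\<bar> = q * \<bar>h \<tau>\<bar>" for \<tau>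
      using wP by (simp add: h_def q_def abs_mult distrib_left exp_diff exp_minus field_simps)
    show "h P = 0" "h' P = - q" using wP by (auto simp: h_def h'_def q_def)
  qed
  moreover have "(1 + q) / ((1 - q) * b) = 1 / (b * tanh (pi * a / (2 * sqrt (4 * b - a\<^sup>2))))"
  proof -
    have "pi * a / (2 * sqrt (4 * b - a\<^sup>2)) = p * P / 2"
      using w(1) by (simp add: P_def p_def \<omega>_def field_simps)
    \<comment> \<open>The origin of the hyperbolic tangent in \<open>L_bar\<close>: tanh y = (1 -
      exp (-2 y)) / (1 + exp (-2 y)), and here exp (-2 y) is the ratio \<open>q\<close> of the
      geometric progression.\<close>
    moreover have "tanh (p * P / 2) = (1 - q) / (1 + q)"
      by (simp add: tanh_real_altdef q_def)
    ultimately have eq: "tanh (pi * a / (2 * sqrt (4 * b - a\<^sup>2))) = (1 - q) / (1 + q)"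
      by (simp only:)
    show ?thesis unfolding eq by (simp add: mult.commute)
  qed
  ultimately show ?thesis using damped_oscillator_axioms by auto
qed

lemma damped_oscillator_exists:
  assumes "a > 0" and "b > 0"
  shows "\<exists>h h' K \<mu>. damped_oscillator a b h h' K \<mu> \<and>
    (\<forall>R\<ge>0. integral {0..R} (\<lambda>\<tau>. \<bar>h \<tau>\<bar>) \<le> oscillator_mass a b)"
  using overdamped_oscillator[OF assms] critically_damped_oscillator[OF assms]
    underdamped_oscillator[OF assms]
  unfolding oscillator_mass_def by (cases "a\<^sup>2" "4 * b" rule: linorder_cases) auto

section \<open>Settling time along the linear flow\<close>

text \<open>\<open>G\<close> stands for the derivative of the inverse of \<Phi> and \<Lambda> for 2
  D. The assumption \<open>mass\<close> is the form in which the normalization of the parameters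
  enters the estimates.\<close>

locale settling_function = damped_oscillator +
  fixes G :: "real \<Rightarrow> real" and \<Lambda> :: real
  assumes G_0: "G 0 = 0"
    and G_pos: "\<And>w. w \<noteq> 0 \<Longrightarrow> G w > 0"
    and G_lipschitz: "\<And>u v. \<bar>G u - G v\<bar> \<le> \<Lambda> * \<bar>u - v\<bar>"
    and mass: "\<And>R. R \<ge> 0 \<Longrightarrow> \<Lambda> * integral {0..R} (\<lambda>\<tau>. \<bar>h \<tau>\<bar>) \<le> 1"
begin

lemma \<Lambda>_nonneg: "\<Lambda> \<ge> 0"
  using G_lipschitz[of 1 0] by simp

lemma G_nonneg: "G w \<ge> 0"
  using G_pos[of w] G_0 by (cases "w = 0") auto

lemma G_eq_0_iff: "G w = 0 \<longleftrightarrow> w = 0"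
  using G_pos[of w] G_0 by (cases "w = 0") auto

lemma G_continuous: "continuous_on S G"
proof (rule lipschitz_on_continuous_on)
  show "\<Lambda>-lipschitz_on S G"
    using G_lipschitz \<Lambda>_nonneg by (auto simp: lipschitz_on_def dist_real_def)
qed

lemma rate_continuous: "continuous_on S (\<lambda>\<tau>. G (fst (flow \<tau> z)))"
  by (rule continuous_on_compose2[OF G_continuous fst_flow_continuous]) auto

lemma rate_integrable: "(\<lambda>\<tau>. G (fst (flow \<tau> z))) integrable_on {u..v}"
  by (intro integrable_continuous_real rate_continuous)

text \<open>By linearity two trajectories differ in the first component by \<open>h'\<close> times
  the first plus \<open>h\<close> times the second initial difference. The coefficient of the second
  one is exactly 1 thanks to \<open>mass\<close>.\<close>

lemma integral_rate_diff:
  assumes R: "R \<ge> 0"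
  shows "integral {0..R} (\<lambda>\<tau>. G (fst (flow \<tau> z))) - integral {0..R} (\<lambda>\<tau>. G (fst (flow \<tau> z')))
     \<le> \<Lambda> * (K / \<mu>) * \<bar>fst z - fst z'\<bar> + \<bar>snd z - snd z'\<bar>"
proof -
  let ?B = "\<lambda>\<tau>. \<Lambda> * \<bar>fst z - fst z'\<bar> * \<bar>h' \<tau>\<bar> + \<Lambda> * \<bar>snd z - snd z'\<bar> * \<bar>h \<tau>\<bar>"
  have int: "(\<lambda>\<tau>. \<bar>h \<tau>\<bar>) integrable_on {0..R}" "(\<lambda>\<tau>. \<bar>h' \<tau>\<bar>) integrable_on {0..R}"
    by (intro integrable_continuous_real continuous_intros h_continuous h'_continuous)+
  have "integral {0..R} (\<lambda>\<tau>. G (fst (flow \<tau> z))) - integral {0..R} (\<lambda>\<tau>. G (fst (flow \<tau> z')))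
     = integral {0..R} (\<lambda>\<tau>. G (fst (flow \<tau> z)) - G (fst (flow \<tau> z')))"
    by (simp add: Henstock_Kurzweil_Integration.integral_diff rate_integrable)
  also have "\<dots> \<le> integral {0..R} ?B"
  proof (rule integral_le)
    show "(\<lambda>\<tau>. G (fst (flow \<tau> z)) - G (fst (flow \<tau> z'))) integrable_on {0..R}"
      by (intro integrable_diff rate_integrable)
    show "?B integrable_on {0..R}"
      by (intro integrable_continuous_real continuous_intros h_continuous h'_continuous)
    fix \<tau>
    have "G (fst (flow \<tau> z)) - G (fst (flow \<tau> z')) \<le> \<Lambda> * \<bar>fst (flow \<tau> z) - fst (flow \<tau> z')\<bar>"
      using G_lipschitz[of "fst (flow \<tau> z)" "fst (flow \<tau> z')"] by simp
    also have "fst (flow \<tau> z) - fst (flow \<tau> z') = h' \<tau> * (fst z - fst z') + h \<tau> * (snd z - snd z')"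
      by (simp add: flow_def algebra_simps)
    also have "\<bar>\<dots>\<bar> \<le> \<bar>h' \<tau>\<bar> * \<bar>fst z - fst z'\<bar> + \<bar>h \<tau>\<bar> * \<bar>snd z - snd z'\<bar>"
      by (metis abs_mult abs_triangle_ineq)
    also have "\<Lambda> * \<dots> = ?B \<tau>" by (simp add: algebra_simps)
    finally show "G (fst (flow \<tau> z)) - G (fst (flow \<tau> z')) \<le> ?B \<tau>"
      using \<Lambda>_nonneg by (simp add: mult_left_mono)
  qed
  also have "\<dots> = \<Lambda> * \<bar>fst z - fst z'\<bar> * integral {0..R} (\<lambda>\<tau>. \<bar>h' \<tau>\<bar>)
      + \<Lambda> * \<bar>snd z - snd z'\<bar> * integral {0..R} (\<lambda>\<tau>. \<bar>h \<tau>\<bar>)"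
    using int by (subst Henstock_Kurzweil_Integration.integral_add) (auto intro!: integrable_on_mult_right)
  also have "\<dots> \<le> \<Lambda> * \<bar>fst z - fst z'\<bar> * (K / \<mu>) + \<bar>snd z - snd z'\<bar> * 1"
  proof (rule add_mono)
    show "\<Lambda> * \<bar>fst z - fst z'\<bar> * integral {0..R} (\<lambda>\<tau>. \<bar>h' \<tau>\<bar>) \<le> \<Lambda> * \<bar>fst z - fst z'\<bar> * (K / \<mu>)"
      using integral_abs_h'_le[OF R] \<Lambda>_nonneg by (intro mult_left_mono) auto
    have "\<bar>snd z - snd z'\<bar> * (\<Lambda> * integral {0..R} (\<lambda>\<tau>. \<bar>h \<tau>\<bar>)) \<le> \<bar>snd z - snd z'\<bar> * 1"
      using mass[OF R] by (intro mult_left_mono) auto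
    then show "\<Lambda> * \<bar>snd z - snd z'\<bar> * integral {0..R} (\<lambda>\<tau>. \<bar>h \<tau>\<bar>) \<le> \<bar>snd z - snd z'\<bar> * 1"
      by (simp add: mult_ac)
  qed
  finally show ?thesis by (simp add: mult_ac)
qed

text \<open>In the time scale of the nonlinear system, \<open>settle z\<close> is the time the unperturbed
  trajectory starting at \<open>z\<close> needs to reach the origin.\<close>

definition settle :: "real \<times> real \<Rightarrow> real" where
  "settle z = (SUP R\<in>{0..}. integral {0..R} (\<lambda>\<tau>. G (fst (flow \<tau> z))))"

text \<open>Comparison with the trajectory resting at the origin, where the integrand
  vanishes.\<close>

lemma integral_rate_bdd_above: "bdd_above ((\<lambda>R. integral {0..R} (\<lambda>\<tau>. G (fst (flow \<tau> z)))) ` {0..})"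
  using integral_rate_diff[of _ z 0]
  by (intro bdd_aboveI2[of _ _ "\<Lambda> * (K / \<mu>) * \<bar>fst z\<bar> + \<bar>snd z\<bar>"]) (auto simp: G_0)

lemma settle_ge: "R \<ge> 0 \<Longrightarrow> integral {0..R} (\<lambda>\<tau>. G (fst (flow \<tau> z))) \<le> settle z"
  unfolding settle_def by (intro cSUP_upper integral_rate_bdd_above) auto

lemma settle_nonneg: "settle z \<ge> 0"
  using settle_ge[of 0 z] by simp

lemma settle_0 [simp]: "settle 0 = 0"
  by (simp add: settle_def G_0)

lemma settle_tendsto:
  "((\<lambda>R. integral {0..R} (\<lambda>\<tau>. G (fst (flow \<tau> z)))) \<longlongrightarrow> settle z) at_top"
proof (rule order_tendstoI)
  fix y assume "y < settle z"
  then obtain R where R: "R \<ge> 0" "y < integral {0..R} (\<lambda>\<tau>. G (fst (flow \<tau> z)))"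
    unfolding settle_def using less_cSUP_iff[OF _ integral_rate_bdd_above] by auto
  have "y < integral {0..r} (\<lambda>\<tau>. G (fst (flow \<tau> z)))" if "r \<ge> R" for r
  proof -
    have "integral {0..R} (\<lambda>\<tau>. G (fst (flow \<tau> z))) \<le> integral {0..r} (\<lambda>\<tau>. G (fst (flow \<tau> z)))"
      using that by (intro integral_subset_le rate_integrable) (auto simp: G_nonneg)
    then show ?thesis using R by simp
  qed
  then show "\<forall>\<^sub>F r in at_top. y < integral {0..r} (\<lambda>\<tau>. G (fst (flow \<tau> z)))"
    by (auto simp: eventually_at_top_linorder)
next
  fix y assume "settle z < y"
  then show "\<forall>\<^sub>F r in at_top. integral {0..r} (\<lambda>\<tau>. G (fst (flow \<tau> z))) < y"
    using settle_ge[of _ z] by (auto simp: eventually_at_top_linorder intro!: exI[of _ 0] intro: le_less_trans)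
qed

lemma settle_lipschitz:
  "\<bar>settle z - settle z'\<bar> \<le> \<Lambda> * (K / \<mu>) * \<bar>fst z - fst z'\<bar> + \<bar>snd z - snd z'\<bar>"
proof -
  have *: "settle z - settle z' \<le> \<Lambda> * (K / \<mu>) * \<bar>fst z - fst z'\<bar> + \<bar>snd z - snd z'\<bar>" for z z'
  proof (rule tendsto_upperbound[OF tendsto_diff[OF settle_tendsto settle_tendsto]])
    show "\<forall>\<^sub>F R in at_top. integral {0..R} (\<lambda>\<tau>. G (fst (flow \<tau> z)))
        - integral {0..R} (\<lambda>\<tau>. G (fst (flow \<tau> z')))
        \<le> \<Lambda> * (K / \<mu>) * \<bar>fst z - fst z'\<bar> + \<bar>snd z - snd z'\<bar>"
      by (rule eventually_mono[OF eventually_ge_at_top[of 0] integral_rate_diff])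
  qed simp
  show ?thesis using *[of z z'] *[of z' z] by (simp add: abs_minus_commute abs_le_iff)
qed

text \<open>An antiderivative on the whole line is wanted, not just an integral from 0, because the
  settling time is differentiated along the flow at \<sigma> = 0 from both sides.\<close>

lemma rate_antiderivative:
  obtains A where "\<And>\<tau>. (A has_real_derivative G (fst (flow \<tau> z))) (at \<tau>)"
proof -
  have "continuous_on UNIV (\<lambda>\<tau>. G (fst (flow \<tau> z)))" by (rule rate_continuous)
  then have "\<exists>A. \<forall>\<tau>::real. -\<infinity> < ereal \<tau> \<longrightarrow> ereal \<tau> < \<infinity> \<longrightarrow>
      (A has_vector_derivative G (fst (flow \<tau> z))) (at \<tau>)"
    by (intro einterval_antiderivative) (auto simp: continuous_on_eq_continuous_at)
  then show ?thesis
    using that by (auto simp: has_real_derivative_iff_has_vector_derivative)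
qed

lemma integral_rate_shift:
  assumes A: "\<And>\<tau>. (A has_real_derivative G (fst (flow \<tau> z))) (at \<tau>)" and R: "R \<ge> 0"
  shows "integral {0..R} (\<lambda>\<tau>. G (fst (flow \<tau> (flow \<sigma> z)))) = A (R + \<sigma>) - A \<sigma>"
proof -
  have "((\<lambda>\<tau>. A (\<tau> + \<sigma>)) has_real_derivative G (fst (flow (\<tau> + \<sigma>) z)) * 1) (at \<tau> within {0..R})" for \<tau>
    by (rule DERIV_chain2[OF A]) (auto intro!: derivative_eq_intros)
  then have "((\<lambda>\<tau>. G (fst (flow \<tau> (flow \<sigma> z)))) has_integral A (R + \<sigma>) - A (0 + \<sigma>)) {0..R}"
    by (intro fundamental_theorem_of_calculus R)
      (simp add: flow_flow flip: has_real_derivative_iff_has_vector_derivative)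
  then show ?thesis by (simp add: integral_unique)
qed

lemma antiderivative_tendsto:
  assumes A: "\<And>\<tau>. (A has_real_derivative G (fst (flow \<tau> z))) (at \<tau>)"
  shows "(A \<longlongrightarrow> A 0 + settle z) at_top"
proof (rule Lim_transform_eventually)
  show "((\<lambda>R. A 0 + integral {0..R} (\<lambda>\<tau>. G (fst (flow \<tau> z)))) \<longlongrightarrow> A 0 + settle z) at_top"
    by (intro tendsto_intros settle_tendsto)
  show "\<forall>\<^sub>F R in at_top. A 0 + integral {0..R} (\<lambda>\<tau>. G (fst (flow \<tau> z))) = A R"
    using integral_rate_shift[OF A, of _ 0]
    by (auto simp: eventually_at_top_linorder intro!: exI[of _ 0])
qed

lemma settle_flow:
  assumes A: "\<And>\<tau>. (A has_real_derivative G (fst (flow \<tau> z))) (at \<tau>)"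
  shows "settle (flow \<sigma> z) = settle z + A 0 - A \<sigma>"
proof (rule tendsto_unique[OF _ settle_tendsto])
  have "filterlim (\<lambda>R::real. R + \<sigma>) at_top at_top"
    using filterlim_tendsto_add_at_top[OF tendsto_const[of \<sigma>] filterlim_ident]
    by (simp add: add.commute)
  then have "((\<lambda>R. A (R + \<sigma>) - A \<sigma>) \<longlongrightarrow> A 0 + settle z - A \<sigma>) at_top"
    by (intro tendsto_diff tendsto_const filterlim_compose[OF antiderivative_tendsto[OF A]])
  then have "((\<lambda>R. integral {0..R} (\<lambda>\<tau>. G (fst (flow \<tau> (flow \<sigma> z))))) \<longlongrightarrow> A 0 + settle z - A \<sigma>) at_top"
  proof (rule Lim_transform_eventually)
    show "\<forall>\<^sub>F R in at_top. A (R + \<sigma>) - A \<sigma> = integral {0..R} (\<lambda>\<tau>. G (fst (flow \<tau> (flow \<sigma> z))))"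
      using integral_rate_shift[OF A] by (auto simp: eventually_at_top_linorder intro!: exI[of _ 0])
  qed
  then show "((\<lambda>R. integral {0..R} (\<lambda>\<tau>. G (fst (flow \<tau> (flow \<sigma> z))))) \<longlongrightarrow> settle z + A 0 - A \<sigma>) at_top"
    by (simp add: add.commute)
qed simp

text \<open>Moving along the flow only cuts off an initial piece of the settling integral; this
  gives a derivative in the one direction where it is needed.\<close>

lemma settle_flow_deriv: "((\<lambda>\<sigma>. settle (flow \<sigma> z)) has_real_derivative - G (fst z)) (at 0)"
proof -
  obtain A where A: "\<And>\<tau>. (A has_real_derivative G (fst (flow \<tau> z))) (at \<tau>)"
    using rate_antiderivative[of z] by blast
  have "((\<lambda>\<sigma>. settle z + A 0 - A \<sigma>) has_real_derivative - G (fst z)) (at 0)"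
    using A[of 0] by (auto intro!: derivative_eq_intros)
  then show ?thesis by (simp add: settle_flow[OF A])
qed

end

section \<open>The inverse of a DGF\<close>

text \<open>Serves for the inverse of \<Phi> and for the inverse of the time change. The latter is
  not onto, since real time stays bounded, so \<open>g\<close> is merely a left inverse.\<close>

lemma DERIV_left_inverse:
  fixes f g :: "real \<Rightarrow> real"
  assumes f: "\<And>x. isCont f x" and gf: "\<And>x. g (f x) = x"
    and d: "(f has_real_derivative d) (at x)" "d \<noteq> 0"
  shows "(g has_real_derivative inverse d) (at (f x))"
proof -
  have "(f has_derivative (*) d) (at x)" using d(1) by (simp add: has_field_derivative_def)
  moreover have "(*) d \<circ> (*) (inverse d) = id" using d(2) by (auto simp: fun_eq_iff)
  ultimately have "(g has_derivative (*) (inverse d)) (at (f x))"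
    using f gf by (intro has_derivative_inverse_strong[of UNIV x f g]) (auto intro: continuous_at_imp_continuous_on)
  then show ?thesis by (simp add: has_field_derivative_def)
qed

text \<open>The derivative of \<open>inv \<Phi>\<close>. Its value \<open>0\<close> at the origin comes from condition (iv),
  whereas \<open>deriv \<Phi> 0\<close> is unspecified.\<close>

definition inverse_slope :: "(real \<Rightarrow> real) \<Rightarrow> real \<Rightarrow> real" where
  "inverse_slope \<Phi> w = (if w = 0 then 0 else 1 / deriv \<Phi> (inv \<Phi> w))"

locale bounded_DGF =
  fixes \<Phi> :: "real \<Rightarrow> real" and C D :: real
  assumes DGF: "DGF \<Phi>"
    and C_pos: "C > 0"
    and slope_bound: "\<And>x. x \<noteq> 0 \<Longrightarrow> C * deriv \<Phi> x \<ge> 1"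
    and curvature: "curvature_bound \<Phi> D"
begin

abbreviation \<Psi> :: "real \<Rightarrow> real" where "\<Psi> \<equiv> inv \<Phi>"
abbreviation G :: "real \<Rightarrow> real" where "G \<equiv> inverse_slope \<Phi>"

lemma phi_minus: "\<Phi> (- x) = - \<Phi> x"
  and deriv_pos: "x \<noteq> 0 \<Longrightarrow> deriv \<Phi> x > 0"
  using DGF unfolding DGF_def by auto

lemma phi_0 [simp]: "\<Phi> 0 = 0"
  using phi_minus[of 0] by simp

lemma phi_deriv:
  assumes "x \<noteq> 0" shows "(\<Phi> has_real_derivative deriv \<Phi> x) (at x)"
proof -
  obtain F where "\<forall>x\<in>- {0}. (\<Phi> has_vector_derivative F x) (at x)"
    using DGF unfolding DGF_def C1_differentiable_on_def by auto
  with assms have "(\<Phi> has_real_derivative F x) (at x)"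
    by (simp add: has_real_derivative_iff_has_vector_derivative)
  then show ?thesis using DERIV_imp_deriv by metis
qed

lemma deriv_deriv:
  assumes "x \<noteq> 0" shows "(deriv \<Phi> has_real_derivative deriv (deriv \<Phi>) x) (at x)"
proof -
  obtain F where "\<forall>x\<in>- {0}. (deriv \<Phi> has_vector_derivative F x) (at x)"
    using DGF unfolding DGF_def C1_differentiable_on_def by auto
  with assms have "(deriv \<Phi> has_real_derivative F x) (at x)"
    by (simp add: has_real_derivative_iff_has_vector_derivative)
  then show ?thesis using DERIV_imp_deriv by metis
qed

lemma phi_isCont: "isCont \<Phi> x"
proof -
  have "absolutely_cont_on_interval \<Phi> (x - 1) (x + 1)"
    using DGF unfolding DGF_def locally_absolutely_cont_on_def by auto
  then have "continuous_on {x - 1..x + 1} \<Phi>" by (rule AC_interval_continuous)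
  then show ?thesis by (rule continuous_on_interior) simp
qed

lemma phi_continuous: "continuous_on S \<Phi>"
  using phi_isCont by (simp add: continuous_at_imp_continuous_on)

lemma phi_less_nonneg:
  assumes "0 \<le> x" "x < y" shows "\<Phi> x < \<Phi> y"
proof (rule DERIV_pos_imp_increasing_open[OF assms(2)])
  fix z assume "x < z" "z < y"
  then have "z \<noteq> 0" using assms by auto
  then show "\<exists>d. (\<Phi> has_real_derivative d) (at z) \<and> d > 0" using phi_deriv deriv_pos by blast
qed (rule phi_continuous)

lemma phi_strict_mono: "strict_mono \<Phi>"
proof (rule strict_monoI)
  fix x y :: real assume xy: "x < y"
  consider "0 \<le> x" | "y \<le> 0" | "x < 0" "0 < y" by linarith
  then show "\<Phi> x < \<Phi> y"
  proof cases
    case 2 then show ?thesis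
      using phi_less_nonneg[of "- y" "- x"] xy by (simp add: phi_minus)
  next
    case 3 then show ?thesis
      using phi_less_nonneg[of 0 y] phi_less_nonneg[of 0 "- x"] by (simp add: phi_minus)
  qed (use phi_less_nonneg xy in auto)
qed

text \<open>Condition (b) through the mean value theorem. It makes \<Phi> unbounded, hence a
  bijection of the line.\<close>

lemma phi_ge_linear:
  assumes "x > 0" shows "\<Phi> x \<ge> x / C"
proof -
  obtain l z where z: "0 < z" "z < x" "(\<Phi> has_real_derivative l) (at z)" "\<Phi> x - \<Phi> 0 = (x - 0) * l"
    using MVT[OF assms phi_continuous] phi_deriv
    by (metis less_irrefl real_differentiable_def)
  then have l: "l = deriv \<Phi> z" using DERIV_imp_deriv by metis
  have "1 / C \<le> l" using slope_bound[of z] z C_pos unfolding l by (simp add: pos_divide_le_eq mult.commute)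
  then have "x * (1 / C) \<le> x * l" using assms by (intro mult_left_mono) auto
  then show ?thesis using z by simp
qed

lemma phi_bij: "bij \<Phi>"
proof (rule bijI)
  show "inj \<Phi>" by (rule strict_mono_imp_inj_on[OF phi_strict_mono])
  have pos: "\<exists>x. \<Phi> x = w" if w: "w \<ge> 0" for w
  proof -
    have "w \<le> \<Phi> (C * w + C)"
      using phi_ge_linear[of "C * w + C"] C_pos w by (simp add: add_divide_distrib add_nonneg_pos)
    then show ?thesis
      using IVT'[of \<Phi> 0 w "C * w + C"] w C_pos phi_continuous by auto
  qed
  have "\<exists>x. \<Phi> x = w" for w
  proof (cases "w \<ge> 0")
    case False
    then obtain x where "\<Phi> x = - w" using pos[of "- w"] by auto
    then have "\<Phi> (- x) = w" by (simp add: phi_minus)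
    then show ?thesis ..
  qed (use pos in auto)
  then show "surj \<Phi>" by (metis surjI)
qed

lemma inv_phi [simp]: "\<Psi> (\<Phi> x) = x" "\<Phi> (\<Psi> w) = w"
  using phi_bij by (auto simp: bij_is_inj bij_is_surj surj_f_inv_f)

lemma inv_0 [simp]: "\<Psi> 0 = 0"
  using inv_phi(1)[of 0] by simp

lemma inv_eq_0_iff [simp]: "\<Psi> w = 0 \<longleftrightarrow> w = 0"
  by (metis inv_phi(2) phi_0 inv_0)

lemma inv_minus: "\<Psi> (- w) = - \<Psi> w"
  by (metis inv_phi phi_minus)

lemma inv_pos: "w > 0 \<Longrightarrow> \<Psi> w > 0"
  using strict_mono_less[OF phi_strict_mono, of 0 "\<Psi> w"] by simp

lemma inv_isCont: "isCont \<Psi> w"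
  using isCont_inverse_function[of 1 "\<Psi> w" \<Psi> \<Phi>] phi_isCont by simp

lemma inv_continuous: "continuous_on S \<Psi>"
  using inv_isCont by (simp add: continuous_at_imp_continuous_on)

lemma deriv_minus: "deriv \<Phi> (- x) = deriv \<Phi> x"
proof (cases "x = 0")
  case False
  then have "((\<lambda>x. - \<Phi> (- x)) has_real_derivative - (deriv \<Phi> (- x) * - 1)) (at x)"
    by (intro DERIV_minus DERIV_chain2[OF phi_deriv]) (auto intro!: derivative_eq_intros)
  then show ?thesis using DERIV_imp_deriv[of \<Phi>] by (simp add: phi_minus)
qed simp

section \<open>The slope of the inverse function\<close>

lemma slope_0 [simp]: "G 0 = 0"
  by (simp add: inverse_slope_def)

lemma slope_pos: "w \<noteq> 0 \<Longrightarrow> G w > 0"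
  by (simp add: inverse_slope_def deriv_pos)

lemma slope_phi: "x \<noteq> 0 \<Longrightarrow> G (\<Phi> x) = 1 / deriv \<Phi> x"
  using inv_eq_0_iff[of "\<Phi> x"] by (auto simp: inverse_slope_def simp del: inv_eq_0_iff)

lemma slope_minus: "G (- w) = G w"
  by (simp add: inverse_slope_def inv_minus deriv_minus)

lemma slope_abs: "G \<bar>w\<bar> = G w"
  by (simp add: abs_if slope_minus)

lemma inv_deriv_nonzero:
  assumes "w \<noteq> 0" shows "(\<Psi> has_real_derivative G w) (at w)"
proof -
  have "(\<Psi> has_real_derivative inverse (deriv \<Phi> (\<Psi> w))) (at (\<Phi> (\<Psi> w)))"
    using assms deriv_pos[of "\<Psi> w"]
    by (intro DERIV_left_inverse phi_isCont inv_phi phi_deriv) auto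
  then show ?thesis using assms by (simp add: inverse_slope_def inverse_eq_divide)
qed

text \<open>This explains the cube in (c) and (v): the first bounds the derivative of
  \<open>G\<close> from above, the second bounds it away from 0 near the origin.\<close>

lemma slope_deriv:
  assumes "w \<noteq> 0"
  shows "(G has_real_derivative - deriv (deriv \<Phi>) (\<Psi> w) / deriv \<Phi> (\<Psi> w) ^ 3) (at w)"
proof -
  have p: "deriv \<Phi> (\<Psi> w) > 0" using assms deriv_pos by simp
  have d: "((\<lambda>w. deriv \<Phi> (\<Psi> w)) has_real_derivative deriv (deriv \<Phi>) (\<Psi> w) * G w) (at w)"
    using assms by (intro DERIV_chain2[OF deriv_deriv] inv_deriv_nonzero) auto
  have "((\<lambda>w. 1 / deriv \<Phi> (\<Psi> w)) has_real_derivative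
     - (deriv (deriv \<Phi>) (\<Psi> w) * G w) / (deriv \<Phi> (\<Psi> w))\<^sup>2) (at w)"
    using p d by (auto intro!: derivative_eq_intros simp: power2_eq_square)
  also have "- (deriv (deriv \<Phi>) (\<Psi> w) * G w) / (deriv \<Phi> (\<Psi> w))\<^sup>2
     = - deriv (deriv \<Phi>) (\<Psi> w) / deriv \<Phi> (\<Psi> w) ^ 3"
    using assms by (simp add: inverse_slope_def power2_eq_square power3_eq_cube)
  finally show ?thesis
    by (rule has_field_derivative_transform_within_open[of _ _ _ "- {0}"])
      (use assms in \<open>auto simp: inverse_slope_def\<close>)
qed

lemma slope_deriv_bound:
  assumes "w \<noteq> 0"
  shows "\<bar>- deriv (deriv \<Phi>) (\<Psi> w) / deriv \<Phi> (\<Psi> w) ^ 3\<bar> \<le> 2 * D"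
proof -
  have p: "deriv \<Phi> (\<Psi> w) > 0" using assms deriv_pos by simp
  have "\<bar>deriv (deriv \<Phi>) (\<Psi> w)\<bar> \<le> 2 * D * deriv \<Phi> (\<Psi> w) ^ 3"
    using curvature assms p unfolding curvature_bound_def by (metis abs_of_pos inv_eq_0_iff)
  then show ?thesis using p by (simp add: pos_divide_le_eq)
qed

lemma D_pos: "D > 0"
  using curvature by (simp add: curvature_bound_def)

lemma slope_lipschitz_pos:
  assumes "0 < u" "0 < v" shows "\<bar>G u - G v\<bar> \<le> 2 * D * \<bar>u - v\<bar>"
proof -
  have "norm (G u - G v) \<le> 2 * D * norm (u - v)"
  proof (rule field_differentiable_bound[of "{0<..}"])
    show "(G has_real_derivative - deriv (deriv \<Phi>) (\<Psi> z) / deriv \<Phi> (\<Psi> z) ^ 3) (at z within {0<..})"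
      if "z \<in> {0<..}" for z
      using that by (intro DERIV_subset[OF slope_deriv]) auto
    show "norm (- deriv (deriv \<Phi>) (\<Psi> z) / deriv \<Phi> (\<Psi> z) ^ 3) \<le> 2 * D" if "z \<in> {0<..}" for z
      using that slope_deriv_bound[of z] by auto
  qed (use assms in auto)
  then show ?thesis by simp
qed

lemma slope_tendsto_0: "(G \<longlongrightarrow> 0) (at 0)"
proof -
  have "filterlim \<Psi> (at 0) (at 0)"
    unfolding filterlim_at
  proof
    show "(\<Psi> \<longlongrightarrow> 0) (at 0)" using inv_isCont[of 0] by (simp add: isCont_def)
    show "\<forall>\<^sub>F w in at 0. \<Psi> w \<in> UNIV \<and> \<Psi> w \<noteq> 0"
      by (auto simp: eventually_at intro: exI[of _ 1])
  qed
  moreover have "filterlim (\<lambda>x. \<bar>deriv \<Phi> x\<bar>) at_top (at 0)"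
    using DGF by (simp add: DGF_def)
  ultimately have "filterlim (\<lambda>w. \<bar>deriv \<Phi> (\<Psi> w)\<bar>) at_top (at 0)"
    by (rule filterlim_compose[rotated])
  then have "((\<lambda>w. inverse \<bar>deriv \<Phi> (\<Psi> w)\<bar>) \<longlongrightarrow> 0) (at 0)"
    by (rule tendsto_inverse_0_at_top)
  then show ?thesis
  proof (rule Lim_transform_eventually)
    show "\<forall>\<^sub>F w in at 0. inverse \<bar>deriv \<Phi> (\<Psi> w)\<bar> = G w"
      using deriv_pos by (auto simp: eventually_at inverse_slope_def inverse_eq_divide abs_of_pos intro!: exI[of _ 1])
  qed
qed

text \<open>The Lipschitz bound is known on the open half-axis. Condition (iv) makes
  \<open>G\<close> tend to 0 at the origin, so letting u tend to 0 includes the endpoint.\<close>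

lemma slope_le: "G w \<le> 2 * D * \<bar>w\<bar>"
proof (cases "w = 0")
  case False
  have "((\<lambda>u. G u + 2 * D * \<bar>\<bar>w\<bar> - u\<bar>) \<longlongrightarrow> 0 + 2 * D * \<bar>\<bar>w\<bar> - 0\<bar>) (at_right 0)"
    using slope_tendsto_0 by (intro tendsto_intros) (auto intro: tendsto_mono[OF at_le])
  moreover have "\<forall>\<^sub>F u in at_right 0. G \<bar>w\<bar> \<le> G u + 2 * D * \<bar>\<bar>w\<bar> - u\<bar>"
    using slope_lipschitz_pos[of "\<bar>w\<bar>"] False
    by (auto simp: eventually_at_right_field abs_le_iff intro!: exI[of _ 1])
      (smt (verit))
  ultimately have "G \<bar>w\<bar> \<le> 0 + 2 * D * \<bar>\<bar>w\<bar> - 0\<bar>"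
    by (rule tendsto_lowerbound) simp
  then show ?thesis by (simp add: slope_abs)
qed simp

lemma slope_lipschitz: "\<bar>G u - G v\<bar> \<le> 2 * D * \<bar>u - v\<bar>"
proof (cases "u = 0 \<or> v = 0")
  case True
  then show ?thesis
    using slope_le[of u] slope_le[of v] slope_pos[of u] slope_pos[of v]
    by (cases "u = 0"; cases "v = 0") auto
next
  case False
  have "\<bar>G u - G v\<bar> = \<bar>G \<bar>u\<bar> - G \<bar>v\<bar>\<bar>" by (simp add: slope_abs)
  also have "\<dots> \<le> 2 * D * \<bar>\<bar>u\<bar> - \<bar>v\<bar>\<bar>" using False by (intro slope_lipschitz_pos) auto
  also have "\<dots> \<le> 2 * D * \<bar>u - v\<bar>" using D_pos by (intro mult_left_mono) auto
  finally show ?thesis .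
qed

lemma slope_continuous: "continuous_on S G"
proof (rule lipschitz_on_continuous_on)
  show "(2 * D)-lipschitz_on S G"
    using slope_lipschitz D_pos by (auto simp: lipschitz_on_def dist_real_def)
qed

lemma inv_abs: "\<bar>\<Psi> w\<bar> = \<Psi> \<bar>w\<bar>"
  using inv_pos[of w] inv_pos[of "- w"] by (cases w "0 :: real" rule: linorder_cases) (auto simp: inv_minus)

text \<open>At 0 the inverse function rule fails, because \<Phi> has no finite derivative there.
  Integrating the linear bound on \<open>G\<close>, in the form of the mean value theorem, gives a
  quadratic bound on \<Psi> instead, hence derivative 0.\<close>

lemma inv_deriv: "(\<Psi> has_real_derivative G w) (at w)"
proof (cases "w = 0")
  case True
  have quad: "\<bar>\<Psi> w\<bar> \<le> 2 * D * \<bar>w\<bar> * \<bar>w\<bar>" for w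
  proof (cases "w = 0")
    case False
    then have "0 < \<bar>w\<bar>" by simp
    then obtain l z where z: "0 < z" "z < \<bar>w\<bar>" "(\<Psi> has_real_derivative l) (at z)"
        "\<Psi> \<bar>w\<bar> - \<Psi> 0 = (\<bar>w\<bar> - 0) * l"
      using MVT[OF _ inv_continuous] inv_deriv_nonzero
      by (metis less_irrefl real_differentiable_def)
    then have "l = G z" using inv_deriv_nonzero[of z] DERIV_unique by blast
    also have "\<dots> \<le> 2 * D * \<bar>z\<bar>" by (rule slope_le)
    also have "\<dots> \<le> 2 * D * \<bar>w\<bar>" using z D_pos by (intro mult_left_mono) auto
    finally have "\<bar>w\<bar> * l \<le> \<bar>w\<bar> * (2 * D * \<bar>w\<bar>)" by (intro mult_left_mono) auto
    then show ?thesis using z by (simp add: inv_abs mult_ac)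
  qed simp
  have "((\<lambda>h. (\<Psi> (0 + h) - \<Psi> 0) / h) \<longlongrightarrow> 0) (at 0)"
  proof (rule Lim_null_comparison)
    show "\<forall>\<^sub>F h in at 0. norm ((\<Psi> (0 + h) - \<Psi> 0) / h) \<le> 2 * D * \<bar>h\<bar>"
      using quad by (auto simp: eventually_at abs_divide pos_divide_le_eq intro!: exI[of _ 1])
    show "((\<lambda>h. 2 * D * \<bar>h\<bar>) \<longlongrightarrow> 0) (at 0)"
      by (auto intro!: tendsto_eq_intros)
  qed
  then show ?thesis using True by (simp add: DERIV_def)
qed (rule inv_deriv_nonzero)

text \<open>Near the origin this is condition (v) of a DGF.\<close>

lemma slope_ge_linear:
  obtains \<kappa> where "\<kappa> > 0" "\<And>w. \<bar>w\<bar> \<le> M \<Longrightarrow> \<bar>w\<bar> \<le> \<kappa> * G w"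
proof -
  have "\<forall>\<^sub>F x in at 0. dist \<bar>2 * deriv \<Phi> x ^ 3 / deriv (deriv \<Phi>) x\<bar> 1 < 1"
    using DGF unfolding DGF_def by (intro tendstoD) auto
  then obtain d where d: "d > 0"
    "\<And>x. \<lbrakk>x \<noteq> 0; \<bar>x\<bar> < d\<rbrakk> \<Longrightarrow> dist \<bar>2 * deriv \<Phi> x ^ 3 / deriv (deriv \<Phi>) x\<bar> 1 < 1"
    by (auto simp: eventually_at)
  have low: "\<bar>deriv (deriv \<Phi>) x\<bar> \<ge> deriv \<Phi> x ^ 3" if x: "x \<noteq> 0" "\<bar>x\<bar> < d" for x
  proof -
    have p: "deriv \<Phi> x > 0" using x deriv_pos by simp
    have "dist \<bar>2 * deriv \<Phi> x ^ 3 / deriv (deriv \<Phi>) x\<bar> 1 < 1" using d(2) x by blast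
    \<comment> \<open>Tolerance 1 around the limit 1 gives both bounds. The lower one excludes
      \<open>deriv (deriv \<Phi>) x = 0\<close>, for which the quotient would be 0 by
      convention.\<close>
    then have r: "0 < \<bar>2 * deriv \<Phi> x ^ 3 / deriv (deriv \<Phi>) x\<bar>" "\<bar>2 * deriv \<Phi> x ^ 3 / deriv (deriv \<Phi>) x\<bar> < 2"
      unfolding dist_real_def by linarith+
    then have nz: "deriv (deriv \<Phi>) x \<noteq> 0" by auto
    have "2 * deriv \<Phi> x ^ 3 / \<bar>deriv (deriv \<Phi>) x\<bar> < 2"
      using r(2) p by (simp add: abs_divide abs_mult)
    then show ?thesis using nz by (simp add: pos_divide_less_eq)
  qed
  obtain e where e: "e > 0" "\<And>w. \<bar>w\<bar> < e \<Longrightarrow> \<bar>\<Psi> w\<bar> < d"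
    using inv_isCont[of 0] d(1) unfolding continuous_at_eps_delta by (auto simp: dist_real_def)
  have near: "w \<le> G w" if w: "0 < w" "w < e" for w
  proof -
    obtain l z where z: "0 < z" "z < w" "(G has_real_derivative l) (at z)" "G w - G 0 = (w - 0) * l"
      using MVT[OF w(1) slope_continuous] slope_deriv
      by (metis less_irrefl real_differentiable_def)
    then have l: "l = - deriv (deriv \<Phi>) (\<Psi> z) / deriv \<Phi> (\<Psi> z) ^ 3"
      using slope_deriv[of z] DERIV_unique by blast
    have "deriv \<Phi> (\<Psi> z) > 0" using z(1) deriv_pos by simp
    moreover have "\<bar>deriv (deriv \<Phi>) (\<Psi> z)\<bar> \<ge> deriv \<Phi> (\<Psi> z) ^ 3"
      using z w e(2)[of z] by (intro low) auto
    ultimately have "\<bar>l\<bar> \<ge> 1" unfolding l by (simp add: abs_divide pos_le_divide_eq)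
    then have "w * 1 \<le> w * \<bar>l\<bar>" using w by (intro mult_left_mono) auto
    also have "\<dots> = \<bar>G w\<bar>" using z(4) w by (simp add: abs_mult)
    finally show ?thesis using slope_pos[of w] w by simp
  qed
  \<comment> \<open>Away from 0, where (v) says nothing, compactness provides the constant.\<close>
  have "continuous_on {e..M} (\<lambda>w. w / G w)"
    using slope_pos e(1) by (intro continuous_intros slope_continuous) (metis atLeastAtMost_iff less_irrefl less_le_trans)
  then have "bounded ((\<lambda>w. w / G w) ` {e..M})"
    by (intro compact_imp_bounded compact_continuous_image) auto
  then obtain B where B: "\<And>w. w \<in> {e..M} \<Longrightarrow> \<bar>w / G w\<bar> \<le> B"
    unfolding bounded_iff by (metis image_eqI real_norm_def)
  show ?thesis
  proof
    show "max 1 B > 0" by simp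
    fix w assume w: "\<bar>w\<bar> \<le> M"
    consider "w = 0" | "0 < \<bar>w\<bar>" "\<bar>w\<bar> < e" | "\<bar>w\<bar> \<in> {e..M}" using w by force
    then show "\<bar>w\<bar> \<le> max 1 B * G w"
    proof cases
      case 2
      then have "\<bar>w\<bar> \<le> 1 * G w" using near[of "\<bar>w\<bar>"] by (simp add: slope_abs)
      also have "\<dots> \<le> max 1 B * G w" using slope_pos[of w] 2 by (intro mult_right_mono) auto
      finally show ?thesis .
    next
      case 3
      then have p: "G w > 0" using e(1) by (intro slope_pos) auto
      have "\<bar>w\<bar> / G w \<le> B" using B[OF 3] p by (simp add: slope_abs)
      then have "\<bar>w\<bar> \<le> B * G w" using p by (simp add: pos_divide_le_eq)
      also have "\<dots> \<le> max 1 B * G w" using p by (intro mult_right_mono) auto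
      finally show ?thesis .
    qed simp
  qed
qed

end

section \<open>Solutions without perturbation\<close>

lemma DERIV_nonzero_eventually_neq:
  fixes f :: "real \<Rightarrow> real"
  assumes "(f has_real_derivative d) (at y)" "d \<noteq> 0"
  shows "\<forall>\<^sub>F x in at y. f x \<noteq> f y"
proof -
  have "((\<lambda>x. (f x - f y) / (x - y)) \<longlongrightarrow> d) (at y)"
    using assms(1) by (simp add: has_field_derivative_iff)
  then have "\<forall>\<^sub>F x in at y. (f x - f y) / (x - y) \<noteq> 0"
    using assms(2) by (rule tendsto_imp_eventually_ne)
  then show ?thesis by eventually_elim auto
qed

lemma time_derivI:
  assumes "t \<ge> 0" and f: "(f has_vector_derivative d) (at t within {0..})"
  shows "time_deriv f t = d"
proof -
  have "at_right t \<le> at t within {0..}"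
    using assms(1) by (intro at_le) auto
  then have "at t within {0..} \<noteq> bot"
    using trivial_limit_at_right_real[of t] by (metis bot.extremum_uniqueI)
  then show ?thesis unfolding time_deriv_def by (rule vector_derivative_within[OF _ f])
qed

lemma time_deriv_const: "t \<ge> 0 \<Longrightarrow> time_deriv (\<lambda>_. c) t = 0"
  by (intro time_derivI) auto

lemma time_deriv_const_has_derivative:
  assumes "t \<ge> 0"
  shows "(time_deriv (\<lambda>_. c) has_vector_derivative 0) (at t within {0..})"
  by (rule has_vector_derivative_transform[where f = "\<lambda>_. 0"]) (use assms in \<open>auto simp: time_deriv_const\<close>)

lemma time_deriv_time_deriv_const: "t \<ge> 0 \<Longrightarrow> time_deriv (time_deriv (\<lambda>_. c)) t = 0"
  by (intro time_derivI time_deriv_const_has_derivative)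

lemma input_signal_const:
  assumes "L \<ge> 0" shows "input_signal L (\<lambda>_. c)"
  unfolding input_signal_def
proof (intro conjI)
  show "continuous_on {0..} (time_deriv (\<lambda>_. c))"
    using continuous_on_cong[of "{0..}" "{0..}" "time_deriv (\<lambda>_. c)" "\<lambda>_. 0"]
    by (simp add: time_deriv_const)
  show "\<exists>M. M-lipschitz_on {0..} (time_deriv (\<lambda>_. c))"
    by (intro exI[of _ 0]) (auto simp: lipschitz_on_def time_deriv_const)
  show "AE t in lebesgue. 0 \<le> t \<longrightarrow> time_deriv (\<lambda>_. c) differentiable at t within {0..} \<and>
      \<bar>time_deriv (time_deriv (\<lambda>_. c)) t\<bar> \<le> L"
    using assms by (auto simp: time_deriv_time_deriv_const intro: differentiableI_vector[OF time_deriv_const_has_derivative])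
qed auto

locale differentiator = bounded_DGF + damped_oscillator +
  assumes mass_bound: "\<And>R. R \<ge> 0 \<Longrightarrow> 2 * D * integral {0..R} (\<lambda>\<tau>. \<bar>h \<tau>\<bar>) \<le> 1"
begin

sublocale settling_function a b h h' K \<mu> "inverse_slope \<Phi>" "2 * D"
  by unfold_locales (auto intro: slope_pos slope_lipschitz mass_bound)

section \<open>The scaled generator and the error field\<close>

lemma scaled_deriv:
  assumes "\<epsilon> \<noteq> 0" "x \<noteq> 0"
  shows "(scaled \<Phi> \<epsilon> has_real_derivative \<epsilon> * deriv \<Phi> (\<epsilon>\<^sup>2 * x)) (at x)"
proof -
  have "((\<lambda>x. \<Phi> (\<epsilon>\<^sup>2 * x) / \<epsilon>) has_real_derivative deriv \<Phi> (\<epsilon>\<^sup>2 * x) * \<epsilon>\<^sup>2 / \<epsilon>) (at x)"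
    using assms by (intro DERIV_cdivide DERIV_chain2[OF phi_deriv]) (auto intro!: derivative_eq_intros)
  then show ?thesis using assms by (simp add: scaled_def[abs_def] power2_eq_square mult.commute)
qed

lemma deriv_scaled: "\<epsilon> \<noteq> 0 \<Longrightarrow> x \<noteq> 0 \<Longrightarrow> deriv (scaled \<Phi> \<epsilon>) x = \<epsilon> * deriv \<Phi> (\<epsilon>\<^sup>2 * x)"
  by (intro DERIV_imp_deriv scaled_deriv)

lemma scaled_isCont: "isCont (scaled \<Phi> \<epsilon>) x"
  unfolding scaled_def[abs_def] divide_inverse
  by (intro continuous_intros isCont_o2[OF _ phi_isCont])

lemma deriv_scaled_isCont:
  assumes "\<epsilon> \<noteq> 0" "x \<noteq> 0" shows "isCont (deriv (scaled \<Phi> \<epsilon>)) x"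
proof -
  have "isCont (\<lambda>x. \<epsilon> * deriv \<Phi> (\<epsilon>\<^sup>2 * x)) x"
    using assms by (intro continuous_intros isCont_o2[OF _ DERIV_isCont[OF deriv_deriv]]) auto
  moreover have "\<forall>\<^sub>F y in nhds x. \<epsilon> * deriv \<Phi> (\<epsilon>\<^sup>2 * y) = deriv (scaled \<Phi> \<epsilon>) y"
    using t1_space_nhds[OF assms(2)] by eventually_elim (use assms in \<open>simp add: deriv_scaled\<close>)
  ultimately show ?thesis by (simp add: isCont_cong)
qed

lemma error_field_alt:
  "error_field \<Phi> k1 k2 \<epsilon> f t = (\<lambda>x. (- k1 * scaled \<Phi> \<epsilon> (fst x) + snd x,
      - 2 * k2 * scaled \<Phi> \<epsilon> (fst x) * deriv (scaled \<Phi> \<epsilon>) (fst x) + time_deriv (time_deriv f) t))"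
  by (auto simp: error_field_def)

lemma error_field_isCont:
  assumes "\<epsilon> \<noteq> 0" "fst x \<noteq> 0"
  shows "isCont (error_field \<Phi> k1 k2 \<epsilon> f t) x"
  unfolding error_field_alt
  by (intro continuous_intros isCont_o2[OF _ scaled_isCont] isCont_o2[OF _ deriv_scaled_isCont] assms)

text \<open>In contrast to the whole field, this component is continuous across x1 = 0, so the
  Filippov set determines x1' there too.\<close>

lemma error_field_fst_isCont: "isCont (\<lambda>x. fst (error_field \<Phi> k1 k2 \<epsilon> f t x)) x"
  unfolding error_field_alt fst_conv
  by (intro continuous_intros isCont_o2[OF _ scaled_isCont])

lemma error_field_minus:
  assumes "\<epsilon> \<noteq> 0" "fst x \<noteq> 0" "t \<ge> 0"
  shows "error_field \<Phi> k1 k2 \<epsilon> (\<lambda>_. 0) t (- x) = - error_field \<Phi> k1 k2 \<epsilon> (\<lambda>_. 0) t x"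
proof -
  have "deriv (scaled \<Phi> \<epsilon>) (- fst x) = deriv (scaled \<Phi> \<epsilon>) (fst x)"
    using assms by (simp add: deriv_scaled deriv_minus)
  then show ?thesis
    using assms(3) by (simp add: error_field_alt scaled_def phi_minus time_deriv_time_deriv_const)
qed

text \<open>\<open>trajectory \<epsilon> z\<close> is the unperturbed error trajectory in the time scale \<open>\<tau>\<close> of the linear flow.\<close>

definition trajectory :: "real \<Rightarrow> real \<times> real \<Rightarrow> real \<Rightarrow> real \<times> real" where
  "trajectory \<epsilon> z \<tau> = (\<Psi> (fst (flow \<tau> z)) / \<epsilon>\<^sup>2, snd (flow \<tau> z) / \<epsilon>)"

text \<open>Valid at crossings z1 = 0 as well, since \<Psi> is differentiable at 0 with slope
  \<open>G 0 = 0\<close>.\<close>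

lemma trajectory_has_derivative:
  "(trajectory \<epsilon> z has_vector_derivative
     (G (fst (flow \<tau> z)) * (- a * fst (flow \<tau> z) + snd (flow \<tau> z)) / \<epsilon>\<^sup>2, - b * fst (flow \<tau> z) / \<epsilon>)) (at \<tau>)"
proof -
  have "((\<lambda>\<tau>. \<Psi> (fst (flow \<tau> z)) / \<epsilon>\<^sup>2) has_real_derivative
      G (fst (flow \<tau> z)) * (- a * fst (flow \<tau> z) + snd (flow \<tau> z)) / \<epsilon>\<^sup>2) (at \<tau>)"
    by (intro DERIV_cdivide DERIV_chain2[OF inv_deriv] fst_flow_deriv)
  moreover have "((\<lambda>\<tau>. snd (flow \<tau> z) / \<epsilon>) has_real_derivative - b * fst (flow \<tau> z) / \<epsilon>) (at \<tau>)"
    by (intro DERIV_cdivide snd_flow_deriv)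
  ultimately show ?thesis
    unfolding trajectory_def[abs_def] has_real_derivative_iff_has_vector_derivative
    by (intro has_vector_derivative_Pair)
qed

lemma trajectory_tendsto: "(trajectory \<epsilon> z \<longlongrightarrow> 0) at_top"
proof -
  have "((\<lambda>\<tau>. \<Psi> (fst (flow \<tau> z))) \<longlongrightarrow> \<Psi> 0) at_top"
    by (rule isCont_tendsto_compose[OF inv_isCont flow_tendsto(1)])
  then have "((\<lambda>\<tau>. (\<Psi> (fst (flow \<tau> z)) / \<epsilon>\<^sup>2, snd (flow \<tau> z) / \<epsilon>)) \<longlongrightarrow> (0 / \<epsilon>\<^sup>2, 0 / \<epsilon>)) at_top"
    unfolding divide_inverse by (intro tendsto_intros flow_tendsto) simp
  then show ?thesis by (simp add: trajectory_def[abs_def] zero_prod_def)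
qed

lemma trajectory_eq_0_iff: "\<epsilon> \<noteq> 0 \<Longrightarrow> trajectory \<epsilon> z \<tau> = 0 \<longleftrightarrow> z = 0"
proof -
  assume "\<epsilon> \<noteq> 0"
  then have "trajectory \<epsilon> z \<tau> = 0 \<longleftrightarrow> fst (flow \<tau> z) = 0 \<and> snd (flow \<tau> z) = 0"
    by (simp add: trajectory_def zero_prod_def)
  also have "\<dots> \<longleftrightarrow> flow \<tau> z = 0" by (simp add: prod_eq_iff)
  finally show ?thesis by (simp add: flow_eq_0_iff)
qed

text \<open>Crossings are transversal: where z1 = 0, z1' = z2 is nonzero. Hence they are isolated.
  Their times will form a null set of exceptions.\<close>

lemma fst_flow_zeros_countable:
  assumes "z \<noteq> 0" shows "countable {\<tau>. fst (flow \<tau> z) = 0}"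
proof -
  have "\<forall>\<^sub>F \<sigma> in at \<tau>. \<sigma> \<notin> {\<tau>. fst (flow \<tau> z) = 0}" for \<tau>
  proof (cases "fst (flow \<tau> z) = 0")
    case True
    then have "snd (flow \<tau> z) \<noteq> 0"
      using assms flow_eq_0_iff[of \<tau> z] by (auto simp: prod_eq_iff)
    then show ?thesis
      using DERIV_nonzero_eventually_neq[OF fst_flow_deriv[of z \<tau>]] True by simp
  next
    case False
    have "isCont (\<lambda>\<tau>. fst (flow \<tau> z)) \<tau>" using fst_flow_deriv DERIV_isCont by blast
    then show ?thesis
      using False by (auto simp: isCont_def intro: tendsto_imp_eventually_ne)
  qed
  then have "{\<tau>. fst (flow \<tau> z) = 0} sparse_in UNIV"
    by (simp add: sparse_in_eventually_iff)
  then show ?thesis using sparse_imp_countable[OF open_UNIV] by simp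
qed

text \<open>The time change could stall only on an interval where z1 = 0; there z1' = 0 as well, so
  z2 = 0, which no nonzero trajectory allows.\<close>

lemma antiderivative_strict_mono:
  assumes z: "z \<noteq> 0" and A: "\<And>\<tau>. (A has_real_derivative G (fst (flow \<tau> z))) (at \<tau>)"
  shows "strict_mono A"
proof (rule strict_monoI)
  fix r s :: real assume rs: "r < s"
  have mono: "A u \<le> A v" if "u \<le> v" for u v
    by (rule DERIV_nonneg_imp_nondecreasing[OF that]) (use A G_nonneg in blast)
  show "A r < A s"
  proof (rule ccontr)
    assume "\<not> A r < A s"
    then have const: "A x = A r" if "x \<in> {r<..<s}" for x
      using mono[of r x] mono[of x s] that \<open>\<not> A r < A s\<close> by simp
    have zero: "fst (flow x z) = 0" if x: "x \<in> {r<..<s}" for x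
    proof -
      have "((\<lambda>_. A r) has_real_derivative G (fst (flow x z))) (at x)"
        by (rule has_field_derivative_transform_within_open[OF A, of "{r<..<s}"]) (use x const in auto)
      then have "G (fst (flow x z)) = 0" by (rule DERIV_unique[OF _ DERIV_const])
      then show ?thesis using G_eq_0_iff by simp
    qed
    define x where "x = (r + s) / 2"
    have x: "x \<in> {r<..<s}" using rs by (simp add: x_def)
    have "((\<lambda>_. 0) has_real_derivative - a * fst (flow x z) + snd (flow x z)) (at x)"
      by (rule has_field_derivative_transform_within_open[OF fst_flow_deriv, of "{r<..<s}"])
        (use x zero in auto)
    then have "- a * fst (flow x z) + snd (flow x z) = 0" by (rule DERIV_unique[OF _ DERIV_const])
    then have "flow x z = 0" using zero[OF x] by (simp add: prod_eq_iff)
    then show False using z flow_eq_0_iff by simp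
  qed
qed

text \<open>The increment of \<open>A\<close> is real time up to the factor \<epsilon>, so the speed
  has to be compared with \<open>G\<close>. The first component carries this factor already; the
  second is proportional to z1, which is dominated by \<open>G\<close> through
  \<open>slope_ge_linear\<close>.\<close>

lemma trajectory_lipschitz:
  assumes A: "\<And>\<tau>. (A has_real_derivative G (fst (flow \<tau> z))) (at \<tau>)" and \<epsilon>: "\<epsilon> > 0"
  obtains c where "c \<ge> 0"
    "\<And>r s. \<lbrakk>0 \<le> r; r \<le> s\<rbrakk> \<Longrightarrow> norm (trajectory \<epsilon> z s - trajectory \<epsilon> z r) \<le> c * (A s - A r)"
proof -
  define M where "M = (1 + a + b) * K * (\<bar>fst z\<bar> + \<bar>snd z\<bar>)"
  have M: "\<bar>fst (flow \<tau> z)\<bar> \<le> M" "\<bar>snd (flow \<tau> z)\<bar> \<le> M" if "\<tau> \<ge> 0" for \<tau>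
    using flow_bound[OF that] by (auto simp: M_def)
  obtain \<kappa> where \<kappa>: "\<kappa> > 0" "\<And>w. \<bar>w\<bar> \<le> M \<Longrightarrow> \<bar>w\<bar> \<le> \<kappa> * G w"
    using slope_ge_linear[of M] by blast
  have M0: "M \<ge> 0" using M(1)[of 0] by simp
  define c where "c = (a * M + M) / \<epsilon>\<^sup>2 + b * \<kappa> / \<epsilon>"
  show ?thesis
  proof
    show c0: "c \<ge> 0" using a_pos b_pos M0 \<kappa> \<epsilon> by (simp add: c_def)
    fix r s :: real assume rs: "0 \<le> r" "r \<le> s"
    show "norm (trajectory \<epsilon> z s - trajectory \<epsilon> z r) \<le> c * (A s - A r)"
    proof (cases "r = s")
      case False
      have "norm (trajectory \<epsilon> z s - trajectory \<epsilon> z r) \<le> c * A s - c * A r"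
      proof (rule differentiable_bound_general)
        show "r < s" using False rs by simp
        show "continuous_on {r..s} (trajectory \<epsilon> z)"
          using trajectory_has_derivative
          by (meson continuous_at_imp_continuous_on has_vector_derivative_continuous)
        have "isCont A x" for x using A DERIV_isCont by blast
        then show "continuous_on {r..s} (\<lambda>\<tau>. c * A \<tau>)"
          by (intro continuous_intros continuous_at_imp_continuous_on) auto
        show "((\<lambda>\<tau>. c * A \<tau>) has_vector_derivative c * G (fst (flow x z))) (at x)" for x
          using DERIV_cmult[OF A] by (simp add: has_real_derivative_iff_has_vector_derivative)
        fix x assume x: "r < x" "x < s"
        let ?w = "fst (flow x z)" and ?v = "snd (flow x z)"
        have "\<bar>- a * ?w + ?v\<bar> \<le> \<bar>- a * ?w\<bar> + \<bar>?v\<bar>" by (rule abs_triangle_ineq)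
        also have "\<dots> \<le> a * M + M"
          using M[of x] x rs a_pos by (intro add_mono) (auto simp: abs_mult)
        finally have 1: "\<bar>G ?w * (- a * ?w + ?v) / \<epsilon>\<^sup>2\<bar> \<le> G ?w * (a * M + M) / \<epsilon>\<^sup>2"
          using G_nonneg by (simp add: abs_mult abs_divide divide_right_mono mult_left_mono)
        have "b * \<bar>?w\<bar> \<le> b * (\<kappa> * G ?w)"
          using \<kappa>(2) M[of x] x rs b_pos by (intro mult_left_mono) auto
        then have 2: "\<bar>- b * ?w / \<epsilon>\<bar> \<le> b * (\<kappa> * G ?w) / \<epsilon>"
          using \<epsilon> b_pos by (simp add: abs_mult abs_divide divide_right_mono)
        have "norm (G ?w * (- a * ?w + ?v) / \<epsilon>\<^sup>2, - b * ?w / \<epsilon>)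
           \<le> norm (G ?w * (- a * ?w + ?v) / \<epsilon>\<^sup>2) + norm (- b * ?w / \<epsilon>)"
          by (rule norm_Pair_le)
        also have "\<dots> \<le> G ?w * (a * M + M) / \<epsilon>\<^sup>2 + b * (\<kappa> * G ?w) / \<epsilon>"
          using 1 2 by simp
        also have "\<dots> = c * G ?w" by (simp add: c_def algebra_simps add_divide_distrib)
        finally show "norm (G ?w * (- a * ?w + ?v) / \<epsilon>\<^sup>2, - b * ?w / \<epsilon>) \<le> c * G ?w" .
      qed (rule trajectory_has_derivative)
      then show ?thesis by (simp add: right_diff_distrib)
    qed simp
  qed
qed

lemma error_field_trajectory:
  assumes \<epsilon>: "\<epsilon> > 0" and w: "fst (flow \<tau> z) \<noteq> 0" and t: "t \<ge> 0" and b: "b = 2 * k2"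
  shows "error_field \<Phi> a k2 \<epsilon> (\<lambda>_. 0) t (trajectory \<epsilon> z \<tau>) =
    ((- a * fst (flow \<tau> z) + snd (flow \<tau> z)) / \<epsilon>, - b * fst (flow \<tau> z) / G (fst (flow \<tau> z)))"
proof -
  have *: "\<epsilon>\<^sup>2 * fst (trajectory \<epsilon> z \<tau>) = \<Psi> (fst (flow \<tau> z))" "fst (trajectory \<epsilon> z \<tau>) \<noteq> 0"
    using \<epsilon> w by (auto simp: trajectory_def)
  have "scaled \<Phi> \<epsilon> (fst (trajectory \<epsilon> z \<tau>)) = fst (flow \<tau> z) / \<epsilon>"
    unfolding scaled_def * by simp
  moreover have "deriv (scaled \<Phi> \<epsilon>) (fst (trajectory \<epsilon> z \<tau>)) = \<epsilon> / G (fst (flow \<tau> z))"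
    using \<epsilon> w * by (simp add: deriv_scaled inverse_slope_def)
  moreover have "snd (trajectory \<epsilon> z \<tau>) = snd (flow \<tau> z) / \<epsilon>"
    by (simp add: trajectory_def)
  ultimately show ?thesis
    using \<epsilon> t by (simp add: error_field_alt time_deriv_time_deriv_const b
        add_divide_distrib diff_divide_distrib)
qed

text \<open>The unperturbed solution is the linear flow reparametrised by \<open>dt = G(z\<^sub>1) d\<tau> / \<epsilon>\<close>.\<close>

lemma unperturbed_solution:
  assumes \<epsilon>: "\<epsilon> > 0" and z: "z \<noteq> 0" and b: "b = 2 * k2"
  obtains x where "error_solution \<Phi> a k2 \<epsilon> (\<lambda>_. 0) (trajectory \<epsilon> z 0) x"
    "ennreal (settle z / \<epsilon>) \<le> convergence_time x"
proof -
  obtain A where A: "\<And>\<tau>. (A has_real_derivative G (fst (flow \<tau> z))) (at \<tau>)"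
    using rate_antiderivative[of z] by blast
  define tm where "tm \<tau> = (A \<tau> - A 0) / \<epsilon>" for \<tau>
  define T where "T = settle z / \<epsilon>"
  have tm_0: "tm 0 = 0" by (simp add: tm_def)
  have tm_deriv: "(tm has_real_derivative G (fst (flow \<tau> z)) / \<epsilon>) (at \<tau>)" for \<tau>
    unfolding tm_def[abs_def] using A[of \<tau>] \<epsilon> by (auto intro!: derivative_eq_intros)
  have tm_isCont: "isCont tm \<tau>" for \<tau> using tm_deriv DERIV_isCont by blast
  have tm_mono: "strict_mono tm"
    using antiderivative_strict_mono[OF z A] \<epsilon>
    by (auto simp: strict_mono_def tm_def divide_strict_right_mono)
  have "((\<lambda>\<tau>. (A \<tau> - A 0) / \<epsilon>) \<longlongrightarrow> (A 0 + settle z - A 0) / \<epsilon>) at_top"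
    using \<epsilon> by (intro tendsto_intros antiderivative_tendsto[OF A]) auto
  then have tm_lim: "(tm \<longlongrightarrow> T) at_top" by (simp add: tm_def[abs_def] T_def)
  \<comment> \<open>Linear time is unbounded, but real time only tends to \<open>T\<close> and never
    reaches it.\<close>
  have tm_less: "tm \<tau> < T" for \<tau>
  proof -
    have "tm (\<tau> + 1) \<le> T"
    proof (rule tendsto_lowerbound[OF tm_lim])
      show "\<forall>\<^sub>F \<sigma> in at_top. tm (\<tau> + 1) \<le> tm \<sigma>"
        using strict_mono_less_eq[OF tm_mono] by (auto simp: eventually_at_top_linorder)
    qed simp
    then show ?thesis using strict_monoD[OF tm_mono, of \<tau> "\<tau> + 1"] by simp
  qed
  have tm_onto: "\<exists>\<tau>\<ge>0. tm \<tau> = t" if t: "0 \<le> t" "t < T" for t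
  proof -
    have "\<forall>\<^sub>F \<tau> in at_top. t < tm \<tau>" using tm_lim t(2) by (rule order_tendstoD)
    then have "\<forall>\<^sub>F \<tau> in at_top. t < tm \<tau> \<and> 0 \<le> \<tau>"
      using eventually_ge_at_top[of 0] by eventually_elim simp
    then obtain \<tau> where "t < tm \<tau>" "0 \<le> \<tau>"
      using eventually_happens'[of "at_top :: real filter"] by auto
    then show ?thesis
      using IVT[of tm 0 t \<tau>] t tm_0 tm_isCont by auto
  qed
  define \<theta> where "\<theta> = inv tm"
  have \<theta>: "\<theta> (tm \<tau>) = \<tau>" for \<tau>
    unfolding \<theta>_def using strict_mono_imp_inj_on[OF tm_mono] by (rule inv_f_f)
  define x where "x t = (if t < T then trajectory \<epsilon> z (\<theta> t) else 0)" for t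
  have x_tm: "x (tm \<tau>) = trajectory \<epsilon> z \<tau>" for \<tau>
    using tm_less by (simp add: x_def \<theta>)
  obtain c where c: "c \<ge> 0"
    "\<And>r s. \<lbrakk>0 \<le> r; r \<le> s\<rbrakk> \<Longrightarrow> norm (trajectory \<epsilon> z s - trajectory \<epsilon> z r) \<le> c * (A s - A r)"
    using trajectory_lipschitz[OF A \<epsilon>] by blast
  define c' where "c' = c * \<epsilon>"
  have c': "c' \<ge> 0" using c(1) \<epsilon> by (simp add: c'_def)
  have lip: "norm (trajectory \<epsilon> z s - trajectory \<epsilon> z r) \<le> c' * (tm s - tm r)"
    if "0 \<le> r" "r \<le> s" for r s
    using c(2)[OF that] \<epsilon> by (simp add: c'_def tm_def flip: diff_divide_distrib)
  \<comment> \<open>The Lipschitz bound survives the limit, so continuing the trajectory by 0 from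
    \<open>T\<close> on keeps it Lipschitz.\<close>
  have lip_T: "norm (trajectory \<epsilon> z r) \<le> c' * (T - tm r)" if r: "0 \<le> r" for r
  proof -
    have "((\<lambda>s. norm (trajectory \<epsilon> z s - trajectory \<epsilon> z r)) \<longlongrightarrow> norm (0 - trajectory \<epsilon> z r)) at_top"
      by (intro tendsto_intros trajectory_tendsto)
    moreover have "((\<lambda>s. c' * (tm s - tm r)) \<longlongrightarrow> c' * (T - tm r)) at_top"
      by (intro tendsto_intros tm_lim)
    moreover have "\<forall>\<^sub>F s in at_top. norm (trajectory \<epsilon> z s - trajectory \<epsilon> z r) \<le> c' * (tm s - tm r)"
      using lip[OF r] by (auto simp: eventually_at_top_linorder)
    ultimately have "norm (0 - trajectory \<epsilon> z r) \<le> c' * (T - tm r)"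
      by (intro tendsto_le[OF trivial_limit_at_top_linorder])
    then show ?thesis by simp
  qed
  have x_lip: "norm (x t - x s) \<le> c' * (t - s)" if st: "0 \<le> s" "s \<le> t" for s t
  proof (cases "s < T")
    case False
    then show ?thesis using st c' by (simp add: x_def)
  next
    case s: True
    obtain r where r: "r \<ge> 0" "tm r = s" using tm_onto st s by blast
    show ?thesis
    proof (cases "t < T")
      case True
      obtain r' where r': "r' \<ge> 0" "tm r' = t" using tm_onto[of t] st True by auto
      have "r \<le> r'" using strict_mono_less_eq[OF tm_mono] r r' st by metis
      then show ?thesis using lip[OF r(1), of r'] r r' x_tm by metis
    next
      case False
      have "norm (x t - x s) = norm (trajectory \<epsilon> z r)"
        using False x_tm[of r] r by (simp add: x_def)
      also have "\<dots> \<le> c' * (T - s)" using lip_T[OF r(1)] r by simp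
      also have "\<dots> \<le> c' * (t - s)" using False c' by (intro mult_left_mono) auto
      finally show ?thesis .
    qed
  qed
  have AC: "locally_absolutely_cont_on x {0..}"
    unfolding locally_absolutely_cont_on_def
  proof (intro allI impI)
    fix u v :: real assume "u \<le> v \<and> {u..v} \<subseteq> {0..}"
    then have "0 \<le> u" by auto
    then show "absolutely_cont_on_interval x u v"
      using x_lip by (intro AC_interval_dominated[OF AC_interval_id c']) auto
  qed
  \<comment> \<open>Besides the gluing time \<open>T\<close>, these are the crossings, where the
    time change has derivative 0 and its inverse no finite one.\<close>
  define N where "N = insert T (tm ` {\<tau>. fst (flow \<tau> z) = 0})"
  have "countable N" unfolding N_def using fst_flow_zeros_countable[OF z] by simp
  then have "N \<in> null_sets lebesgue"
    by (intro null_sets_completionI countable_imp_null_set_lborel)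
  then have ae: "AE t in lebesgue. t \<notin> N" by (rule AE_not_in)
  have sol: "\<exists>v \<in> filippov_set (error_field \<Phi> a k2 \<epsilon> (\<lambda>_. 0) t) (x t).
      (x has_vector_derivative v) (at t within {0..})" if t: "t \<ge> 0" "t \<notin> N" for t
  proof (cases "t < T")
    case False
    then have tT: "t > T" using t by (auto simp: N_def)
    have "(x has_vector_derivative 0) (at t)"
      by (rule has_vector_derivative_transform_within_open[of "\<lambda>_. 0" _ _ "{T<..}"])
        (use tT in \<open>auto simp: x_def\<close>)
    moreover have "0 \<in> filippov_set (error_field \<Phi> a k2 \<epsilon> (\<lambda>_. 0) t) 0"
    proof (rule zero_in_filippov_set_odd[of "{x. fst x = 0}"])
      have "{x :: real \<times> real. fst x = 0} = {x. (1, 0) \<bullet> x = 0}"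
        by (simp add: inner_prod_def)
      moreover have "(1, 0) \<noteq> (0 :: real \<times> real)" by (simp add: prod_eq_iff)
      ultimately show "negligible {x :: real \<times> real. fst x = 0}"
        using negligible_hyperplane by metis
      show "error_field \<Phi> a k2 \<epsilon> (\<lambda>_. 0) t (- x) = - error_field \<Phi> a k2 \<epsilon> (\<lambda>_. 0) t x"
        if "x \<notin> {x. fst x = 0}" for x
        using that \<epsilon> t(1) by (intro error_field_minus) auto
    qed
    ultimately show ?thesis using False by (auto simp: x_def intro: has_vector_derivative_at_within)
  next
    case True
    obtain \<tau> where \<tau>: "\<tau> \<ge> 0" "tm \<tau> = t" using tm_onto t True by blast
    let ?w = "fst (flow \<tau> z)" and ?v = "snd (flow \<tau> z)"
    have w: "?w \<noteq> 0" using t(2) \<tau> by (auto simp: N_def)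
    then have Gw: "G ?w > 0" by (rule slope_pos)
    have "(\<theta> has_real_derivative inverse (G ?w / \<epsilon>)) (at (tm \<tau>))"
      using Gw \<epsilon> by (intro DERIV_left_inverse tm_isCont \<theta> tm_deriv) auto
    then have \<theta>_deriv: "(\<theta> has_vector_derivative \<epsilon> / G ?w) (at t)"
      using \<tau> by (simp add: has_real_derivative_iff_has_vector_derivative)
    have "(trajectory \<epsilon> z has_vector_derivative
       (G ?w * (- a * ?w + ?v) / \<epsilon>\<^sup>2, - b * ?w / \<epsilon>)) (at (\<theta> t))"
      using trajectory_has_derivative[of \<epsilon> z \<tau>] \<theta>[of \<tau>] \<tau> by simp
    then have deriv: "(trajectory \<epsilon> z \<circ> \<theta> has_vector_derivative
       (\<epsilon> / G ?w) *\<^sub>R (G ?w * (- a * ?w + ?v) / \<epsilon>\<^sup>2, - b * ?w / \<epsilon>)) (at t)"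
      by (rule vector_diff_chain_at[OF \<theta>_deriv])
    have "(\<epsilon> / G ?w) *\<^sub>R (G ?w * (- a * ?w + ?v) / \<epsilon>\<^sup>2, - b * ?w / \<epsilon>)
       = error_field \<Phi> a k2 \<epsilon> (\<lambda>_. 0) t (trajectory \<epsilon> z \<tau>)"
    proof -
      have "\<epsilon> / G ?w * (G ?w * u / \<epsilon>\<^sup>2) = u / \<epsilon>" "\<epsilon> / G ?w * (u / \<epsilon>) = u / G ?w" for u
        using \<epsilon> Gw by (simp_all add: power2_eq_square)
      then show ?thesis
        unfolding error_field_trajectory[OF \<epsilon> w t(1) b] by (simp only: scaleR_Pair real_scaleR_def)
    qed
    also have "trajectory \<epsilon> z \<tau> = x t" using x_tm[of \<tau>] \<tau> by simp
    finally have "(trajectory \<epsilon> z \<circ> \<theta> has_vector_derivative error_field \<Phi> a k2 \<epsilon> (\<lambda>_. 0) t (x t)) (at t)"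
      using deriv by (simp only:)
    then have "(x has_vector_derivative error_field \<Phi> a k2 \<epsilon> (\<lambda>_. 0) t (x t)) (at t)"
      by (rule has_vector_derivative_transform_within_open[of _ _ _ "{..<T}"])
        (use True in \<open>auto simp: x_def\<close>)
    moreover have "isCont (error_field \<Phi> a k2 \<epsilon> (\<lambda>_. 0) t) (x t)"
      using x_tm[of \<tau>] \<tau> w \<epsilon> by (intro error_field_isCont) (auto simp: trajectory_def)
    ultimately show ?thesis
      by (intro bexI[of _ "error_field \<Phi> a k2 \<epsilon> (\<lambda>_. 0) t (x t)"] filippov_set_isCont)
        (auto intro: has_vector_derivative_at_within)
  qed
  show ?thesis
  proof
    have "filippov_solution (error_field \<Phi> a k2 \<epsilon> (\<lambda>_. 0)) x"
      unfolding filippov_solution_def using AC ae sol by auto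
    then show "error_solution \<Phi> a k2 \<epsilon> (\<lambda>_. 0) (trajectory \<epsilon> z 0) x"
      unfolding error_solution_def using x_tm[of 0] tm_0 by simp
    show "ennreal (settle z / \<epsilon>) \<le> convergence_time x"
      unfolding convergence_time_def T_def[symmetric]
    proof (rule INF_greatest)
      fix t assume "t \<in> {t. 0 \<le> t \<and> (\<forall>\<sigma>\<ge>t. x \<sigma> = 0)}"
      then have t: "0 \<le> t" "\<forall>\<sigma>\<ge>t. x \<sigma> = 0" by auto
      have "\<not> t < T"
      proof
        assume "t < T"
        then obtain \<tau> where "tm \<tau> = t" using tm_onto t by blast
        then have "trajectory \<epsilon> z \<tau> = 0" using x_tm t by auto
        then show False using trajectory_eq_0_iff \<epsilon> z by auto
      qed
      then show "ennreal T \<le> ennreal t" by (intro ennreal_leI) simp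
    qed
  qed
qed

text \<open>Every nonzero z yields an initial state whose unperturbed solution settles no earlier
  than \<open>settle z / \<epsilon>\<close>, so a global convergence time bounds the Lyapunov
  function uniformly.\<close>

lemma settle_le:
  assumes \<epsilon>: "\<epsilon> > 0" and b: "b = 2 * k2" and T: "T \<ge> 0"
    and conv: "global_convergence_time \<Phi> a k2 \<epsilon> 0 \<le> ennreal T"
  shows "settle z \<le> \<epsilon> * T"
proof (cases "z = 0")
  case False
  obtain x where x: "error_solution \<Phi> a k2 \<epsilon> (\<lambda>_. 0) (trajectory \<epsilon> z 0) x"
    "ennreal (settle z / \<epsilon>) \<le> convergence_time x"
    using unperturbed_solution[OF \<epsilon> False b] by blast
  have "convergence_time x \<le> convergence_time_function \<Phi> a k2 \<epsilon> 0 (trajectory \<epsilon> z 0)"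
    unfolding convergence_time_function_def
    by (rule SUP_upper2[of "\<lambda>_. 0"], simp add: input_signal_const, rule SUP_upper) (simp add: x)
  also have "\<dots> \<le> global_convergence_time \<Phi> a k2 \<epsilon> 0"
    unfolding global_convergence_time_def by (rule SUP_upper) simp
  finally have "ennreal (settle z / \<epsilon>) \<le> ennreal T" using x(2) conv by order
  then show ?thesis using T \<epsilon> by (simp add: ennreal_le_iff pos_divide_le_eq mult.commute)
qed (use \<epsilon> T in simp)

end

section \<open>Solutions with perturbation\<close>

lemma straddling_increment_le:
  fixes F :: "real \<Rightarrow> real"
  assumes est: "\<And>s. \<lbrakk>s \<ge> 0; \<bar>s - t\<bar> < d\<rbrakk> \<Longrightarrow> \<bar>F s - F t - q * (s - t)\<bar> \<le> e * \<bar>s - t\<bar>"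
    and uv: "0 \<le> u" "u \<le> t" "t \<le> v" "v - u < d"
  shows "F v - F u \<le> (q + e) * (v - u)"
proof -
  have "F v - F t - q * (v - t) \<le> e * (v - t)" "- (F u - F t - q * (u - t)) \<le> e * (t - u)"
    using est[of v] est[of u] uv by (auto simp: abs_le_iff)
  then show ?thesis by (simp add: algebra_simps)
qed

text \<open>With its mirror image below, this carries an increment bound up to a crossing time,
  where only continuity of the Lyapunov function is available.\<close>

lemma increment_le_open_left:
  fixes F :: "real \<Rightarrow> real"
  assumes F: "continuous_on {u..v} F" and uv: "u \<le> v"
    and le: "\<And>s. \<lbrakk>u < s; s \<le> v\<rbrakk> \<Longrightarrow> F v - F s \<le> c * (v - s)"
  shows "F v - F u \<le> c * (v - u)"
proof (cases "u = v")
  case False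
  then have uv': "u < v" using uv by simp
  have "((\<lambda>s. c * (v - s) - (F v - F s)) \<longlongrightarrow> c * (v - u) - (F v - F u)) (at_right u)"
    by (intro tendsto_intros continuous_on_Icc_at_rightD[OF F uv'])
  moreover have "\<forall>\<^sub>F s in at_right u. 0 \<le> c * (v - s) - (F v - F s)"
    using le uv' by (auto simp: eventually_at_right_field intro!: exI[of _ v])
  ultimately have "0 \<le> c * (v - u) - (F v - F u)" by (rule tendsto_lowerbound) simp
  then show ?thesis by simp
qed simp

lemma increment_le_open_right:
  fixes F :: "real \<Rightarrow> real"
  assumes F: "continuous_on {u..v} F" and uv: "u \<le> v"
    and le: "\<And>s. \<lbrakk>u \<le> s; s < v\<rbrakk> \<Longrightarrow> F s - F u \<le> c * (s - u)"
  shows "F v - F u \<le> c * (v - u)"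
proof (cases "u = v")
  case False
  then have uv': "u < v" using uv by simp
  have "((\<lambda>s. c * (s - u) - (F s - F u)) \<longlongrightarrow> c * (v - u) - (F v - F u)) (at_left v)"
    by (intro tendsto_intros continuous_on_Icc_at_leftD[OF F uv'])
  moreover have "\<forall>\<^sub>F s in at_left v. 0 \<le> c * (s - u) - (F s - F u)"
    using le uv' by (auto simp: eventually_at_left_field intro!: exI[of _ u])
  ultimately have "0 \<le> c * (v - u) - (F v - F u)" by (rule tendsto_lowerbound) simp
  then show ?thesis by simp
qed simp

lemma abs_component_diff_le:
  fixes z z' :: "real \<times> real"
  shows "\<bar>fst z - fst z'\<bar> \<le> norm (z - z')" "\<bar>snd z - snd z'\<bar> \<le> norm (z - z')"
  using norm_fst_le[of "fst (z - z')" "snd (z - z')"] norm_snd_le[of "snd (z - z')" "fst (z - z')"]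
  by (auto simp: minus_prod_def)

context settling_function
begin

lemma settle_lipschitz_norm:
  "\<bar>settle z - settle z'\<bar> \<le> (\<Lambda> * (K / \<mu>) + 1) * norm (z - z')"
proof -
  have c: "\<Lambda> * (K / \<mu>) \<ge> 0" using \<Lambda>_nonneg K_nonneg \<mu>_pos by simp
  have "\<Lambda> * (K / \<mu>) * \<bar>fst z - fst z'\<bar> + \<bar>snd z - snd z'\<bar>
      \<le> \<Lambda> * (K / \<mu>) * norm (z - z') + norm (z - z')"
    using c by (intro add_mono mult_left_mono abs_component_diff_le)
  then show ?thesis using settle_lipschitz[of z z'] by (simp add: distrib_right)
qed

lemma settle_continuous: "continuous_on S settle"
proof (rule lipschitz_on_continuous_on)
  show "(\<Lambda> * (K / \<mu>) + 1)-lipschitz_on S settle"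
    using settle_lipschitz_norm \<Lambda>_nonneg K_nonneg \<mu>_pos
    by (auto simp: lipschitz_on_def dist_norm)
qed

text \<open>A perturbation \<open>p\<close> of the second component changes the rate of decrease of \<open>settle\<close>
  by at most \<open>\<bar>p\<bar>\<close>. No differentiability of \<open>settle\<close> is needed: to first order the curve
  follows the flow, along which \<open>settle\<close> has a derivative.\<close>

lemma settle_along_curve:
  assumes \<zeta>: "(\<zeta> has_vector_derivative
        (r / G (fst (\<zeta> t)) * (- a * fst (\<zeta> t) + snd (\<zeta> t)), r / G (fst (\<zeta> t)) * (- b * fst (\<zeta> t)) + p))
        (at t within S)"
    and nz: "fst (\<zeta> t) \<noteq> 0" and \<eta>: "\<eta> > 0"
  shows "\<exists>d>0. \<forall>s\<in>S. \<bar>s - t\<bar> < d \<longrightarrow>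
     \<bar>settle (\<zeta> s) - settle (\<zeta> t) - - r * (s - t)\<bar> \<le> (\<bar>p\<bar> + \<eta>) * \<bar>s - t\<bar>"
proof -
  define c where "c = r / G (fst (\<zeta> t))"
  define C where "C = \<Lambda> * (K / \<mu>) + 1"
  have C: "C > 0" using \<Lambda>_nonneg K_nonneg \<mu>_pos by (simp add: C_def add_nonneg_pos)
  \<comment> \<open>A comparison curve with the velocity of \<zeta> at \<open>t\<close>: the flow
    run at speed \<open>c\<close>, plus a linear drift caused by the perturbation. Thus \<zeta> and
    \<open>y\<close> differ by o(s - t) only.\<close>
  define y where "y s = (fst (flow (c * (s - t)) (\<zeta> t)), snd (flow (c * (s - t)) (\<zeta> t)) + (s - t) * p)" for s
  have "((\<lambda>s. fst (flow (c * (s - t)) (\<zeta> t))) has_real_derivative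
      (- a * fst (flow (c * (t - t)) (\<zeta> t)) + snd (flow (c * (t - t)) (\<zeta> t))) * c) (at t within S)"
    by (rule DERIV_chain2[OF fst_flow_deriv]) (auto intro!: derivative_eq_intros)
  moreover have "((\<lambda>s. snd (flow (c * (s - t)) (\<zeta> t)) + (s - t) * p) has_real_derivative
      (- b * fst (flow (c * (t - t)) (\<zeta> t))) * c + p) (at t within S)"
    by (intro DERIV_add DERIV_chain2[OF snd_flow_deriv]) (auto intro!: derivative_eq_intros)
  ultimately have "(y has_vector_derivative
      ((- a * fst (flow (c * (t - t)) (\<zeta> t)) + snd (flow (c * (t - t)) (\<zeta> t))) * c,
       (- b * fst (flow (c * (t - t)) (\<zeta> t))) * c + p)) (at t within S)"
    unfolding y_def[abs_def] has_real_derivative_iff_has_vector_derivative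
    by (rule has_vector_derivative_Pair)
  then have "(y has_vector_derivative
      (c * (- a * fst (\<zeta> t) + snd (\<zeta> t)), c * (- b * fst (\<zeta> t)) + p)) (at t within S)"
    by (simp add: mult.commute)
  from has_vector_derivative_diff[OF \<zeta>[folded c_def] this]
  have "((\<lambda>s. \<zeta> s - y s) has_vector_derivative 0) (at t within S)"
    by simp
  then have "\<forall>e>0. \<exists>d>0. \<forall>s\<in>S. norm (s - t) < d \<longrightarrow>
      norm (\<zeta> s - y s - (\<zeta> t - y t) - (s - t) *\<^sub>R 0) \<le> e * norm (s - t)"
    unfolding has_vector_derivative_def has_derivative_within_alt by blast
  moreover have "\<eta> / (2 * C) > 0" using \<eta> C by simp
  moreover have "\<zeta> t - y t = 0" by (simp add: y_def)
  ultimately obtain d1 where d1: "d1 > 0"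
      "\<And>s. \<lbrakk>s \<in> S; \<bar>s - t\<bar> < d1\<rbrakk> \<Longrightarrow> norm (\<zeta> s - y s) \<le> \<eta> / (2 * C) * \<bar>s - t\<bar>"
    by (auto simp: algebra_simps)
  have "((\<lambda>s. settle (flow (c * (s - t)) (\<zeta> t))) has_real_derivative - G (fst (\<zeta> t)) * c) (at t within S)"
    by (rule DERIV_chain2[of _ _ "\<lambda>s. c * (s - t)"])
      (use settle_flow_deriv[of "\<zeta> t"] in \<open>auto intro!: derivative_eq_intros\<close>)
  moreover have "- G (fst (\<zeta> t)) * c = - r" using G_pos[OF nz] by (simp add: c_def)
  ultimately have "((\<lambda>s. settle (flow (c * (s - t)) (\<zeta> t))) has_derivative (*) (- r)) (at t within S)"
    by (simp add: has_field_derivative_def)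
  then obtain d2 where d2: "d2 > 0" "\<And>s. \<lbrakk>s \<in> S; \<bar>s - t\<bar> < d2\<rbrakk> \<Longrightarrow>
      \<bar>settle (flow (c * (s - t)) (\<zeta> t)) - settle (flow (c * (t - t)) (\<zeta> t)) - - r * (s - t)\<bar> \<le> \<eta> / 2 * \<bar>s - t\<bar>"
    using \<eta> unfolding has_derivative_within_alt real_norm_def by (metis half_gt_zero)
  show ?thesis
  proof (intro exI conjI ballI impI)
    show "min d1 d2 > 0" using d1 d2 by simp
    fix s assume s: "s \<in> S" "\<bar>s - t\<bar> < min d1 d2"
    have "\<bar>settle (\<zeta> s) - settle (y s)\<bar> \<le> C * norm (\<zeta> s - y s)"
      unfolding C_def by (rule settle_lipschitz_norm)
    also have "\<dots> \<le> C * (\<eta> / (2 * C) * \<bar>s - t\<bar>)"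
      using C d1(2)[OF s(1)] s(2) by (intro mult_left_mono) auto
    also have "\<dots> = \<eta> / 2 * \<bar>s - t\<bar>" using C by simp
    finally have 1: "\<bar>settle (\<zeta> s) - settle (y s)\<bar> \<le> \<eta> / 2 * \<bar>s - t\<bar>" .
    \<comment> \<open>These points differ in the second coordinate alone, so the sharp coefficient 1
      applies and yields exactly \<open>\<bar>p\<bar>\<close>.\<close>
    have 2: "\<bar>settle (y s) - settle (flow (c * (s - t)) (\<zeta> t))\<bar> \<le> \<bar>p\<bar> * \<bar>s - t\<bar>"
      using settle_lipschitz[of "y s" "flow (c * (s - t)) (\<zeta> t)"]
      by (simp add: y_def abs_mult mult.commute)
    have 3: "\<bar>settle (flow (c * (s - t)) (\<zeta> t)) - settle (\<zeta> t) - - r * (s - t)\<bar> \<le> \<eta> / 2 * \<bar>s - t\<bar>"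
      using d2(2)[OF s(1)] s(2) by simp
    have "(\<bar>p\<bar> + \<eta>) * \<bar>s - t\<bar> = \<eta> / 2 * \<bar>s - t\<bar> + \<bar>p\<bar> * \<bar>s - t\<bar> + \<eta> / 2 * \<bar>s - t\<bar>"
      by (simp add: algebra_simps)
    then show "\<bar>settle (\<zeta> s) - settle (\<zeta> t) - - r * (s - t)\<bar> \<le> (\<bar>p\<bar> + \<eta>) * \<bar>s - t\<bar>"
      using 1 2 3 by linarith
  qed
qed

end

locale perturbed_solution = differentiator +
  fixes \<gamma> \<epsilon> L k1 k2 :: real and f :: "real \<Rightarrow> real" and x :: "real \<Rightarrow> real \<times> real"
  assumes \<gamma>_pos: "\<gamma> > 0" and \<epsilon>_pos: "\<epsilon> > 0"
    and k1: "k1 = a * sqrt \<gamma>" and k2: "2 * k2 = b * \<gamma>"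
    and solution: "filippov_solution (error_field \<Phi> k1 k2 \<epsilon> f) x"
    and perturbation: "AE t in lebesgue. t \<ge> 0 \<longrightarrow> \<bar>time_deriv (time_deriv f) t\<bar> \<le> L"
begin

lemma x_AC: "\<lbrakk>0 \<le> u; u \<le> v\<rbrakk> \<Longrightarrow> absolutely_cont_on_interval x u v"
  using solution unfolding filippov_solution_def locally_absolutely_cont_on_def by auto

lemma x_continuous: "continuous_on {0..} x"
  using solution unfolding filippov_solution_def by (intro locally_AC_continuous) auto

lemma regular_times:
  obtains N where "negligible N"
    "\<And>t. \<lbrakk>t \<ge> 0; t \<notin> N\<rbrakk> \<Longrightarrow> \<bar>time_deriv (time_deriv f) t\<bar> \<le> L"
    "\<And>t. \<lbrakk>t \<ge> 0; t \<notin> N\<rbrakk> \<Longrightarrow> \<exists>v \<in> filippov_set (error_field \<Phi> k1 k2 \<epsilon> f t) (x t).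
       (x has_vector_derivative v) (at t within {0..})"
proof -
  have "AE t in lebesgue. t \<ge> 0 \<longrightarrow> (\<exists>v \<in> filippov_set (error_field \<Phi> k1 k2 \<epsilon> f t) (x t).
       (x has_vector_derivative v) (at t within {0..}))"
    using solution unfolding filippov_solution_def by blast
  then have "AE t in lebesgue. (t \<ge> 0 \<longrightarrow> (\<exists>v \<in> filippov_set (error_field \<Phi> k1 k2 \<epsilon> f t) (x t).
       (x has_vector_derivative v) (at t within {0..}))) \<and> (t \<ge> 0 \<longrightarrow> \<bar>time_deriv (time_deriv f) t\<bar> \<le> L)"
    using perturbation by eventually_elim blast
  then obtain N where "N \<in> null_sets lebesgue" "{t \<in> space lebesgue. \<not> ((t \<ge> 0 \<longrightarrow> (\<exists>v \<in> filippov_set (error_field \<Phi> k1 k2 \<epsilon> f t) (x t).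
       (x has_vector_derivative v) (at t within {0..}))) \<and> (t \<ge> 0 \<longrightarrow> \<bar>time_deriv (time_deriv f) t\<bar> \<le> L))} \<subseteq> N"
    unfolding eventually_ae_filter by blast
  then show ?thesis
    by (intro that[of N]) (auto simp: negligible_iff_null_sets)
qed

text \<open>Near such a time x1' stays close to x2, which is nonzero, so x1 is strictly monotone
  there. The derivative exists only almost everywhere; absolute continuity turns it into
  increments.\<close>

lemma fst_x_zero_isolated:
  assumes t: "t \<ge> 0" "fst (x t) = 0" "x t \<noteq> 0"
  obtains d where "d > 0" "\<And>s. \<lbrakk>s \<ge> 0; s \<noteq> t; \<bar>s - t\<bar> < d\<rbrakk> \<Longrightarrow> fst (x s) \<noteq> 0"
proof -
  define q where "q s = - k1 * scaled \<Phi> \<epsilon> (fst (x s)) + snd (x s)" for s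
  have "continuous_on UNIV (scaled \<Phi> \<epsilon>)"
    using scaled_isCont by (simp add: continuous_at_imp_continuous_on)
  then have "continuous_on {0..} (\<lambda>s. scaled \<Phi> \<epsilon> (fst (x s)))"
    by (rule continuous_on_compose2) (auto intro!: continuous_intros x_continuous)
  then have q_cont: "continuous_on {0..} q"
    unfolding q_def[abs_def] by (intro continuous_intros x_continuous)
  have qt: "q t = snd (x t)" using t by (simp add: q_def scaled_def)
  have nz: "snd (x t) \<noteq> 0" using t by (simp add: prod_eq_iff)
  have "\<exists>d>0. \<forall>s\<in>{0..}. dist s t < d \<longrightarrow> dist (q s) (q t) < \<bar>snd (x t)\<bar> / 2"
    using q_cont[unfolded continuous_on_iff, rule_format, of t "\<bar>snd (x t)\<bar> / 2"] t(1) nz by simp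
  then obtain d where d: "d > 0"
      "\<And>s. \<lbrakk>s \<ge> 0; \<bar>s - t\<bar> < d\<rbrakk> \<Longrightarrow> \<bar>q s - snd (x t)\<bar> < \<bar>snd (x t)\<bar> / 2"
    unfolding qt dist_real_def by auto
  \<comment> \<open>The sign treats upward and downward crossings alike:
    \<open>- \<sigma> * fst (x s)\<close> decreases at speed at least \<open>m\<close>.\<close>
  define \<sigma> where "\<sigma> = sgn (snd (x t))"
  define m where "m = \<bar>snd (x t)\<bar> / 2"
  have m: "m > 0" using nz by (simp add: m_def)
  have \<sigma>: "\<bar>\<sigma>\<bar> = 1" "\<sigma> \<noteq> 0" using nz by (auto simp: \<sigma>_def abs_sgn_eq sgn_0_0)
  have qm: "\<sigma> * q s \<ge> m" if "s \<ge> 0" "\<bar>s - t\<bar> < d" for s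
  proof (cases "snd (x t) > 0")
    case True
    then show ?thesis
      using d(2)[OF that] abs_ge_minus_self[of "q s - snd (x t)"] unfolding \<sigma>_def m_def by simp
  next
    case False
    then have "snd (x t) < 0" using nz by simp
    then show ?thesis
      using d(2)[OF that] abs_ge_self[of "q s - snd (x t)"] unfolding \<sigma>_def m_def by simp
  qed
  obtain N where N: "negligible N"
    "\<And>t. \<lbrakk>t \<ge> 0; t \<notin> N\<rbrakk> \<Longrightarrow> \<bar>time_deriv (time_deriv f) t\<bar> \<le> L"
    "\<And>t. \<lbrakk>t \<ge> 0; t \<notin> N\<rbrakk> \<Longrightarrow> \<exists>v \<in> filippov_set (error_field \<Phi> k1 k2 \<epsilon> f t) (x t).
       (x has_vector_derivative v) (at t within {0..})"
    by (rule regular_times) blast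
  have dec: "- \<sigma> * fst (x v) - - \<sigma> * fst (x u) \<le> - m * (v - u)"
    if uv: "0 \<le> u" "u \<le> v" "\<bar>u - t\<bar> < d" "\<bar>v - t\<bar> < d" for u v
  proof (rule AC_increment_le[OF uv(2) _ N(1)])
    have "norm (- \<sigma> * fst (x v') - - \<sigma> * fst (x u')) \<le> 1 * norm (x v' - x u')" for u' v'
    proof -
      have "norm (- \<sigma> * fst (x v') - - \<sigma> * fst (x u')) = \<bar>\<sigma>\<bar> * \<bar>fst (x v') - fst (x u')\<bar>"
        by (simp only: real_norm_def abs_mult abs_minus_cancel right_diff_distrib[symmetric])
      then show ?thesis using \<sigma>(1) abs_component_diff_le(1)[of "x v'" "x u'"] by (simp only: mult_1)
    qed
    then show "absolutely_cont_on_interval (\<lambda>s. - \<sigma> * fst (x s)) u v"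
      by (rule AC_interval_dominated[OF x_AC[OF uv(1,2)], rotated]) (rule zero_le_one)
    fix s \<eta> :: real assume s: "s \<in> {u..v} - N" and \<eta>: "\<eta> > 0"
    have s': "s \<ge> 0" "\<bar>s - t\<bar> < d" using s uv by (auto simp: abs_less_iff)
    obtain w where w: "w \<in> filippov_set (error_field \<Phi> k1 k2 \<epsilon> f s) (x s)"
      "(x has_vector_derivative w) (at s within {0..})" using N(3)[OF s'(1)] s by auto
    have "fst w = q s"
      using filippov_set_continuous_component[OF w(1) bounded_linear_fst error_field_fst_isCont]
      by (simp add: error_field_alt q_def)
    then have "((\<lambda>s. fst (x s)) has_vector_derivative q s) (at s within {0..})"
      using bounded_linear.has_vector_derivative[OF bounded_linear_fst w(2)] by simp
    then have "((\<lambda>s. - \<sigma> * fst (x s)) has_real_derivative - \<sigma> * q s) (at s within {0..})"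
      by (intro DERIV_cmult) (simp add: has_real_derivative_iff_has_vector_derivative)
    then have "\<exists>d>0. \<forall>r\<in>{0..}. \<bar>r - s\<bar> < d \<longrightarrow>
        \<bar>- \<sigma> * fst (x r) - - \<sigma> * fst (x s) - - \<sigma> * q s * (r - s)\<bar> \<le> \<eta> * \<bar>r - s\<bar>"
      using \<eta> unfolding has_field_derivative_def has_derivative_within_alt real_norm_def by blast
    then obtain d' where d': "d' > 0" "\<And>r. \<lbrakk>r \<ge> 0; \<bar>r - s\<bar> < d'\<rbrakk> \<Longrightarrow>
        \<bar>- \<sigma> * fst (x r) - - \<sigma> * fst (x s) - - \<sigma> * q s * (r - s)\<bar> \<le> \<eta> * \<bar>r - s\<bar>"
      by auto
    show "\<exists>d>0. \<forall>u' v'. u \<le> u' \<and> u' \<le> s \<and> s \<le> v' \<and> v' \<le> v \<and> v' - u' < d \<longrightarrow>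
        - \<sigma> * fst (x v') - - \<sigma> * fst (x u') \<le> (- m + \<eta>) * (v' - u')"
    proof (intro exI conjI allI impI)
      fix u' v' assume uv': "u \<le> u' \<and> u' \<le> s \<and> s \<le> v' \<and> v' \<le> v \<and> v' - u' < d'"
      have "- \<sigma> * fst (x v') - - \<sigma> * fst (x u') \<le> (- \<sigma> * q s + \<eta>) * (v' - u')"
        using uv' uv(1) by (intro straddling_increment_le[where t = s and d = d'] d') auto
      also have "\<dots> \<le> (- m + \<eta>) * (v' - u')"
        using qm[OF s'] uv' by (intro mult_right_mono) auto
      finally show "- \<sigma> * fst (x v') - - \<sigma> * fst (x u') \<le> (- m + \<eta>) * (v' - u')" .
    qed (rule d')
  qed
  show ?thesis
  proof (rule that[OF d(1)])
    fix s assume s: "s \<ge> 0" "s \<noteq> t" "\<bar>s - t\<bar> < d"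
    show "fst (x s) \<noteq> 0"
    proof
      assume "fst (x s) = 0"
      then have "0 \<le> - m * (t - s)" if "s \<le> t" using dec[of s t] s t d(1) that by simp
      moreover have "0 \<le> - m * (s - t)" if "t \<le> s"
        using dec[of t s] s t d(1) that \<open>fst (x s) = 0\<close> by simp
      ultimately show False using m s(2) by (cases "s \<le> t") (simp_all add: mult_le_0_iff)
    qed
  qed
qed

text \<open>The state in the coordinates of the linear flow.\<close>

definition \<zeta> :: "real \<Rightarrow> real \<times> real" where
  "\<zeta> t = (\<Phi> (\<epsilon>\<^sup>2 * fst (x t)), \<epsilon> * snd (x t) / sqrt \<gamma>)"

section \<open>The Lyapunov function along a perturbed solution\<close>

definition W :: "real \<Rightarrow> real" where "W t = settle (\<zeta> t)"

text \<open>The unperturbed decrease \<open>\<epsilon> * sqrt \<gamma>\<close> minus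
  \<open>\<epsilon> / sqrt \<gamma> * L\<close>, the largest effect of the perturbation after
  rescaling the second state.\<close>

definition rate :: real where "rate = \<epsilon> * (\<gamma> - L) / sqrt \<gamma>"

lemma W_nonneg: "W t \<ge> 0"
  by (simp add: W_def settle_nonneg)

lemma W_eq_0: "x t = 0 \<Longrightarrow> W t = 0"
proof -
  assume "x t = 0"
  then have "\<zeta> t = 0" by (simp add: \<zeta>_def zero_prod_def)
  then show ?thesis by (simp add: W_def)
qed

lemma \<zeta>_continuous: "continuous_on {0..} \<zeta>"
proof -
  have "continuous_on {0..} (\<lambda>t. \<Phi> (\<epsilon>\<^sup>2 * fst (x t)))"
    by (rule continuous_on_compose2[OF phi_continuous[of UNIV]]) (auto intro!: continuous_intros x_continuous)
  then show ?thesis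
    unfolding \<zeta>_def[abs_def] divide_inverse by (intro continuous_intros x_continuous)
qed

lemma W_continuous: "continuous_on {0..} W"
  unfolding W_def[abs_def]
  by (rule continuous_on_compose2[OF settle_continuous[of UNIV] \<zeta>_continuous]) auto

text \<open>Off x1 = 0 the field is continuous, so the Filippov velocity is the field itself. The
  chain rule for \<Phi> then produces the common factor \<open>r / G\<close>, since
  \<open>\<epsilon> * snd v / sqrt \<gamma>\<close> contains \<Phi>' too.\<close>

lemma \<zeta>_has_derivative:
  assumes nz: "fst (x t) \<noteq> 0"
    and v: "v \<in> filippov_set (error_field \<Phi> k1 k2 \<epsilon> f t) (x t)"
    and x': "(x has_vector_derivative v) (at t within {0..})"
  defines "r \<equiv> \<epsilon> * sqrt \<gamma>"
  shows "(\<zeta> has_vector_derivative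
     (r / G (fst (\<zeta> t)) * (- a * fst (\<zeta> t) + snd (\<zeta> t)),
      r / G (fst (\<zeta> t)) * (- b * fst (\<zeta> t)) + \<epsilon> / sqrt \<gamma> * time_deriv (time_deriv f) t)) (at t within {0..})"
proof -
  define y p g where "y = \<epsilon>\<^sup>2 * fst (x t)" and "p = time_deriv (time_deriv f) t" and "g = sqrt \<gamma>"
  have g: "g > 0" "\<gamma> = g * g" using \<gamma>_pos by (auto simp: g_def)
  have y: "y \<noteq> 0" using nz \<epsilon>_pos by (simp add: y_def)
  have "v = error_field \<Phi> k1 k2 \<epsilon> f t (x t)"
    using filippov_set_continuous_component[OF v bounded_linear_ident] error_field_isCont nz \<epsilon>_pos by simp
  then have v1: "fst v = - k1 * (\<Phi> y / \<epsilon>) + snd (x t)"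
    and v2: "snd v = - (2 * k2) * (\<Phi> y / \<epsilon>) * (\<epsilon> * deriv \<Phi> y) + p"
    using nz \<epsilon>_pos by (auto simp: error_field_alt scaled_def deriv_scaled y_def p_def)
  have "((\<lambda>t. fst (x t)) has_vector_derivative fst v) (at t within {0..})"
    by (rule bounded_linear.has_vector_derivative[OF bounded_linear_fst x'])
  then have x1: "((\<lambda>t. fst (x t)) has_real_derivative fst v) (at t within {0..})"
    by (simp add: has_real_derivative_iff_has_vector_derivative)
  have "((\<lambda>t. snd (x t)) has_vector_derivative snd v) (at t within {0..})"
    by (rule bounded_linear.has_vector_derivative[OF bounded_linear_snd x'])
  then have x2: "((\<lambda>t. snd (x t)) has_real_derivative snd v) (at t within {0..})"
    by (simp add: has_real_derivative_iff_has_vector_derivative)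
  have z1: "((\<lambda>t. \<Phi> (\<epsilon>\<^sup>2 * fst (x t))) has_real_derivative deriv \<Phi> y * (\<epsilon>\<^sup>2 * fst v)) (at t within {0..})"
    using phi_deriv[OF y] unfolding y_def by (rule DERIV_chain2) (rule DERIV_cmult[OF x1])
  have z2: "((\<lambda>t. \<epsilon> * snd (x t) / sqrt \<gamma>) has_real_derivative \<epsilon> * snd v / sqrt \<gamma>) (at t within {0..})"
    by (intro DERIV_cdivide DERIV_cmult x2)
  have "(\<zeta> has_vector_derivative (deriv \<Phi> y * (\<epsilon>\<^sup>2 * fst v), \<epsilon> * snd v / sqrt \<gamma>)) (at t within {0..})"
    using z1 z2 unfolding \<zeta>_def[abs_def] has_real_derivative_iff_has_vector_derivative
    by (rule has_vector_derivative_Pair)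
  moreover have rG: "r / G (fst (\<zeta> t)) = \<epsilon> * g * deriv \<Phi> y"
    using slope_phi[OF y] by (simp add: r_def \<zeta>_def y_def g_def)
  moreover have \<zeta>: "fst (\<zeta> t) = \<Phi> y" "snd (\<zeta> t) = \<epsilon> * snd (x t) / g"
    by (simp_all add: \<zeta>_def y_def g_def)
  moreover have "deriv \<Phi> y * (\<epsilon>\<^sup>2 * fst v) = \<epsilon> * g * deriv \<Phi> y * (- a * fst (\<zeta> t) + snd (\<zeta> t))"
  proof -
    have "k1 = a * g" by (simp add: k1 g_def)
    then show ?thesis
      using g(1) \<epsilon>_pos unfolding v1 \<zeta> by (simp add: field_simps power2_eq_square)
  qed
  moreover have "\<epsilon> * snd v / sqrt \<gamma> = \<epsilon> * g * deriv \<Phi> y * (- b * fst (\<zeta> t)) + \<epsilon> / sqrt \<gamma> * p"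
    using g(1) \<epsilon>_pos unfolding v2 k2 \<zeta> g_def[symmetric] by (simp add: field_simps g(2))
  ultimately show ?thesis by (simp only: p_def)
qed

lemma W_near_regular_time:
  assumes nz: "fst (x t) \<noteq> 0" and p: "\<bar>time_deriv (time_deriv f) t\<bar> \<le> L"
    and v: "v \<in> filippov_set (error_field \<Phi> k1 k2 \<epsilon> f t) (x t)"
    and x': "(x has_vector_derivative v) (at t within {0..})" and \<eta>: "\<eta> > 0"
  shows "\<exists>d>0. \<forall>u v. 0 \<le> u \<and> u \<le> t \<and> t \<le> v \<and> v - u < d \<longrightarrow> W v - W u \<le> (- rate + \<eta>) * (v - u)"
proof -
  let ?p = "\<epsilon> / sqrt \<gamma> * time_deriv (time_deriv f) t"
  have "fst (\<zeta> t) \<noteq> 0"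
    using nz \<epsilon>_pos strict_mono_eq[OF phi_strict_mono, of _ 0] by (simp add: \<zeta>_def)
  from settle_along_curve[OF \<zeta>_has_derivative[OF nz v x'] this \<eta>]
  obtain d where d: "d > 0" "\<And>s. \<lbrakk>s \<ge> 0; \<bar>s - t\<bar> < d\<rbrakk> \<Longrightarrow>
      \<bar>W s - W t - - (\<epsilon> * sqrt \<gamma>) * (s - t)\<bar> \<le> (\<bar>?p\<bar> + \<eta>) * \<bar>s - t\<bar>"
    unfolding W_def by auto
  show ?thesis
  proof (intro exI conjI allI impI)
    fix u v assume uv: "0 \<le> u \<and> u \<le> t \<and> t \<le> v \<and> v - u < d"
    have "W v - W u \<le> (- (\<epsilon> * sqrt \<gamma>) + (\<bar>?p\<bar> + \<eta>)) * (v - u)"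
      using uv by (intro straddling_increment_le[where t = t and d = d] d) auto
    also have "\<dots> \<le> (- rate + \<eta>) * (v - u)"
    proof (rule mult_right_mono)
      have "\<bar>?p\<bar> = \<epsilon> / sqrt \<gamma> * \<bar>time_deriv (time_deriv f) t\<bar>"
        using \<epsilon>_pos \<gamma>_pos by (simp add: abs_mult)
      also have "\<dots> \<le> \<epsilon> / sqrt \<gamma> * L"
        using p \<epsilon>_pos \<gamma>_pos by (intro mult_left_mono) auto
      also have "\<dots> = \<epsilon> * sqrt \<gamma> - rate"
        using \<gamma>_pos by (simp add: rate_def field_simps)
      finally show "- (\<epsilon> * sqrt \<gamma>) + (\<bar>?p\<bar> + \<eta>) \<le> - rate + \<eta>" by simp
    qed (use uv in auto)
    finally show "W v - W u \<le> (- rate + \<eta>) * (v - u)" .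
  qed (rule d)
qed

text \<open>On a time interval without crossings x1 ranges over a compact interval avoiding 0, on
  which \<Phi>' is bounded. The constant \<open>c\<close> deteriorates near crossings, but it only
  serves to make \<open>W\<close> absolutely continuous.\<close>

lemma W_dominated:
  assumes uv: "0 \<le> u" "u \<le> v" and nz: "\<And>t. t \<in> {u..v} \<Longrightarrow> fst (x t) \<noteq> 0"
  obtains c where "c \<ge> 0" "\<And>s t. \<lbrakk>s \<in> {u..v}; t \<in> {u..v}\<rbrakk> \<Longrightarrow> \<bar>W t - W s\<bar> \<le> c * norm (x t - x s)"
proof -
  define J where "J = (\<lambda>t. \<epsilon>\<^sup>2 * fst (x t)) ` {u..v}"
  have "continuous_on {u..v} x"
    using x_continuous uv by (rule_tac continuous_on_subset) auto
  then have cont: "continuous_on {u..v} (\<lambda>t. \<epsilon>\<^sup>2 * fst (x t))"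
    by (intro continuous_intros)
  have "compact J" unfolding J_def by (intro compact_continuous_image cont compact_Icc)
  moreover have "connected J" unfolding J_def by (intro connected_continuous_image cont connected_Icc)
  ultimately have J: "compact J" "convex J"
    by (simp_all add: is_interval_convex is_interval_connected_1)
  have in_J: "\<epsilon>\<^sup>2 * fst (x t) \<in> J" if "t \<in> {u..v}" for t
    unfolding J_def using that by (rule imageI)
  have J0: "0 \<notin> J" using nz \<epsilon>_pos by (auto simp: J_def)
  have "isCont (deriv \<Phi>) y" if "y \<in> J" for y
    using that J0 by (intro DERIV_isCont[OF deriv_deriv]) auto
  then have "continuous_on J (deriv \<Phi>)" by (simp add: continuous_at_imp_continuous_on)
  then have "bounded (deriv \<Phi> ` J)"
    using J(1) by (intro compact_imp_bounded compact_continuous_image)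
  then obtain B where B: "B > 0" "\<And>y. y \<in> J \<Longrightarrow> \<bar>deriv \<Phi> y\<bar> \<le> B"
    unfolding bounded_pos real_norm_def by blast
  define c1 where "c1 = 2 * D * (K / \<mu>)"
  have c1: "c1 \<ge> 0" using D_pos K_nonneg \<mu>_pos by (simp add: c1_def)
  have sg: "sqrt \<gamma> > 0" using \<gamma>_pos by simp
  show ?thesis
  proof
    show "c1 * (B * \<epsilon>\<^sup>2) + \<epsilon> / sqrt \<gamma> \<ge> 0"
      using c1 B(1) \<epsilon>_pos sg by (intro add_nonneg_nonneg mult_nonneg_nonneg divide_nonneg_nonneg) auto
    fix s t assume st: "s \<in> {u..v}" "t \<in> {u..v}"
    have "norm (\<Phi> (\<epsilon>\<^sup>2 * fst (x t)) - \<Phi> (\<epsilon>\<^sup>2 * fst (x s))) \<le> B * norm (\<epsilon>\<^sup>2 * fst (x t) - \<epsilon>\<^sup>2 * fst (x s))"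
    proof (rule field_differentiable_bound[where f = \<Phi> and f' = "deriv \<Phi>", OF J(2)])
      show "(\<Phi> has_real_derivative deriv \<Phi> y) (at y within J)" if "y \<in> J" for y
        by (rule has_field_derivative_at_within[OF phi_deriv]) (use that J0 in auto)
      show "norm (deriv \<Phi> y) \<le> B" if "y \<in> J" for y using B(2)[OF that] by simp
    qed (rule in_J[OF st(2)], rule in_J[OF st(1)])
    also have "norm (\<epsilon>\<^sup>2 * fst (x t) - \<epsilon>\<^sup>2 * fst (x s)) = \<epsilon>\<^sup>2 * \<bar>fst (x t) - fst (x s)\<bar>"
      by (simp only: real_norm_def abs_mult abs_power2 right_diff_distrib[symmetric])
    also have "B * (\<epsilon>\<^sup>2 * \<bar>fst (x t) - fst (x s)\<bar>) \<le> B * (\<epsilon>\<^sup>2 * norm (x t - x s))"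
      using B(1) abs_component_diff_le(1) by (intro mult_left_mono) auto
    finally have 1: "\<bar>fst (\<zeta> t) - fst (\<zeta> s)\<bar> \<le> B * \<epsilon>\<^sup>2 * norm (x t - x s)"
      by (simp add: \<zeta>_def mult.assoc)
    have "\<bar>snd (\<zeta> t) - snd (\<zeta> s)\<bar> = \<epsilon> / sqrt \<gamma> * \<bar>snd (x t) - snd (x s)\<bar>"
    proof -
      have "snd (\<zeta> t) - snd (\<zeta> s) = \<epsilon> / sqrt \<gamma> * (snd (x t) - snd (x s))"
        by (simp add: \<zeta>_def right_diff_distrib)
      moreover have "\<bar>\<epsilon> / sqrt \<gamma>\<bar> = \<epsilon> / sqrt \<gamma>" using \<epsilon>_pos sg by simp
      ultimately show ?thesis by (simp only: abs_mult)
    qed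
    also have "\<dots> \<le> \<epsilon> / sqrt \<gamma> * norm (x t - x s)"
      using \<epsilon>_pos sg abs_component_diff_le(2) by (intro mult_left_mono) auto
    finally have 2: "\<bar>snd (\<zeta> t) - snd (\<zeta> s)\<bar> \<le> \<epsilon> / sqrt \<gamma> * norm (x t - x s)" .
    have "\<bar>W t - W s\<bar> \<le> c1 * \<bar>fst (\<zeta> t) - fst (\<zeta> s)\<bar> + \<bar>snd (\<zeta> t) - snd (\<zeta> s)\<bar>"
      unfolding W_def c1_def by (rule settle_lipschitz)
    also have "\<dots> \<le> c1 * (B * \<epsilon>\<^sup>2 * norm (x t - x s)) + \<epsilon> / sqrt \<gamma> * norm (x t - x s)"
      using 1 2 c1 by (intro add_mono mult_left_mono)
    finally show "\<bar>W t - W s\<bar> \<le> (c1 * (B * \<epsilon>\<^sup>2) + \<epsilon> / sqrt \<gamma>) * norm (x t - x s)"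
      by (simp add: algebra_simps)
  qed
qed

lemma W_decrease_off_zeros:
  assumes uv: "0 \<le> u" "u \<le> v" and nz: "\<And>t. t \<in> {u..v} \<Longrightarrow> fst (x t) \<noteq> 0"
  shows "W v - W u \<le> - rate * (v - u)"
proof -
  obtain c where c: "c \<ge> 0" "\<And>s t. \<lbrakk>s \<in> {u..v}; t \<in> {u..v}\<rbrakk> \<Longrightarrow> \<bar>W t - W s\<bar> \<le> c * norm (x t - x s)"
    using W_dominated[OF uv nz] by blast
  obtain N where N: "negligible N"
    "\<And>t. \<lbrakk>t \<ge> 0; t \<notin> N\<rbrakk> \<Longrightarrow> \<bar>time_deriv (time_deriv f) t\<bar> \<le> L"
    "\<And>t. \<lbrakk>t \<ge> 0; t \<notin> N\<rbrakk> \<Longrightarrow> \<exists>v \<in> filippov_set (error_field \<Phi> k1 k2 \<epsilon> f t) (x t).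
       (x has_vector_derivative v) (at t within {0..})"
    by (rule regular_times) blast
  show ?thesis
  proof (rule AC_increment_le[OF uv(2) _ N(1)])
    show "absolutely_cont_on_interval W u v"
      using c by (intro AC_interval_dominated[OF x_AC[OF uv] c(1)]) auto
    fix t \<eta> :: real assume t: "t \<in> {u..v} - N" and \<eta>: "\<eta> > 0"
    then have t0: "t \<ge> 0" "t \<notin> N" using uv by auto
    obtain w where w: "w \<in> filippov_set (error_field \<Phi> k1 k2 \<epsilon> f t) (x t)"
      "(x has_vector_derivative w) (at t within {0..})" using N(3)[OF t0] by blast
    obtain d where "d > 0"
      "\<forall>u v. 0 \<le> u \<and> u \<le> t \<and> t \<le> v \<and> v - u < d \<longrightarrow> W v - W u \<le> (- rate + \<eta>) * (v - u)"
      using W_near_regular_time[OF _ N(2)[OF t0] w \<eta>] nz t by blast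
    then show "\<exists>d>0. \<forall>u' v'. u \<le> u' \<and> u' \<le> t \<and> t \<le> v' \<and> v' \<le> v \<and> v' - u' < d \<longrightarrow>
        W v' - W u' \<le> (- rate + \<eta>) * (v' - u')"
      using uv(1) by (intro exI[of _ d]) auto
  qed
qed

lemma W_continuous_Icc: "0 \<le> u \<Longrightarrow> continuous_on {u..v} W"
  by (rule continuous_on_subset[OF W_continuous]) auto

text \<open>Each time has a neighbourhood in which it is the only possible crossing. Splitting there
  and passing to one-sided limits gives the local bound, which compactness makes global.\<close>

lemma W_decrease:
  assumes uv: "0 \<le> u" "u \<le> v" and nz: "\<And>t. t \<in> {u..v} \<Longrightarrow> x t \<noteq> 0"
  shows "W v - W u \<le> - rate * (v - u)"
proof (rule increment_le_of_local[OF uv(2)])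
  fix t assume t: "t \<in> {u..v}"
  have "\<exists>d>0. \<forall>s. s \<ge> 0 \<and> s \<noteq> t \<and> \<bar>s - t\<bar> < d \<longrightarrow> fst (x s) \<noteq> 0"
  proof (cases "fst (x t) = 0")
    case True
    show ?thesis
      by (rule fst_x_zero_isolated[OF _ True nz[OF t]]) (use t uv in auto)
  next
    case False
    have "continuous_on {0..} (\<lambda>s. fst (x s))" by (intro continuous_intros x_continuous)
    from this[unfolded continuous_on_iff dist_real_def, rule_format, of t "\<bar>fst (x t)\<bar>"]
    obtain d where d: "d > 0" "\<forall>s\<in>{0..}. \<bar>s - t\<bar> < d \<longrightarrow> \<bar>fst (x s) - fst (x t)\<bar> < \<bar>fst (x t)\<bar>"
      using t uv False by auto
    have "fst (x s) \<noteq> 0" if "s \<ge> 0" "\<bar>s - t\<bar> < d" for s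
      using d(2) that by force
    then show ?thesis using d(1) by blast
  qed
  then obtain d where d: "d > 0" "\<And>s. \<lbrakk>s \<ge> 0; s \<noteq> t; \<bar>s - t\<bar> < d\<rbrakk> \<Longrightarrow> fst (x s) \<noteq> 0"
    by blast
  show "\<exists>d>0. \<forall>u' v'. u \<le> u' \<and> u' \<le> t \<and> t \<le> v' \<and> v' \<le> v \<and> v' - u' < d \<longrightarrow>
      W v' - W u' \<le> - rate * (v' - u')"
  proof (intro exI conjI allI impI)
    fix u' v' assume uv': "u \<le> u' \<and> u' \<le> t \<and> t \<le> v' \<and> v' \<le> v \<and> v' - u' < d"
    have "W v' - W t \<le> - rate * (v' - t)"
    proof (rule increment_le_open_left)
      show "continuous_on {t..v'} W" using uv uv' by (intro W_continuous_Icc) simp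
      show "W v' - W s \<le> - rate * (v' - s)" if "t < s" "s \<le> v'" for s
        using that uv uv' by (intro W_decrease_off_zeros d(2)) auto
    qed (use uv' in simp)
    moreover have "W t - W u' \<le> - rate * (t - u')"
    proof (rule increment_le_open_right)
      show "continuous_on {u'..t} W" using uv uv' by (intro W_continuous_Icc) simp
      show "W s - W u' \<le> - rate * (s - u')" if "u' \<le> s" "s < t" for s
        using that uv uv' by (intro W_decrease_off_zeros d(2)) auto
    qed (use uv' in simp)
    ultimately show "W v' - W u' \<le> - rate * (v' - u')" by (simp add: algebra_simps)
  qed (rule d)
qed

text \<open>A state nonzero at \<open>t\<close> has been nonzero since time 0 or since the last
  visit to the origin. In the first case \<open>W\<close> starts at most at \<open>rate * T\<close>,
  in the second at 0; either way it would be negative at \<open>t\<close>. The second case also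
  shows that the origin is never left again.\<close>

lemma reaches_origin:
  assumes rate: "rate > 0" and bound: "\<And>z. settle z \<le> rate * T" and t: "0 \<le> T" "T < t"
  shows "x t = 0"
proof (rule ccontr)
  assume nz: "x t \<noteq> 0"
  define Z where "Z = {s \<in> {0..t}. x s = 0}"
  show False
  proof (cases "Z = {}")
    case True
    then have "W t - W 0 \<le> - rate * (t - 0)"
      using t by (intro W_decrease) (auto simp: Z_def)
    moreover have "W 0 \<le> rate * T" by (simp add: W_def bound)
    moreover have "rate * T < rate * t" using rate t by simp
    ultimately show False using W_nonneg[of t] by simp
  next
    case False
    have "closed Z"
    proof -
      have "continuous_on {0..t} x" by (rule continuous_on_subset[OF x_continuous]) auto
      then have "closed ({0..t} \<inter> x -` {0})"
        by (intro continuous_closed_preimage) auto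
      moreover have "{0..t} \<inter> x -` {0} = Z" by (auto simp: Z_def)
      ultimately show ?thesis by simp
    qed
    moreover have bdd: "bdd_above Z" by (auto simp: Z_def bdd_above_def)
    ultimately have s: "Sup Z \<in> Z" using False by (intro closed_contains_Sup)
    define s where "s = Sup Z"
    have s: "0 \<le> s" "s \<le> t" "x s = 0" using s by (auto simp: Z_def s_def)
    have st: "s < t" using s nz by (cases "s = t") auto
    have later: "x r \<noteq> 0" if "s < r" "r \<le> t" for r
      using that cSup_upper[OF _ bdd, of r] s by (auto simp: Z_def s_def)
    have "W t - W s \<le> - rate * (t - s)"
    proof (rule increment_le_open_left)
      show "continuous_on {s..t} W" using s by (intro W_continuous_Icc)
      show "W t - W r \<le> - rate * (t - r)" if "s < r" "r \<le> t" for r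
        using that s later by (intro W_decrease) auto
    qed (use s in simp)
    moreover have "rate * (t - s) > 0" using rate st by simp
    ultimately show False using W_nonneg[of t] W_eq_0[OF s(3)] by simp
  qed
qed

lemma convergence_time_le:
  assumes rate: "rate > 0" and bound: "\<And>z. settle z \<le> rate * T" and T: "0 \<le> T"
  shows "convergence_time x \<le> ennreal T"
proof -
  \<comment> \<open>\<open>reaches_origin\<close> covers times strictly after \<open>T\<close> only;
    right-continuity adds \<open>T\<close> itself.\<close>
  have "x T = 0"
  proof (rule tendsto_unique[of "at_right T"])
    have "continuous_on {T..T+1} x" using T by (intro continuous_on_subset[OF x_continuous]) auto
    then show "(x \<longlongrightarrow> x T) (at_right T)" by (rule continuous_on_Icc_at_rightD) simp
    have "\<forall>\<^sub>F t in at_right T. 0 = x t"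
      using reaches_origin[OF rate bound T] by (auto simp: eventually_at_right_field intro!: exI[of _ "T + 1"])
    then show "(x \<longlongrightarrow> 0) (at_right T)"
      by (rule Lim_transform_eventually[OF tendsto_const])
  qed simp
  then have "x t = 0" if "t \<ge> T" for t
    using reaches_origin[OF rate bound T] that by (cases "t = T") auto
  then show ?thesis
    unfolding convergence_time_def using T by (intro INF_lower) auto
qed

end

section \<open>The scaled differentiator\<close>

text \<open>With a = k1 and b = 2 k2 the discriminant condition 4 b \<le> a^2 is the case
  distinction of \<open>L_bar\<close>, and the left-hand side is 1 / L_bar in both cases.\<close>

lemma curvature_oscillator_mass_le:
  assumes L: "L_bar D k1 k2 \<ge> 1" and D: "D \<ge> 1" and k: "k1 > 0" "k2 > 0"
  shows "2 * D * oscillator_mass k1 (2 * k2) \<le> 1"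
proof (cases "k1\<^sup>2 \<ge> 8 * k2")
  case True
  then have "1 \<le> k2 / D" using L by (simp add: L_bar_def)
  then have "D \<le> k2" using D by (simp add: pos_le_divide_eq)
  then show ?thesis using True k by (simp add: oscillator_mass_def)
next
  case False
  define \<theta> where "\<theta> = tanh (pi * k1 / (2 * sqrt (8 * k2 - k1\<^sup>2)))"
  have "pi * k1 / (2 * sqrt (8 * k2 - k1\<^sup>2)) > 0"
    using False k by (intro divide_pos_pos mult_pos_pos) auto
  then have \<theta>: "\<theta> > 0" by (simp add: \<theta>_def)
  have "1 \<le> k2 / D * \<theta>" using L False by (simp add: L_bar_def \<theta>_def)
  then have "D \<le> k2 * \<theta>" using D by (simp add: pos_le_divide_eq)
  moreover have "oscillator_mass k1 (2 * k2) = 1 / (2 * k2 * \<theta>)"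
    using False by (simp add: oscillator_mass_def \<theta>_def)
  ultimately show ?thesis using k \<theta> by (simp add: pos_divide_le_eq)
qed

theorem theorem4p8:
  fixes \<Phi> :: "real \<Rightarrow> real"
    and L T T' \<gamma> k1' k2' k3' k1 k2 k3 :: real
  assumes "L \<ge> 0" and "T > 0"
    and "admissible_DGF \<Phi>"
    and "normalized \<Phi> k1' k2' k3'"
    and "T' > 0"
    and "global_convergence_time \<Phi> k1' k2' k3' 0 \<le> ennreal T'"
    and "\<gamma> > L"
    and "k1 = k1' * sqrt \<gamma>"
    and "k2 = k2' * \<gamma>"
    and "k3 = k3' * sqrt \<gamma> / (\<gamma> - L) * (T' / T)"
  shows "global_convergence_time \<Phi> k1 k2 k3 L \<le> ennreal T"
proof -
  \<comment> \<open>The same \<open>D\<close> has to satisfy (c) and make \<open>L_bar\<close> at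
    least 1, so it is taken from the normalization.\<close>
  obtain D where k': "k1' > 0" "k2' > 0" "k3' > 0"
    and D: "curvature_bound \<Phi> D" "L_bar D k1' k2' \<ge> 1"
    using \<open>normalized \<Phi> k1' k2' k3'\<close> unfolding normalized_def by blast
  obtain C where "DGF \<Phi>" "C > 0" "\<forall>x. x \<noteq> 0 \<longrightarrow> C * deriv \<Phi> x \<ge> 1"
    using \<open>admissible_DGF \<Phi>\<close> unfolding admissible_DGF_def by blast
  then interpret bounded_DGF \<Phi> C D
    using D(1) by unfold_locales auto
  obtain h h' K \<mu> where osc: "damped_oscillator k1' (2 * k2') h h' K \<mu>"
    and mass: "\<And>R. R \<ge> 0 \<Longrightarrow> integral {0..R} (\<lambda>\<tau>. \<bar>h \<tau>\<bar>) \<le> oscillator_mass k1' (2 * k2')"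
    using damped_oscillator_exists[of k1' "2 * k2'"] k' by auto
  interpret damped_oscillator k1' "2 * k2'" h h' K \<mu> by (rule osc)
  interpret differentiator \<Phi> C D k1' "2 * k2'" h h' K \<mu>
  proof
    fix R :: real assume "R \<ge> 0"
    then have "2 * D * integral {0..R} (\<lambda>\<tau>. \<bar>h \<tau>\<bar>) \<le> 2 * D * oscillator_mass k1' (2 * k2')"
      using mass D_pos by (intro mult_left_mono) auto
    also have "\<dots> \<le> 1"
      using D k' by (intro curvature_oscillator_mass_le) (auto simp: curvature_bound_def)
    finally show "2 * D * integral {0..R} (\<lambda>\<tau>. \<bar>h \<tau>\<bar>) \<le> 1" .
  qed
  have \<gamma>: "\<gamma> > 0" "\<gamma> - L > 0" using assms(1,7) by auto
  have k3: "k3 > 0" using \<gamma> k' assms(2,5,10) by simp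
  \<comment> \<open>The choice of \<open>k3\<close> is made for this identity: during
    \<open>T\<close> the decrease amounts to k3' T', the bound that \<open>settle_le\<close> gives
    for the initial value.\<close>
  have rate: "k3 * (\<gamma> - L) / sqrt \<gamma> = k3' * T' / T"
    using \<gamma> by (simp add: assms(10))
  have settle: "settle z \<le> k3 * (\<gamma> - L) / sqrt \<gamma> * T" for z
    using settle_le[OF k'(3) refl _ assms(6)] assms(2,5) unfolding rate by simp
  have "convergence_time x \<le> ennreal T"
    if f: "input_signal L f" and x: "error_solution \<Phi> k1 k2 k3 f x0 x" for f x0 x
  proof -
    interpret perturbed_solution \<Phi> C D k1' "2 * k2'" h h' K \<mu> \<gamma> k3 L k1 k2 f x
    proof
      show "AE t in lebesgue. 0 \<le> t \<longrightarrow> \<bar>time_deriv (time_deriv f) t\<bar> \<le> L"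
        using f unfolding input_signal_def by (auto elim: AE_mp)
      show "filippov_solution (error_field \<Phi> k1 k2 k3 f) x"
        using x by (simp add: error_solution_def)
    qed (use \<gamma> k3 assms(8,9) in auto)
    show ?thesis
      using settle \<gamma> k3 assms(2) by (intro convergence_time_le) (auto simp: rate_def)
  qed
  then show ?thesis
    unfolding global_convergence_time_def convergence_time_function_def
    by (intro SUP_least) auto
qed

end
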